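(* Let $(R,\mathfrak{m})$ be a (Noetherian) local ring of dimension $d$. Let $J\subset I$ be ideals of $R$ such that $J$ is a reduction of $I$ and $\ell(I/J)<\infty$. Let $M=\mathcal{R}(I)/\mathcal{R}(J)=\bigoplus_{n=0}^{\infty}I^n/J^n$, regarded as a module over $\mathcal{R}(J)$. Then $H(I/J,n)=\ell(I^n/J^n)$ is a polynomial function of $n$ (for $n\gg 0$) of degree $\dim M-1$.
   Context: $\mathcal{R}(I)=\bigoplus_{n\ge0}I^n$ denotes the Rees algebra of $I$. An ideal $J\subset I$ is a reduction of $I$ if $JI^n=I^{n+1}$ for some positive integer $n$. Convention: the zero polynomial has degree $-1$; if $M=0$ the assertion just means that the polynomial is zero. *)

theory Defs
  imports
    "HOL-Library.Extended_Real"
    "HOL-Computational_Algebra.Polynomial"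
    "HOL-Algebra.Ideal_Product"
    "HOL-Algebra.Ring_Divisibility"
    "HOL-Algebra.UnivPoly"
begin

definition local_ring :: "('a, 'b) ring_scheme \<Rightarrow> 'a set \<Rightarrow> bool" where
  "local_ring R \<mm> \<longleftrightarrow>
     cring R \<and> maximalideal \<mm> R \<and> (\<forall>\<nn>. maximalideal \<nn> R \<longrightarrow> \<nn> = \<mm>)"

text \<open>The unit of \<^const>\<open>ideals_set\<close> is the unit ideal, so the zeroth power is the whole ring.\<close>

abbreviation ideal_pow :: "('a, 'b) ring_scheme \<Rightarrow> 'a set \<Rightarrow> nat \<Rightarrow> 'a set" where
  "ideal_pow R I n \<equiv> I [^]\<^bsub>ideals_set R\<^esub> n"

definition is_reduction :: "('a, 'b) ring_scheme \<Rightarrow> 'a set \<Rightarrow> 'a set \<Rightarrow> bool" where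
  "is_reduction R J I \<longleftrightarrow>
     ideal J R \<and> ideal I R \<and> J \<subseteq> I \<and>
     (\<exists>n>0. ideal_prod R J (ideal_pow R I n) = ideal_pow R I (n + 1))"

text \<open>The Rees algebra, realised as the subring of \<open>R[t]\<close> whose elements have their
  \<open>n\<close>-th coefficient in the \<open>n\<close>-th power of the ideal.\<close>

definition rees_algebra :: "('a, 'b) ring_scheme \<Rightarrow> 'a set \<Rightarrow> ('a, nat \<Rightarrow> 'a) up_ring" where
  "rees_algebra R I =
     (UP R)\<lparr>carrier := {p \<in> carrier (UP R). \<forall>n. up_ring.coeff (UP R) p n \<in> ideal_pow R I n}\<rparr>"

text \<open>A subset \<open>H\<close> of a ring \<open>S\<close> as a module, scalars from \<open>S\<close> (or from a subring of \<open>S\<close>)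
  acting by the multiplication of \<open>S\<close>. The ring of scalars is not part of the record: it is the
  first argument of \<^const>\<open>module\<close>, \<^const>\<open>submodule\<close> and of the invariants below.\<close>

definition mult_module :: "('a, 'b) ring_scheme \<Rightarrow> 'a set \<Rightarrow> ('a, 'a) module" where
  "mult_module S H =
     \<lparr>carrier = H, mult = monoid.mult S, one = monoid.one S, zero = ring.zero S, add = ring.add S, smult = monoid.mult S\<rparr>"

text \<open>The fields \<open>mult\<close> and \<open>one\<close> are inherited from the ring record and play no role for
  modules, hence are left unspecified.\<close>

definition quot_module :: "('r, 'a, 'c) module_scheme \<Rightarrow> 'a set \<Rightarrow> ('r, 'a set) module" where
  "quot_module M N =
     \<lparr>carrier = a_rcosets\<^bsub>M\<^esub> N, mult = undefined, one = undefined, zero = N, add = set_add M,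
      smult = (\<lambda>r X. \<Union>x\<in>X. N +>\<^bsub>M\<^esub> (r \<odot>\<^bsub>M\<^esub> x))\<rparr>"

definition module_length ::
  "('r, 'b) ring_scheme \<Rightarrow> ('r, 'a, 'c) module_scheme \<Rightarrow> enat" where
  "module_length R M =
     (SUP n \<in> {n. \<exists>N. (\<forall>i\<le>n. submodule (N i) R M) \<and> (\<forall>i<n. N i \<subset> N (Suc i)) \<and>
                      N 0 = {\<zero>\<^bsub>M\<^esub>} \<and> N n = carrier M}. enat n)"

text \<open>Extended reals are used only so that the zero ring gets dimension \<open>-\<infinity>\<close>.\<close>

definition krull_dim :: "('a, 'b) ring_scheme \<Rightarrow> ereal" where
  "krull_dim R =
     (SUP n \<in> {n. \<exists>P. (\<forall>i\<le>n. primeideal (P i) R) \<and> (\<forall>i<n. P i \<subset> P (Suc i))}. ereal (real n))"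

definition annihilator ::
  "('r, 'b) ring_scheme \<Rightarrow> ('r, 'a, 'c) module_scheme \<Rightarrow> 'r set" where
  "annihilator R M = {r \<in> carrier R. \<forall>x\<in>carrier M. r \<odot>\<^bsub>M\<^esub> x = \<zero>\<^bsub>M\<^esub>}"

definition module_dim ::
  "('r, 'b) ring_scheme \<Rightarrow> ('r, 'a, 'c) module_scheme \<Rightarrow> ereal" where
  "module_dim R M = krull_dim (R Quot (annihilator R M))"

text \<open>The quotient of \<open>\<R>(I)\<close> by \<open>\<R>(J)\<close>, to be regarded as a module over \<open>\<R>(J)\<close>.\<close>

definition rees_quotient ::
  "('a, 'b) ring_scheme \<Rightarrow> 'a set \<Rightarrow> 'a set \<Rightarrow> (nat \<Rightarrow> 'a, (nat \<Rightarrow> 'a) set) module" where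
  "rees_quotient R I J =
     quot_module (mult_module (UP R) (carrier (rees_algebra R I))) (carrier (rees_algebra R J))"

text \<open>The quotient of two ideals \<open>J \<subseteq> I\<close> as an \<open>R\<close>-module.\<close>

definition ideal_quotient ::
  "('a, 'b) ring_scheme \<Rightarrow> 'a set \<Rightarrow> 'a set \<Rightarrow> ('a, 'a set) module" where
  "ideal_quotient R I J = quot_module (mult_module R I) J"

text \<open>The degree with the convention that the zero polynomial has degree \<open>-1\<close>
  (\<^const>\<open>Polynomial.degree\<close> gives it degree 0).\<close>

definition poly_deg :: "'a::zero poly \<Rightarrow> int" where
  "poly_deg p = (if p = 0 then -1 else int (Polynomial.degree p))"

end

theory Submission
  imports
    Defs
    "HOL-Algebra.Subrings"
begin

text \<open>Graded modules between \<open>\<R>(J)\<close> and \<open>\<R>(I)\<close> are sequences of ideals of \<open>R\<close>. A prime filtration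
  writes the Hilbert function of \<open>M\<close> as a sum of shifted Hilbert functions of rings \<open>A / P\<close>, where
  \<open>A = \<R>(J)\<close> and \<open>P\<close> is a homogeneous prime of \<open>A\<close> over \<open>\<mm>\<close>. By Noetherian induction on \<open>P\<close>, dividing
  by a form of degree 1 outside \<open>P\<close>, the Hilbert function of \<open>A / P\<close> is a polynomial, and some
  chain of homogeneous primes above \<open>P\<close> has length its degree plus 1.

  Conversely let \<open>q\<^sub>0 \<subset> \<dots> \<subset> q\<^sub>l\<close> be primes of \<open>A\<close> over \<open>\<mm>\<close>, homogeneous or not. Multiplication by an
  element of \<open>q\<^sub>1 - q\<^sub>0\<close> of degree at most \<open>e\<close> is injective on \<open>A / q\<^sub>0\<close>, so the lengths \<open>H\<^sub>i(n)\<close> of the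
  parts of degree at most \<open>n\<close> of \<open>A / q\<^sub>i\<close> satisfy \<open>H\<^sub>0(n + e) \<ge> H\<^sub>0(n) + H\<^sub>1(n + e)\<close>. By induction \<open>H\<^sub>0\<close>
  grows at least like \<open>n\<^sup>l\<close>; if \<open>P \<subseteq> q\<^sub>0\<close>, then \<open>H\<^sub>0\<close> is bounded by the sum function of the Hilbert
  function of \<open>A / P\<close>, whence \<open>l\<close> is at most the degree of its Hilbert polynomial plus 1.\<close>

section \<open>Lengths of modules over a local ring\<close>

text \<open>The obstacle is that \<open>module_dim\<close> ranges over chains of all primes, while
  Hilbert functions only see homogeneous ideals. The two bounds are proved by different means:
  homogeneous chains suffice from below, and from above an arbitrary prime is measured by the
  filtration by degree, which needs no grading, and compared with a homogeneous prime inside it.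

  The reduction equation enters twice. It makes \<R>(I) finitely generated over \<R>(J), so that
  prime filtrations of M end. It also yields, for each a in \<mm>, one power of a that carries I^n
  into J^n for all n at once; this power annihilates M, so every prime over the annihilator contains
  \<mm>. Only then do the residue rings have components of finite length.

  The numbers match because summation raises the degree of a polynomial by one: dividing by a form
  of degree 1 lowers the degree by one while the chain loses one prime, and the sum function of a
  Hilbert polynomial of degree k grows with exponent k + 1. The convention that 0 has degree -1
  starts both counts at chains of length 0.\<close>

locale local_module = module R M for R (structure) and M (structure) +
  fixes \<mm> :: "'a set"
  assumes m_carrier: "\<mm> \<subseteq> carrier R"
    and nonunit: "\<lbrakk>a \<in> carrier R; a \<notin> \<mm>\<rbrakk> \<Longrightarrow> a \<in> Units R"
begin

abbreviation sub :: "'c set \<Rightarrow> bool" where "sub N \<equiv> submodule N R M"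

lemma subI:
  assumes "N \<subseteq> carrier M" "\<zero>\<^bsub>M\<^esub> \<in> N"
    and "\<And>x y. \<lbrakk>x \<in> N; y \<in> N\<rbrakk> \<Longrightarrow> x \<oplus>\<^bsub>M\<^esub> y \<in> N"
    and "\<And>a x. \<lbrakk>a \<in> carrier R; x \<in> N\<rbrakk> \<Longrightarrow> a \<odot>\<^bsub>M\<^esub> x \<in> N"
  shows "sub N"
proof (rule submoduleI)
  fix x assume x: "x \<in> N"
  then have "\<ominus>\<^bsub>M\<^esub> x = (\<ominus> \<one>) \<odot>\<^bsub>M\<^esub> x"
    using assms(1) by (simp add: smult_l_minus subset_iff)
  then show "\<ominus>\<^bsub>M\<^esub> x \<in> N" using assms(4)[of "\<ominus> \<one>" x] x by simp
qed (use assms in auto)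

lemma sub_carrier: "\<lbrakk>sub N; x \<in> N\<rbrakk> \<Longrightarrow> x \<in> carrier M"
  using submoduleE(1) by blast
lemma sub_zero: "sub N \<Longrightarrow> \<zero>\<^bsub>M\<^esub> \<in> N"
  using submoduleE(2,4)[of N] sub_carrier
  by (metis R.zero_closed ex_in_conv smult_l_null)
lemma sub_add: "\<lbrakk>sub N; x \<in> N; y \<in> N\<rbrakk> \<Longrightarrow> x \<oplus>\<^bsub>M\<^esub> y \<in> N"
  using submoduleE(5) by blast
lemma sub_smult: "\<lbrakk>sub N; a \<in> carrier R; x \<in> N\<rbrakk> \<Longrightarrow> a \<odot>\<^bsub>M\<^esub> x \<in> N"
  using submoduleE(4) by blast
lemma sub_uminus: "\<lbrakk>sub N; x \<in> N\<rbrakk> \<Longrightarrow> \<ominus>\<^bsub>M\<^esub> x \<in> N"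
  using submoduleE(3) by blast
lemma sub_minus: "\<lbrakk>sub N; x \<in> N; y \<in> N\<rbrakk> \<Longrightarrow> x \<ominus>\<^bsub>M\<^esub> y \<in> N"
  by (simp add: a_minus_def sub_add sub_uminus)

lemma sub_Int: "\<lbrakk>sub N; sub N'\<rbrakk> \<Longrightarrow> sub (N \<inter> N')"
  by (rule subI) (auto intro: sub_carrier sub_zero sub_add sub_smult)

lemma sub_add_cancel_left:
  assumes "sub N" "x \<in> N" "y \<in> carrier M" "x \<oplus>\<^bsub>M\<^esub> y \<in> N"
  shows "y \<in> N"
proof -
  have x: "x \<in> carrier M" using assms sub_carrier by blast
  have "\<ominus>\<^bsub>M\<^esub> x \<oplus>\<^bsub>M\<^esub> (x \<oplus>\<^bsub>M\<^esub> y) = y"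
    using x assms(3) by (simp add: M.r_neg1)
  then show ?thesis using assms sub_add sub_uminus by metis
qed

lemma sub_add_cancel_right:
  assumes "sub N" "y \<in> N" "x \<in> carrier M" "x \<oplus>\<^bsub>M\<^esub> y \<in> N"
  shows "x \<in> N"
  using sub_add_cancel_left[of N y x] assms by (simp add: M.a_comm sub_carrier)

definition cyc_ext :: "'c set \<Rightarrow> 'c \<Rightarrow> 'c set" where
  "cyc_ext K y = {z \<oplus>\<^bsub>M\<^esub> a \<odot>\<^bsub>M\<^esub> y | z a. z \<in> K \<and> a \<in> carrier R}"

lemma cyc_extE:
  assumes "x \<in> cyc_ext K y"
  obtains z a where "z \<in> K" "a \<in> carrier R" "x = z \<oplus>\<^bsub>M\<^esub> a \<odot>\<^bsub>M\<^esub> y"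
  using assms unfolding cyc_ext_def by blast

lemma cyc_extI: "\<lbrakk>z \<in> K; a \<in> carrier R\<rbrakk> \<Longrightarrow> z \<oplus>\<^bsub>M\<^esub> a \<odot>\<^bsub>M\<^esub> y \<in> cyc_ext K y"
  unfolding cyc_ext_def by blast

lemma sub_cyc_ext:
  assumes "sub K" "y \<in> carrier M"
  shows "sub (cyc_ext K y)"
proof (rule subI)
  show "cyc_ext K y \<subseteq> carrier M"
    using assms by (auto simp: cyc_ext_def sub_carrier)
  show "\<zero>\<^bsub>M\<^esub> \<in> cyc_ext K y"
    using cyc_extI[OF sub_zero[OF assms(1)] R.zero_closed, of y] assms(2) by simp
next
  fix u v assume "u \<in> cyc_ext K y" "v \<in> cyc_ext K y"
  then obtain z a w b where *: "z \<in> K" "a \<in> carrier R" "u = z \<oplus>\<^bsub>M\<^esub> a \<odot>\<^bsub>M\<^esub> y"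
    "w \<in> K" "b \<in> carrier R" "v = w \<oplus>\<^bsub>M\<^esub> b \<odot>\<^bsub>M\<^esub> y" by (auto elim!: cyc_extE)
  have c: "z \<in> carrier M" "w \<in> carrier M" using * assms sub_carrier by auto
  have "u \<oplus>\<^bsub>M\<^esub> v = (z \<oplus>\<^bsub>M\<^esub> w) \<oplus>\<^bsub>M\<^esub> (a \<oplus> b) \<odot>\<^bsub>M\<^esub> y"
    using * c assms by (simp add: smult_l_distr M.a_ac)
  then show "u \<oplus>\<^bsub>M\<^esub> v \<in> cyc_ext K y"
    using * cyc_extI[of "z \<oplus>\<^bsub>M\<^esub> w" K "a \<oplus> b" y] sub_add[OF assms(1)] by simp
next
  fix c u assume cR: "c \<in> carrier R" and "u \<in> cyc_ext K y"
  then obtain z a where *: "z \<in> K" "a \<in> carrier R" "u = z \<oplus>\<^bsub>M\<^esub> a \<odot>\<^bsub>M\<^esub> y"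
    by (auto elim!: cyc_extE)
  have "c \<odot>\<^bsub>M\<^esub> u = c \<odot>\<^bsub>M\<^esub> z \<oplus>\<^bsub>M\<^esub> (c \<otimes> a) \<odot>\<^bsub>M\<^esub> y"
    using * cR assms sub_carrier by (simp add: smult_r_distr smult_assoc1)
  then show "c \<odot>\<^bsub>M\<^esub> u \<in> cyc_ext K y"
    using * cR cyc_extI[of "c \<odot>\<^bsub>M\<^esub> z" K "c \<otimes> a" y] sub_smult[OF assms(1)] by simp
qed

lemma cyc_ext_superset:
  assumes "sub K" "y \<in> carrier M" shows "K \<subseteq> cyc_ext K y"
proof
  fix z assume z: "z \<in> K"
  show "z \<in> cyc_ext K y"
    using cyc_extI[OF z R.zero_closed, of y] assms z sub_carrier by simp
qed

lemma cyc_ext_mem: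
  assumes "sub K" "y \<in> carrier M" shows "y \<in> cyc_ext K y"
  using cyc_extI[OF sub_zero[OF assms(1)] R.one_closed, of y] assms by simp

lemma cyc_ext_least:
  assumes "sub N" "K \<subseteq> N" "y \<in> N" shows "cyc_ext K y \<subseteq> N"
  using assms by (auto elim!: cyc_extE intro: sub_add sub_smult)

text \<open>\<open>K / L\<close> has a composition series of length \<open>k\<close>; every step adjoins an element \<open>y\<close> killed by
  \<open>\<mm>\<close> modulo the previous submodule, so its factor is the residue field.\<close>

inductive has_len :: "'c set \<Rightarrow> 'c set \<Rightarrow> nat \<Rightarrow> bool" where
  refl: "sub N \<Longrightarrow> has_len N N 0"
| step: "\<lbrakk>has_len L K k; y \<in> carrier M; y \<notin> K; \<And>a. a \<in> \<mm> \<Longrightarrow> a \<odot>\<^bsub>M\<^esub> y \<in> K\<rbrakk>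
   \<Longrightarrow> has_len L (cyc_ext K y) (Suc k)"

lemma has_len_sub: "has_len L K k \<Longrightarrow> sub L \<and> sub K \<and> L \<subseteq> K"
proof (induction rule: has_len.induct)
  case (step L K k y)
  then show ?case using sub_cyc_ext[of K y] cyc_ext_superset[of K y] by blast
qed simp

lemma has_len_trans: "has_len K N j \<Longrightarrow> has_len L K k \<Longrightarrow> has_len L N (k + j)"
proof (induction rule: has_len.induct)
  case (step K' K j y)
  then show ?case using has_len.step[of L K "k + j" y] by simp
qed simp

text \<open>Modulo \<open>K\<close>, \<open>cyc_ext K y\<close> is a line over the residue field, so
  any \<open>x\<close> in it outside \<open>K\<close> spans it: in \<open>x = z + a y\<close> the
  coefficient \<open>a\<close> is outside \<open>\<mm>\<close>, as \<open>\<mm>\<close> carries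
  \<open>y\<close> into \<open>K\<close>, hence a unit. Then \<open>b = c a^-1\<close> cancels the
  \<open>y\<close>-part of \<open>u\<close>.\<close>

lemma simple_step_absorb:
  assumes K: "sub K" and X: "sub X" and y: "y \<in> carrier M" "\<And>a. a \<in> \<mm> \<Longrightarrow> a \<odot>\<^bsub>M\<^esub> y \<in> K"
    and "X \<subseteq> cyc_ext K y" and x: "x \<in> X" "x \<notin> K" and u: "u \<in> cyc_ext K y"
  obtains b where "b \<in> carrier R" "u \<ominus>\<^bsub>M\<^esub> b \<odot>\<^bsub>M\<^esub> x \<in> K"
proof -
  obtain z a where z: "z \<in> K" "a \<in> carrier R" "x = z \<oplus>\<^bsub>M\<^esub> a \<odot>\<^bsub>M\<^esub> y"
    using assms(5) x by (blast elim: cyc_extE)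
  obtain w c where w: "w \<in> K" "c \<in> carrier R" "u = w \<oplus>\<^bsub>M\<^esub> c \<odot>\<^bsub>M\<^esub> y"
    using u by (blast elim: cyc_extE)
  have "a \<notin> \<mm>" using y(2) z x(2) sub_add[OF K] by blast
  then have a: "a \<in> Units R" using nonunit z by blast
  define b where "b = c \<otimes> inv a"
  have b: "b \<in> carrier R" using a w by (simp add: b_def)
  have ba: "b \<otimes> a = c" using a w z by (simp add: b_def R.m_assoc)
  have car: "z \<in> carrier M" "w \<in> carrier M" using z w K sub_carrier by auto
  have "b \<odot>\<^bsub>M\<^esub> x = b \<odot>\<^bsub>M\<^esub> z \<oplus>\<^bsub>M\<^esub> c \<odot>\<^bsub>M\<^esub> y"
    using z b car y(1) by (simp add: smult_r_distr smult_assoc1[symmetric] ba)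
  moreover have "\<ominus>\<^bsub>M\<^esub> (b \<odot>\<^bsub>M\<^esub> z \<oplus>\<^bsub>M\<^esub> c \<odot>\<^bsub>M\<^esub> y) = \<ominus>\<^bsub>M\<^esub> (c \<odot>\<^bsub>M\<^esub> y) \<oplus>\<^bsub>M\<^esub> \<ominus>\<^bsub>M\<^esub> (b \<odot>\<^bsub>M\<^esub> z)"
    using w car b y(1) by (simp add: M.minus_add M.a_comm)
  ultimately have "u \<ominus>\<^bsub>M\<^esub> b \<odot>\<^bsub>M\<^esub> x = w \<ominus>\<^bsub>M\<^esub> b \<odot>\<^bsub>M\<^esub> z"
    using w car b y(1) by (simp add: a_minus_def M.a_assoc M.r_neg2)
  then show ?thesis using that[of b] b sub_minus[OF K] sub_smult[OF K] z w by simp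
qed

text \<open>Such a function exists whenever \<open>K / L\<close> has a composition series of length \<open>k\<close>, and it bounds
  all chains at once; this replaces the Jordan--Hoelder theorem.\<close>

definition rank_fun :: "'c set \<Rightarrow> 'c set \<Rightarrow> nat \<Rightarrow> ('c set \<Rightarrow> nat) \<Rightarrow> bool" where
  "rank_fun L K k \<rho> \<longleftrightarrow> (\<forall>X. \<rho> X \<le> k) \<and>
     (\<forall>X Y. sub X \<and> sub Y \<and> L \<subseteq> X \<and> X \<subset> Y \<and> Y \<subseteq> K \<longrightarrow> \<rho> X < \<rho> Y)"

text \<open>Adjoining \<open>y\<close> costs one unit of rank: keep the old rank of the trace
  \<open>X \<inter> K\<close> and add 1 once \<open>X\<close> leaves \<open>K\<close>.\<close>

lemma has_len_rank: "has_len L K k \<Longrightarrow> \<exists>\<rho>. rank_fun L K k \<rho>"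
proof (induction rule: has_len.induct)
  case (refl N)
  show ?case by (rule exI[of _ "\<lambda>_. 0"]) (auto simp: rank_fun_def)
next
  case (step L K k y)
  then obtain \<rho> where \<rho>: "rank_fun L K k \<rho>" by blast
  have K: "sub K" and L: "L \<subseteq> K" using has_len_sub step by auto
  define \<rho>' where "\<rho>' = (\<lambda>X. \<rho> (X \<inter> K) + (if X \<subseteq> K then 0 else 1))"
  have "\<rho>' X < \<rho>' Y" if XY: "sub X" "sub Y" "L \<subseteq> X" "X \<subset> Y" "Y \<subseteq> cyc_ext K y" for X Y
  proof (cases "X \<inter> K = Y \<inter> K")
    case False
    then have "X \<inter> K \<subset> Y \<inter> K" "L \<subseteq> X \<inter> K" "Y \<inter> K \<subseteq> K" "sub (X \<inter> K)" "sub (Y \<inter> K)"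
      using XY K L sub_Int by auto
    then have "\<rho> (X \<inter> K) < \<rho> (Y \<inter> K)"
      using \<rho> unfolding rank_fun_def by blast
    then show ?thesis using XY by (auto simp: \<rho>'_def)
  next
    case True
    have "\<not> Y \<subseteq> K" using True XY by blast
    \<comment> \<open>An element of \<open>X\<close> outside \<open>K\<close> would generate
      \<open>cyc_ext K y\<close> modulo \<open>K\<close>. Then each \<open>u\<close> in
      \<open>Y\<close> would differ from an element of \<open>X\<close> by a member of
      \<open>Y \<inter> K = X \<inter> K\<close>, forcing \<open>X = Y\<close>.\<close>
    moreover have "X \<subseteq> K"
    proof (rule ccontr)
      assume "\<not> X \<subseteq> K"
      then obtain x where x: "x \<in> X" "x \<notin> K" by blast
      have "u \<in> X" if u: "u \<in> Y" for u
      proof -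
        obtain b where b: "b \<in> carrier R" "u \<ominus>\<^bsub>M\<^esub> b \<odot>\<^bsub>M\<^esub> x \<in> K"
          using simple_step_absorb[OF K XY(1) step(2,4) _ x, of u] XY u by blast
        have "u \<ominus>\<^bsub>M\<^esub> b \<odot>\<^bsub>M\<^esub> x \<in> Y"
          using XY u x b sub_minus[OF XY(2)] sub_smult[OF XY(2)] by blast
        then have 1: "u \<ominus>\<^bsub>M\<^esub> b \<odot>\<^bsub>M\<^esub> x \<in> X" using b True by blast
        have 2: "b \<odot>\<^bsub>M\<^esub> x \<in> X" using sub_smult[OF XY(1)] b x by blast
        have "u \<in> carrier M" using XY u sub_carrier by blast
        moreover have "\<ominus>\<^bsub>M\<^esub> (b \<odot>\<^bsub>M\<^esub> x) \<in> X" using sub_uminus[OF XY(1)] 2 by blast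
        ultimately show "u \<in> X"
          using sub_add_cancel_right[OF XY(1)] 1[unfolded a_minus_def] by blast
      qed
      then show False using XY by blast
    qed
    ultimately show ?thesis using True by (simp add: \<rho>'_def)
  qed
  moreover have "\<rho>' X \<le> Suc k" for X
    using \<rho> by (auto simp: \<rho>'_def rank_fun_def intro: le_SucI)
  ultimately show ?case unfolding rank_fun_def by blast
qed

lemma rank_add:
  assumes "rank_fun L K k \<rho>" "sub L"
  shows "has_len X Y j \<Longrightarrow> L \<subseteq> X \<Longrightarrow> Y \<subseteq> K \<Longrightarrow> \<rho> X + j \<le> \<rho> Y"
proof (induction rule: has_len.induct)
  case (step X Y j y)
  have Y: "sub Y" "X \<subseteq> Y" using has_len_sub step by auto
  have s: "Y \<subseteq> cyc_ext Y y" "y \<in> cyc_ext Y y" "sub (cyc_ext Y y)"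
    using cyc_ext_superset cyc_ext_mem sub_cyc_ext Y step by auto
  moreover from s have "Y \<subset> cyc_ext Y y" "L \<subseteq> Y" using step.hyps(3) Y step.prems by blast+
  ultimately have "\<rho> Y < \<rho> (cyc_ext Y y)"
    using assms(1) Y(1) step.prems(2) unfolding rank_fun_def by simp
  then show ?case using step s by fastforce
qed simp

text \<open>The gap between \<open>X\<close> and \<open>Y\<close> allows two unrelated factors to be
  stacked inside one. Later \<open>X / L\<close> is the image of a multiplication modulo a prime and
  \<open>K / Y\<close> a truncated residue ring of a larger prime.\<close>

lemma has_len_two:
  assumes "has_len L K a" "has_len L X b" "X \<subseteq> Y" "has_len Y Z c" "Z \<subseteq> K"
  shows "b + c \<le> a"
proof -
  obtain \<rho> where \<rho>: "rank_fun L K a \<rho>" using has_len_rank assms by blast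
  have s: "sub L" "sub X" "sub Y" "L \<subseteq> X" "Y \<subseteq> Z" using assms has_len_sub by auto
  have "\<rho> L + b \<le> \<rho> X" by (rule rank_add[OF \<rho>]) (use assms s in auto)
  moreover have "\<rho> Y + c \<le> \<rho> Z" by (rule rank_add[OF \<rho>]) (use assms s in auto)
  moreover have "\<rho> X \<le> \<rho> Y"
  proof (cases "X = Y")
    case False
    then show ?thesis using \<rho> s assms unfolding rank_fun_def
      by (meson order.strict_implies_order psubsetI subset_trans)
  qed simp
  moreover have "\<rho> Z \<le> a" using \<rho> unfolding rank_fun_def by blast
  ultimately show ?thesis by linarith
qed

lemma has_len_mono:
  assumes "has_len L K a" "has_len X Y b" "L \<subseteq> X" "Y \<subseteq> K"
  shows "b \<le> a"
  using has_len_two[of L K a L 0 X Y b] assms has_len.refl has_len_sub by auto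

lemma has_len_unique: "\<lbrakk>has_len L K a; has_len L K b\<rbrakk> \<Longrightarrow> a = b"
  using has_len_mono[of L K a L K b] has_len_mono[of L K b L K a] by auto

lemma has_len_0D:
  assumes "has_len L K 0" shows "L = K"
  using assms by cases auto

lemma has_len_chain:
  "has_len L K k \<Longrightarrow> \<exists>C. (\<forall>i\<le>k. sub (C i)) \<and> (\<forall>i<k. C i \<subset> C (Suc i)) \<and> C 0 = L \<and> C k = K"
proof (induction rule: has_len.induct)
  case (refl N)
  then show ?case by (intro exI[of _ "\<lambda>_. N"]) auto
next
  case (step L K k y)
  then obtain C where C: "\<forall>i\<le>k. sub (C i)" "\<forall>i<k. C i \<subset> C (Suc i)" "C 0 = L" "C k = K"
    by blast
  have K: "sub K" using has_len_sub step by auto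
  have s: "K \<subset> cyc_ext K y" "sub (cyc_ext K y)"
    using cyc_ext_superset cyc_ext_mem sub_cyc_ext K step by auto
  show ?case
  proof (intro exI conjI)
    let ?C = "\<lambda>i. if i \<le> k then C i else cyc_ext K y"
    show "\<forall>i\<le>Suc k. sub (?C i)" using C s by auto
    show "\<forall>i<Suc k. ?C i \<subset> ?C (Suc i)"
    proof (intro allI impI)
      fix i assume i: "i < Suc k"
      show "?C i \<subset> ?C (Suc i)"
      proof (cases "i = k")
        case True then show ?thesis using C(4) s by simp
      next
        case False
        then have "i < k" using i by simp
        then show ?thesis using C(2) by auto
      qed
    qed
  qed (use C in auto)
qed

text \<open>The factors of an arbitrary chain need not be simple, but a rank function climbs at each
  step. With \<open>has_len_chain\<close> this identifies \<open>k\<close> with the supremum that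
  defines \<open>module_length\<close>.\<close>

lemma chain_le_has_len:
  assumes "has_len L K k" "\<forall>i\<le>n. sub (C i)" "\<forall>i<n. C i \<subset> C (Suc i)" "C 0 = L" "C n = K"
  shows "n \<le> k"
proof -
  obtain \<rho> where \<rho>: "rank_fun L K k \<rho>" using has_len_rank assms by blast
  have mono: "i \<le> j \<Longrightarrow> j \<le> n \<Longrightarrow> C i \<subseteq> C j" for i j
  proof (induction j)
    case (Suc j)
    show ?case
    proof (cases "i = Suc j")
      case False
      then have "C i \<subseteq> C j" using Suc by simp
      also have "\<dots> \<subset> C (Suc j)" using assms(3) Suc by simp
      finally show ?thesis by blast
    qed simp
  qed simp
  have "i \<le> n \<Longrightarrow> i \<le> \<rho> (C i)" for i
  proof (induction i)
    case (Suc i)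
    have "\<rho> (C i) < \<rho> (C (Suc i))"
      using \<rho> Suc assms mono[of 0 i] mono[of "Suc i" n] unfolding rank_fun_def by auto
    then show ?case using Suc by simp
  qed simp
  then show ?thesis using \<rho> unfolding rank_fun_def by (meson le_trans order_refl)
qed

end

locale local_module_map =
  M1: local_module R M1 \<mm> + M2: local_module R M2 \<mm>
  for R (structure) and M1 :: "('a, 'c, 'e) module_scheme" and M2 :: "('a, 'd, 'f) module_scheme" and \<mm>
begin

text \<open>The map \<open>\<phi>\<close> induces an isomorphism \<open>K / (K \<inter> \<phi>\<inverse> L) \<cong> (L + \<phi> K) / L\<close>.\<close>

lemma has_len_map:
  assumes "M1.has_len L1 K k"
    and \<phi>: "\<And>x. x \<in> K \<Longrightarrow> \<phi> x \<in> carrier M2"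
      "\<And>x y. \<lbrakk>x \<in> K; y \<in> K\<rbrakk> \<Longrightarrow> \<phi> (x \<oplus>\<^bsub>M1\<^esub> y) = \<phi> x \<oplus>\<^bsub>M2\<^esub> \<phi> y"
      "\<And>a x. \<lbrakk>a \<in> carrier R; x \<in> K\<rbrakk> \<Longrightarrow> \<phi> (a \<odot>\<^bsub>M1\<^esub> x) = a \<odot>\<^bsub>M2\<^esub> \<phi> x"
    and L2: "M2.sub L2"
    and L1: "\<And>x. x \<in> K \<Longrightarrow> \<phi> x \<in> L2 \<longleftrightarrow> x \<in> L1"
  shows "M2.has_len L2 {z \<oplus>\<^bsub>M2\<^esub> \<phi> x | z x. z \<in> L2 \<and> x \<in> K} k"
  using assms
proof (induction rule: M1.has_len.induct)
  case (refl N)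
  have "{z \<oplus>\<^bsub>M2\<^esub> \<phi> x | z x. z \<in> L2 \<and> x \<in> N} = L2" (is "?A = _")
  proof
    show "?A \<subseteq> L2" using refl M2.sub_add[OF refl(5)] by auto
    show "L2 \<subseteq> ?A"
    proof
      fix z assume z: "z \<in> L2"
      have 0: "\<zero>\<^bsub>M1\<^esub> \<in> N" using M1.sub_zero refl by blast
      then have "\<phi> \<zero>\<^bsub>M1\<^esub> \<in> L2" using refl by blast
      then have "z \<ominus>\<^bsub>M2\<^esub> \<phi> \<zero>\<^bsub>M1\<^esub> \<in> L2" using M2.sub_minus[OF refl(5)] z by blast
      moreover have "z = (z \<ominus>\<^bsub>M2\<^esub> \<phi> \<zero>\<^bsub>M1\<^esub>) \<oplus>\<^bsub>M2\<^esub> \<phi> \<zero>\<^bsub>M1\<^esub>"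
        using refl(2)[OF 0] M2.sub_carrier[OF refl(5) z]
        by (simp add: a_minus_def M2.M.a_assoc M2.M.l_neg)
      ultimately show "z \<in> ?A" using 0 by blast
    qed
  qed
  then show ?case using M2.has_len.refl[OF refl(5)] by simp
next
  case (step L K k y)
  have K: "M1.sub K" and LK: "L \<subseteq> K" using M1.has_len_sub step by auto
  have sup: "K \<subseteq> M1.cyc_ext K y" and y: "y \<in> M1.cyc_ext K y"
    using M1.cyc_ext_superset M1.cyc_ext_mem K step by auto
  have 1: "M2.has_len L2 {z \<oplus>\<^bsub>M2\<^esub> \<phi> x | z x. z \<in> L2 \<and> x \<in> K} k" (is "M2.has_len _ ?A _")
    by (rule step.IH; (rule step.prems; (assumption | erule subsetD[OF sup]))?)
  have A: "M2.sub ?A" using M2.has_len_sub 1 by auto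
  have \<phi>y: "\<phi> y \<in> carrier M2" using step.prems(1) y by blast
  \<comment> \<open>From \<open>\<phi> y = z + \<phi> x\<close> it would follow that
    \<open>y - x\<close> is mapped into \<open>L2\<close>, so lies in
    \<open>L \<subseteq> K\<close>, and \<open>y\<close> with it. The difference is formed with the
    scalar -1, since \<open>\<phi>\<close> is only assumed to respect sums and scalar
    multiples.\<close>
  have 2: "\<phi> y \<notin> ?A"
  proof
    assume "\<phi> y \<in> ?A"
    then obtain z x where zx: "z \<in> L2" "x \<in> K" "\<phi> y = z \<oplus>\<^bsub>M2\<^esub> \<phi> x" by blast
    have xM: "x \<in> carrier M1" "z \<in> carrier M2" "\<phi> x \<in> carrier M2"
      using zx M1.sub_carrier[OF K] M2.sub_carrier step.prems sup by auto
    have mx: "(\<ominus> \<one>) \<odot>\<^bsub>M1\<^esub> x \<in> K" using M1.sub_smult[OF K] zx by simp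
    have mem: "y \<oplus>\<^bsub>M1\<^esub> (\<ominus> \<one>) \<odot>\<^bsub>M1\<^esub> x \<in> M1.cyc_ext K y"
      using M1.sub_add[OF M1.sub_cyc_ext[OF K step.hyps(2)]] y mx sup by blast
    have "\<phi> (y \<oplus>\<^bsub>M1\<^esub> (\<ominus> \<one>) \<odot>\<^bsub>M1\<^esub> x) = \<phi> y \<oplus>\<^bsub>M2\<^esub> (\<ominus> \<one>) \<odot>\<^bsub>M2\<^esub> \<phi> x"
      using step.prems(2,3) y mx sup zx by (simp add: subsetD)
    also have "\<dots> = z"
      using xM zx(3) by (simp add: M2.smult_l_minus M2.M.a_assoc M2.M.r_neg)
    finally have "y \<oplus>\<^bsub>M1\<^esub> (\<ominus> \<one>) \<odot>\<^bsub>M1\<^esub> x \<in> K"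
      using step.prems(5)[OF mem] zx LK by auto
    then have "y \<in> K" using M1.sub_add_cancel_right[OF K mx step.hyps(2)] by blast
    then show False using step.hyps by blast
  qed
  have 3: "a \<odot>\<^bsub>M2\<^esub> \<phi> y \<in> ?A" if a: "a \<in> \<mm>" for a
  proof -
    have aR: "a \<in> carrier R" using a M1.m_carrier by blast
    have "\<phi> (a \<odot>\<^bsub>M1\<^esub> y) = a \<odot>\<^bsub>M2\<^esub> \<phi> y" using step.prems(3) aR y by blast
    moreover have ay: "a \<odot>\<^bsub>M1\<^esub> y \<in> K" using step.hyps a by blast
    moreover have "\<phi> (a \<odot>\<^bsub>M1\<^esub> y) = \<zero>\<^bsub>M2\<^esub> \<oplus>\<^bsub>M2\<^esub> \<phi> (a \<odot>\<^bsub>M1\<^esub> y)"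
      using step.prems(1)[OF subsetD[OF sup ay]] by simp
    ultimately have "a \<odot>\<^bsub>M2\<^esub> \<phi> y = \<zero>\<^bsub>M2\<^esub> \<oplus>\<^bsub>M2\<^esub> \<phi> (a \<odot>\<^bsub>M1\<^esub> y)" by simp
    then show ?thesis using M2.sub_zero[OF step.prems(4)] ay by blast
  qed
  have "M2.cyc_ext ?A (\<phi> y) = {z \<oplus>\<^bsub>M2\<^esub> \<phi> x | z x. z \<in> L2 \<and> x \<in> M1.cyc_ext K y}" (is "_ = ?B")
  proof
    show "M2.cyc_ext ?A (\<phi> y) \<subseteq> ?B"
    proof
      fix u assume "u \<in> M2.cyc_ext ?A (\<phi> y)"
      then obtain z x a where u: "z \<in> L2" "x \<in> K" "a \<in> carrier R"
        "u = (z \<oplus>\<^bsub>M2\<^esub> \<phi> x) \<oplus>\<^bsub>M2\<^esub> a \<odot>\<^bsub>M2\<^esub> \<phi> y" by (auto elim!: M2.cyc_extE)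
      have ay: "a \<odot>\<^bsub>M1\<^esub> y \<in> M1.cyc_ext K y"
        using M1.sub_smult[OF M1.sub_cyc_ext[OF K step.hyps(2)]] u y by blast
      have "\<phi> (x \<oplus>\<^bsub>M1\<^esub> a \<odot>\<^bsub>M1\<^esub> y) = \<phi> x \<oplus>\<^bsub>M2\<^esub> a \<odot>\<^bsub>M2\<^esub> \<phi> y"
        using step.prems(2,3) y ay u sup by (simp add: subsetD)
      then have "u = z \<oplus>\<^bsub>M2\<^esub> \<phi> (x \<oplus>\<^bsub>M1\<^esub> a \<odot>\<^bsub>M1\<^esub> y)"
        using u step.prems(1) sup \<phi>y M2.sub_carrier[OF step.prems(4)]
        by (simp add: subsetD M2.M.a_assoc)
      then show "u \<in> ?B" using u M1.cyc_extI by blast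
    qed
    show "?B \<subseteq> M2.cyc_ext ?A (\<phi> y)"
    proof
      fix u assume "u \<in> ?B"
      then obtain z x a where u: "z \<in> L2" "x \<in> K" "a \<in> carrier R"
        "u = z \<oplus>\<^bsub>M2\<^esub> \<phi> (x \<oplus>\<^bsub>M1\<^esub> a \<odot>\<^bsub>M1\<^esub> y)" by (auto elim!: M1.cyc_extE)
      have ay: "a \<odot>\<^bsub>M1\<^esub> y \<in> M1.cyc_ext K y"
        using M1.sub_smult[OF M1.sub_cyc_ext[OF K step.hyps(2)]] u y by blast
      have "\<phi> (x \<oplus>\<^bsub>M1\<^esub> a \<odot>\<^bsub>M1\<^esub> y) = \<phi> x \<oplus>\<^bsub>M2\<^esub> a \<odot>\<^bsub>M2\<^esub> \<phi> y"
        using step.prems(2,3) y ay u sup by (simp add: subsetD)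
      then have "u = (z \<oplus>\<^bsub>M2\<^esub> \<phi> x) \<oplus>\<^bsub>M2\<^esub> a \<odot>\<^bsub>M2\<^esub> \<phi> y"
        using u step.prems(1) sup \<phi>y M2.sub_carrier[OF step.prems(4)]
        by (simp add: subsetD M2.M.a_assoc)
      then show "u \<in> M2.cyc_ext ?A (\<phi> y)" using u by (auto intro!: M2.cyc_extI)
    qed
  qed
  then show ?case using M2.has_len.step[OF 1 \<phi>y 2 3] by simp
qed

end

section \<open>Second isomorphism theorem and splitting of composition series\<close>

context local_module
begin

interpretation self: local_module_map R M M \<mm> ..

text \<open>Second isomorphism theorem \<open>K / (K \<inter> X) \<cong> (X + K) / X\<close>: this
  is \<open>has_len_map\<close> for the inclusion of \<open>K\<close>.\<close>

lemma has_len_sum: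
  assumes "has_len (K \<inter> X) K j" "sub X"
  shows "has_len X {z \<oplus>\<^bsub>M\<^esub> x | z x. z \<in> X \<and> x \<in> K} j"
proof (rule self.has_len_map[of "K \<inter> X" K j "\<lambda>x. x" X, OF assms(1)])
  show "x \<in> carrier M" if "x \<in> K" for x using that has_len_sub assms(1) sub_carrier by blast
qed (use assms in auto)

text \<open>The series is intersected with \<open>X\<close>. Its last simple factor belongs to the
  upper part if \<open>X \<subseteq> K\<close>, and otherwise to the lower part, because an element
  of \<open>X\<close> outside \<open>K\<close> can then replace \<open>y\<close>.\<close>

lemma has_len_split:
  "has_len L K k \<Longrightarrow> sub X \<Longrightarrow> L \<subseteq> X \<Longrightarrow> X \<subseteq> K \<Longrightarrow> \<exists>i j. has_len L X i \<and> has_len X K j \<and> i + j = k"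
proof (induction arbitrary: X rule: has_len.induct)
  case (refl N)
  then have "X = N" by blast
  then show ?case using refl has_len.refl by auto
next
  case (step L K k y)
  have K: "sub K" and LK: "L \<subseteq> K" using has_len_sub step by auto
  have "\<exists>i j. has_len L (X \<inter> K) i \<and> has_len (X \<inter> K) K j \<and> i + j = k"
    by (rule step.IH) (use step.prems K LK sub_Int in auto)
  then obtain i j where ij: "has_len L (X \<inter> K) i" "has_len (X \<inter> K) K j" "i + j = k" by blast
  show ?case
  proof (cases "X \<subseteq> K")
    case True
    then have "X \<inter> K = X" by blast
    then show ?thesis using ij has_len.step[OF _ step.hyps(2-4), of X j] by (metis add_Suc_right)
  next
    case False
    then obtain x where x: "x \<in> X" "x \<notin> K" by blast
    have xM: "x \<in> carrier M" using x step.prems sub_carrier by blast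
    have absorb: "\<exists>b. b \<in> carrier R \<and> u \<ominus>\<^bsub>M\<^esub> b \<odot>\<^bsub>M\<^esub> x \<in> K" if "u \<in> cyc_ext K y" for u
      using simple_step_absorb[OF K step.prems(1) step.hyps(2,4) step.prems(3) x that] by metis
    have split_off: "u = (u \<ominus>\<^bsub>M\<^esub> b \<odot>\<^bsub>M\<^esub> x) \<oplus>\<^bsub>M\<^esub> b \<odot>\<^bsub>M\<^esub> x" if "u \<in> carrier M" "b \<in> carrier R" for u b
      using that xM by (simp add: a_minus_def M.a_assoc M.l_neg)
    have ax: "a \<odot>\<^bsub>M\<^esub> x \<in> X \<inter> K" if a: "a \<in> \<mm>" for a
    proof -
      have aR: "a \<in> carrier R" using a m_carrier by blast
      obtain z b where z: "z \<in> K" "b \<in> carrier R" "x = z \<oplus>\<^bsub>M\<^esub> b \<odot>\<^bsub>M\<^esub> y"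
        using step.prems(3) x by (blast elim: cyc_extE)
      have "a \<odot>\<^bsub>M\<^esub> x = a \<odot>\<^bsub>M\<^esub> z \<oplus>\<^bsub>M\<^esub> b \<odot>\<^bsub>M\<^esub> (a \<odot>\<^bsub>M\<^esub> y)"
        using z aR step.hyps(2) sub_carrier[OF K]
        by (simp add: smult_r_distr smult_assoc1[symmetric] R.m_comm)
      then have "a \<odot>\<^bsub>M\<^esub> x \<in> K"
        using z aR step.hyps(4)[OF a] sub_add[OF K] sub_smult[OF K] by simp
      then show ?thesis using sub_smult[OF step.prems(1) aR] x by blast
    qed
    have "has_len L (cyc_ext (X \<inter> K) x) (Suc i)"
      by (rule has_len.step[OF ij(1) xM _ ax]) (use x in auto)
    moreover have "cyc_ext (X \<inter> K) x = X"
    proof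
      show "cyc_ext (X \<inter> K) x \<subseteq> X" using cyc_ext_least[OF step.prems(1)] x by blast
      show "X \<subseteq> cyc_ext (X \<inter> K) x"
      proof
        fix u assume u: "u \<in> X"
        then obtain b where b: "b \<in> carrier R" "u \<ominus>\<^bsub>M\<^esub> b \<odot>\<^bsub>M\<^esub> x \<in> K"
          using absorb step.prems by blast
        have "u \<ominus>\<^bsub>M\<^esub> b \<odot>\<^bsub>M\<^esub> x \<in> X"
          using sub_minus[OF step.prems(1)] sub_smult[OF step.prems(1)] u x b by blast
        then show "u \<in> cyc_ext (X \<inter> K) x"
          using b split_off[OF sub_carrier[OF step.prems(1) u] b(1)]
            cyc_extI[of "u \<ominus>\<^bsub>M\<^esub> b \<odot>\<^bsub>M\<^esub> x" "X \<inter> K" b x] by simp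
      qed
    qed
    \<comment> \<open>\<open>x\<close> already generates the last factor, so \<open>X + K\<close> is
      all of \<open>cyc_ext K y\<close>, and the upper part keeps the length \<open>j\<close> of
      \<open>K / (X \<inter> K)\<close>.\<close>
    moreover have "has_len X {z \<oplus>\<^bsub>M\<^esub> x | z x. z \<in> X \<and> x \<in> K} j"
      by (rule has_len_sum) (use ij step.prems in \<open>simp_all add: Int_commute\<close>)
    moreover have "{z \<oplus>\<^bsub>M\<^esub> x | z x. z \<in> X \<and> x \<in> K} = cyc_ext K y" (is "?A = _")
    proof
      have s: "sub (cyc_ext K y)" "K \<subseteq> cyc_ext K y"
        using sub_cyc_ext cyc_ext_superset K step.hyps by auto
      show "?A \<subseteq> cyc_ext K y" using step.prems sub_add[OF s(1)] s by blast
      show "cyc_ext K y \<subseteq> ?A"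
      proof
        fix u assume u: "u \<in> cyc_ext K y"
        then obtain b where b: "b \<in> carrier R" "u \<ominus>\<^bsub>M\<^esub> b \<odot>\<^bsub>M\<^esub> x \<in> K"
          using absorb by blast
        have uM: "u \<in> carrier M" using u sub_carrier[OF s(1)] by blast
        have bx: "b \<odot>\<^bsub>M\<^esub> x \<in> carrier M" using b xM by simp
        have "u = b \<odot>\<^bsub>M\<^esub> x \<oplus>\<^bsub>M\<^esub> (u \<ominus>\<^bsub>M\<^esub> b \<odot>\<^bsub>M\<^esub> x)"
          using split_off[OF uM b(1)] M.a_comm[OF M.minus_closed[OF uM bx] bx] by simp
        moreover have "b \<odot>\<^bsub>M\<^esub> x \<in> X" using sub_smult[OF step.prems(1)] x b by blast
        ultimately show "u \<in> ?A" using b by blast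
      qed
    qed
    ultimately show ?thesis using ij by (metis add_Suc)
  qed
qed

end

section \<open>Noetherian sequences of ideals\<close>

context cring
begin

lemma ideal_commI:
  assumes "K \<subseteq> carrier R" "\<zero> \<in> K"
    and "\<And>x y. \<lbrakk>x \<in> K; y \<in> K\<rbrakk> \<Longrightarrow> x \<oplus> y \<in> K"
    and "\<And>a x. \<lbrakk>a \<in> carrier R; x \<in> K\<rbrakk> \<Longrightarrow> a \<otimes> x \<in> K"
  shows "ideal K R"
proof (rule idealI)
  have "\<ominus> x \<in> K" if "x \<in> K" for x
  proof -
    have "\<ominus> x = (\<ominus> \<one>) \<otimes> x" using assms(1) that by (simp add: l_minus subset_iff)
    then show ?thesis using assms(4)[of "\<ominus> \<one>" x] that by simp
  qed
  then show "subgroup K (add_monoid R)"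
    using assms by (auto simp: subgroup_def a_inv_def)
  show "a \<otimes> x \<in> K" if "a \<in> K" "x \<in> carrier R" for a x
    using assms(4)[OF that(2,1)] assms(1) that m_comm by (metis subsetD)
qed (use assms ring_axioms in auto)

lemma ideal_carrier: "\<lbrakk>ideal K R; x \<in> K\<rbrakk> \<Longrightarrow> x \<in> carrier R"
  by (rule ideal.Icarr)
lemma ideal_zero: "ideal K R \<Longrightarrow> \<zero> \<in> K"
  by (simp add: additive_subgroup.zero_closed ideal.axioms(1))
lemma ideal_add: "\<lbrakk>ideal K R; x \<in> K; y \<in> K\<rbrakk> \<Longrightarrow> x \<oplus> y \<in> K"
  by (simp add: additive_subgroup.a_closed ideal.axioms(1))
lemma ideal_mult: "\<lbrakk>ideal K R; a \<in> carrier R; x \<in> K\<rbrakk> \<Longrightarrow> a \<otimes> x \<in> K"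
  by (rule ideal.I_l_closed)
lemma ideal_uminus: "\<lbrakk>ideal K R; x \<in> K\<rbrakk> \<Longrightarrow> \<ominus> x \<in> K"
  by (simp add: additive_subgroup.a_inv_closed ideal.axioms(1))
lemma ideal_minus: "\<lbrakk>ideal K R; x \<in> K; y \<in> K\<rbrakk> \<Longrightarrow> x \<ominus> y \<in> K"
  by (simp add: a_minus_def ideal_add ideal_uminus)

lemma ideal_add_cancel:
  assumes "ideal K R" "x \<in> carrier R" "y \<in> K" "x \<oplus> y \<in> K"
  shows "x \<in> K"
proof -
  have "(x \<oplus> y) \<ominus> y = x"
    using assms ideal_carrier by (simp add: a_minus_def a_assoc r_neg)
  then show ?thesis using ideal_minus[OF assms(1,4,3)] by simp
qed

text \<open>A sequence \<open>N\<close> of ideals stands for the graded submodule \<open>\<Oplus>\<^sub>n N\<^sub>n t\<^sup>n\<close> of \<open>R[t]\<close> over the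
  subalgebra generated by \<open>S t\<close>. Homogeneous ideals of the Rees algebra of \<open>J\<close> are the case
  \<open>S = J\<close>, \<open>N\<^sub>n \<subseteq> J\<^sup>n\<close>.\<close>

definition gsub :: "'a set \<Rightarrow> (nat \<Rightarrow> 'a set) \<Rightarrow> bool" where
  "gsub S N \<longleftrightarrow> (\<forall>n. ideal (N n) R) \<and> (\<forall>n. \<forall>g\<in>S. \<forall>x\<in>N n. g \<otimes> x \<in> N (Suc n))"

lemma gsubI:
  "\<lbrakk>\<And>n. ideal (N n) R; \<And>n g x. \<lbrakk>g \<in> S; x \<in> N n\<rbrakk> \<Longrightarrow> g \<otimes> x \<in> N (Suc n)\<rbrakk> \<Longrightarrow> gsub S N"
  unfolding gsub_def by blast

lemma gsub_ideal: "gsub S N \<Longrightarrow> ideal (N n) R"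
  unfolding gsub_def by blast

lemma gsub_mult: "\<lbrakk>gsub S N; g \<in> S; x \<in> N n\<rbrakk> \<Longrightarrow> g \<otimes> x \<in> N (Suc n)"
  unfolding gsub_def by blast

lemma gsub_subset: "\<lbrakk>gsub S' N; S \<subseteq> S'\<rbrakk> \<Longrightarrow> gsub S N"
  unfolding gsub_def by blast

lemma gsub_Int: "\<lbrakk>gsub S N; gsub S N'\<rbrakk> \<Longrightarrow> gsub S (\<lambda>n. N n \<inter> N' n)"
  unfolding gsub_def by (simp add: i_intersect)

text \<open>The multipliers carrying every \<open>N n\<close> into \<open>N (Suc n)\<close> form an
  ideal. Hence closure under finitely many generators of \<open>J\<close> gives closure under
  \<open>J\<close>.\<close>

lemma gsub_Idl:
  assumes N: "gsub S N" and S: "S \<subseteq> carrier R"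
  shows "gsub (Idl S) N"
proof -
  let ?A = "{g \<in> carrier R. \<forall>n. \<forall>x\<in>N n. g \<otimes> x \<in> N (Suc n)}"
  have car: "x \<in> N n \<Longrightarrow> x \<in> carrier R" for x n
    using gsub_ideal[OF N] ideal_carrier by blast
  have "ideal ?A R"
  proof (rule ideal_commI)
    show "\<zero> \<in> ?A" using gsub_ideal[OF N] car by (auto simp: ideal_zero)
    show "x \<oplus> y \<in> ?A" if "x \<in> ?A" "y \<in> ?A" for x y
      using that car gsub_ideal[OF N] by (auto simp: l_distr intro!: ideal_add)
    show "a \<otimes> x \<in> ?A" if "a \<in> carrier R" "x \<in> ?A" for a x
      using that car by (simp add: m_assoc ideal_mult[OF gsub_ideal[OF N]])
  qed auto
  moreover have "S \<subseteq> ?A" using S gsub_mult[OF N] by blast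
  ultimately have "Idl S \<subseteq> ?A" by (rule genideal_minimal)
  then show ?thesis using N unfolding gsub_def by blast
qed

text \<open>The ascending chain condition on graded submodules; \<open>\<le>\<close> on sequences is
  inclusion in every degree. No graded module has to be constructed for it.\<close>

definition noeth_seq :: "'a set \<Rightarrow> (nat \<Rightarrow> 'a set) \<Rightarrow> bool" where
  "noeth_seq S W \<longleftrightarrow> (\<forall>f :: nat \<Rightarrow> nat \<Rightarrow> 'a set. (\<forall>k. gsub S (f k) \<and> f k \<le> W \<and> f k \<le> f (Suc k)) \<longrightarrow>
     (\<exists>n. \<forall>k\<ge>n. f k = f n))"

lemma noeth_seqD:
  assumes "noeth_seq S W" "\<And>k. gsub S (f k)" "\<And>k. f k \<le> W" "\<And>k. f k \<le> f (Suc k)"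
  obtains n where "\<And>k. k \<ge> n \<Longrightarrow> f k = f n"
  using assms unfolding noeth_seq_def by meson

lemma noeth_seq_le: "\<lbrakk>noeth_seq S W; W' \<le> W\<rbrakk> \<Longrightarrow> noeth_seq S W'"
  unfolding noeth_seq_def by (meson order_trans)

text \<open>More multipliers leave fewer graded submodules, hence fewer chains.\<close>

lemma noeth_seq_subset: "\<lbrakk>noeth_seq S W; S \<subseteq> S'\<rbrakk> \<Longrightarrow> noeth_seq S' W"
  unfolding noeth_seq_def by (meson gsub_subset)

lemma noeth_seq_induct:
  assumes "noeth_seq S W"
    and step: "\<And>N. \<lbrakk>gsub S N; N \<le> W; \<And>N'. \<lbrakk>gsub S N'; N' \<le> W; N < N'\<rbrakk> \<Longrightarrow> \<Phi> N'\<rbrakk> \<Longrightarrow> \<Phi> N"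
    and N: "gsub S N" "N \<le> W"
  shows "\<Phi> N"
proof (rule ccontr)
  assume neg: "\<not> \<Phi> N"
  let ?P = "\<lambda>N. gsub S N \<and> N \<le> W \<and> \<not> \<Phi> N"
  have "\<exists>f. \<forall>k. ?P (f k) \<and> f k < f (Suc k)"
    by (rule dependent_nat_choice) (use neg N step in blast)+
  then obtain f where f: "\<And>k. ?P (f k) \<and> f k < f (Suc k)" by blast
  then obtain n where "\<And>k. k \<ge> n \<Longrightarrow> f k = f n"
    using noeth_seqD[OF assms(1), of f] by (metis less_imp_le)
  then show False using f[of n] by (metis le_SucI order_refl less_irrefl)
qed

lemma noeth_seq_maximal:
  assumes "noeth_seq S W" and F: "\<And>N. F N \<Longrightarrow> gsub S N \<and> N \<le> W" and N: "F N"
  obtains N' where "F N'" "\<And>N''. F N'' \<Longrightarrow> \<not> N' < N''"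
proof -
  have "F N \<longrightarrow> (\<exists>N'. F N' \<and> (\<forall>N''. F N'' \<longrightarrow> \<not> N' < N''))"
    using assms(1)
  proof (rule noeth_seq_induct[where W = W])
    fix N assume "\<And>N'. \<lbrakk>gsub S N'; N' \<le> W; N < N'\<rbrakk> \<Longrightarrow>
      F N' \<longrightarrow> (\<exists>N'. F N' \<and> (\<forall>N''. F N'' \<longrightarrow> \<not> N' < N''))"
    then show "F N \<longrightarrow> (\<exists>N'. F N' \<and> (\<forall>N''. F N'' \<longrightarrow> \<not> N' < N''))" using F by blast
  qed (use F N in auto)
  then show ?thesis using that N by blast
qed

text \<open>The sequence of the graded module \<open>V + y t\<^sup>s W\<close>, and the ideals of leading coefficients \<open>w\<close> of
  its elements \<open>v + y t\<^sup>s w\<close> that lie in \<open>N\<close>.\<close>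

definition addshift :: "(nat \<Rightarrow> 'a set) \<Rightarrow> 'a \<Rightarrow> nat \<Rightarrow> (nat \<Rightarrow> 'a set) \<Rightarrow> nat \<Rightarrow> 'a set" where
  "addshift V y s W n = (if s \<le> n then {v \<oplus> y \<otimes> w | v w. v \<in> V n \<and> w \<in> W (n - s)} else V n)"

definition lead :: "(nat \<Rightarrow> 'a set) \<Rightarrow> 'a \<Rightarrow> nat \<Rightarrow> (nat \<Rightarrow> 'a set) \<Rightarrow> (nat \<Rightarrow> 'a set) \<Rightarrow> nat \<Rightarrow> 'a set" where
  "lead V y s W N n = {w \<in> W n. \<exists>v\<in>V (n + s). v \<oplus> y \<otimes> w \<in> N (n + s)}"

lemma addshiftI: "\<lbrakk>v \<in> V (n + s); w \<in> W n\<rbrakk> \<Longrightarrow> v \<oplus> y \<otimes> w \<in> addshift V y s W (n + s)"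
  unfolding addshift_def by auto

lemma addshiftE:
  assumes "x \<in> addshift V y s W n"
  obtains "x \<in> V n" "n < s" | m v w where "n = m + s" "v \<in> V n" "w \<in> W m" "x = v \<oplus> y \<otimes> w"
proof (cases "s \<le> n")
  case True
  then obtain v w where "v \<in> V n" "w \<in> W (n - s)" "x = v \<oplus> y \<otimes> w"
    using assms by (auto simp: addshift_def)
  then show ?thesis using that(2)[of "n - s" v w] True by simp
next
  case False
  then show ?thesis using assms that(1) by (simp add: addshift_def)
qed

context
  fixes S :: "'a set" and V W :: "nat \<Rightarrow> 'a set" and y :: 'a and s :: nat
  assumes V: "gsub S V" and W: "gsub S W" and y: "y \<in> carrier R" and S: "S \<subseteq> carrier R"
begin

private lemma car: "x \<in> V n \<Longrightarrow> x \<in> carrier R" "x \<in> W n \<Longrightarrow> x \<in> carrier R" "x \<in> S \<Longrightarrow> x \<in> carrier R"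
  using ideal_carrier[OF gsub_ideal[OF V]] ideal_carrier[OF gsub_ideal[OF W]] S by auto

lemma addshift_superset: "V n \<subseteq> addshift V y s W n"
proof
  fix v assume v: "v \<in> V n"
  show "v \<in> addshift V y s W n"
  proof (cases "s \<le> n")
    case True
    have "v \<oplus> y \<otimes> \<zero> \<in> addshift V y s W (n - s + s)"
      by (rule addshiftI) (use v True gsub_ideal[OF W] in \<open>auto intro: ideal_zero\<close>)
    then show ?thesis using True v y by (simp add: car)
  qed (simp add: addshift_def v)
qed

lemma gsub_addshift: "gsub S (addshift V y s W)"
proof (rule gsubI)
  fix n
  show "ideal (addshift V y s W n) R"
  proof (cases "s \<le> n")
    case True
    have "ideal {v \<oplus> y \<otimes> w | v w. v \<in> V n \<and> w \<in> W (n - s)} R" (is "ideal ?A R")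
    proof (rule ideal_commI)
      show "?A \<subseteq> carrier R" using car y by auto
      have "\<zero> \<oplus> y \<otimes> \<zero> \<in> ?A" using gsub_ideal[OF W] gsub_ideal[OF V] ideal_zero by blast
      then show "\<zero> \<in> ?A" using y by simp
      show "x \<oplus> z \<in> ?A" if xz: "x \<in> ?A" "z \<in> ?A" for x z
      proof -
        obtain v w v' w' where *: "v \<in> V n" "w \<in> W (n-s)" "x = v \<oplus> y \<otimes> w" "v' \<in> V n" "w' \<in> W (n-s)" "z = v' \<oplus> y \<otimes> w'"
          using xz by blast
        have "x \<oplus> z = (v \<oplus> v') \<oplus> y \<otimes> (w \<oplus> w')"
          using * y car by (simp add: r_distr a_ac)
        then show ?thesis using * ideal_add gsub_ideal[OF W] gsub_ideal[OF V] by blast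
      qed
      show "a \<otimes> x \<in> ?A" if ax: "a \<in> carrier R" "x \<in> ?A" for a x
      proof -
        obtain v w where *: "v \<in> V n" "w \<in> W (n-s)" "x = v \<oplus> y \<otimes> w"
          using ax by blast
        have "a \<otimes> x = (a \<otimes> v) \<oplus> y \<otimes> (a \<otimes> w)"
          using * y car ax by (simp add: r_distr m_ac)
        then show ?thesis using * ax ideal_mult gsub_ideal[OF W] gsub_ideal[OF V] by blast
      qed
    qed
    then show ?thesis using True by (simp add: addshift_def)
  next
    case False
    then show ?thesis using gsub_ideal[OF V] by (simp add: addshift_def)
  qed
next
  fix n g x assume g: "g \<in> S" and "x \<in> addshift V y s W n"
  then show "g \<otimes> x \<in> addshift V y s W (Suc n)"
  proof (cases rule: addshiftE[OF \<open>x \<in> addshift V y s W n\<close>])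
    case 1
    then show ?thesis using addshift_superset[of "Suc n"] gsub_mult[OF V g] by blast
  next
    case (2 m v w)
    have "g \<otimes> x = (g \<otimes> v) \<oplus> y \<otimes> (g \<otimes> w)"
      using 2 y car g by (simp add: r_distr m_ac)
    moreover have "(g \<otimes> v) \<oplus> y \<otimes> (g \<otimes> w) \<in> addshift V y s W (Suc m + s)"
      by (rule addshiftI) (use 2 gsub_mult[OF V g] gsub_mult[OF W g] in auto)
    ultimately show ?thesis using 2 by simp
  qed
qed

lemma gsub_lead:
  assumes N: "gsub S N"
  shows "gsub S (lead V y s W N)"
proof (rule gsubI)
  fix n
  show "ideal (lead V y s W N n) R"
  proof (rule ideal_commI)
    show "lead V y s W N n \<subseteq> carrier R" using car by (auto simp: lead_def)
    have "\<zero> \<oplus> y \<otimes> \<zero> \<in> N (n + s)" using y ideal_zero[OF gsub_ideal[OF N]] by simp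
    then show "\<zero> \<in> lead V y s W N n"
      using gsub_ideal[OF W] gsub_ideal[OF V] ideal_zero unfolding lead_def by blast
    show "x \<oplus> z \<in> lead V y s W N n" if xz: "x \<in> lead V y s W N n" "z \<in> lead V y s W N n" for x z
    proof -
      obtain v v' where *: "x \<in> W n" "z \<in> W n" "v \<in> V (n+s)" "v' \<in> V (n+s)" "v \<oplus> y \<otimes> x \<in> N (n+s)" "v' \<oplus> y \<otimes> z \<in> N (n+s)"
        using xz by (auto simp: lead_def)
      have "(v \<oplus> v') \<oplus> y \<otimes> (x \<oplus> z) = (v \<oplus> y \<otimes> x) \<oplus> (v' \<oplus> y \<otimes> z)"
        using * y car by (simp add: r_distr a_ac)
      also have "\<dots> \<in> N (n+s)" using * ideal_add gsub_ideal[OF N] by blast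
      finally show ?thesis
        using * ideal_add gsub_ideal[OF W] gsub_ideal[OF V] unfolding lead_def by blast
    qed
    show "a \<otimes> x \<in> lead V y s W N n" if ax: "a \<in> carrier R" "x \<in> lead V y s W N n" for a x
    proof -
      obtain v where *: "x \<in> W n" "v \<in> V (n+s)" "v \<oplus> y \<otimes> x \<in> N (n+s)"
        using ax by (auto simp: lead_def)
      have "(a \<otimes> v) \<oplus> y \<otimes> (a \<otimes> x) = a \<otimes> (v \<oplus> y \<otimes> x)"
        using * y car ax by (simp add: r_distr m_ac)
      also have "\<dots> \<in> N (n+s)" using * ax ideal_mult gsub_ideal[OF N] by blast
      finally show ?thesis
        using * ax ideal_mult gsub_ideal[OF W] gsub_ideal[OF V] unfolding lead_def by blast
    qed
  qed
next
  fix n g x assume g: "g \<in> S" and "x \<in> lead V y s W N n"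
  then obtain v where *: "x \<in> W n" "v \<in> V (n+s)" "v \<oplus> y \<otimes> x \<in> N (n+s)"
    by (auto simp: lead_def)
  have "(g \<otimes> v) \<oplus> y \<otimes> (g \<otimes> x) = g \<otimes> (v \<oplus> y \<otimes> x)"
    using * y car g by (simp add: r_distr m_ac)
  also have "\<dots> \<in> N (Suc n+s)" using gsub_mult[OF N g *(3)] by simp
  finally show "g \<otimes> x \<in> lead V y s W N (Suc n)"
    using * gsub_mult[OF V g *(2)] gsub_mult[OF W g *(1)] unfolding lead_def by auto
qed

text \<open>A submodule of an extension is determined by its trace and its image: an element
  \<open>v + y w\<close> of \<open>N2\<close> differs from an element \<open>v' + y w\<close> of
  \<open>N1\<close> with the same leading coefficient by a member of \<open>V\<close>, where the
  traces agree. Both sides are cut with \<open>addshift\<close> because later \<open>N1\<close> and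
  \<open>N2\<close> reach beyond a single stage of \<open>powsum\<close>.\<close>

lemma addshift_eq:
  assumes N1: "gsub S N1" and N2: "gsub S N2" and le: "N1 \<le> N2"
    and V_eq: "\<And>n. N1 n \<inter> V n = N2 n \<inter> V n" and lead_eq: "lead V y s W N1 = lead V y s W N2"
  shows "N1 n \<inter> addshift V y s W n = N2 n \<inter> addshift V y s W n"
proof -
  have "x \<in> N1 n" if x: "x \<in> N2 n" "x \<in> addshift V y s W n" for x
    using x(2)
  proof (cases rule: addshiftE)
    case 1
    then show ?thesis using V_eq x by blast
  next
    case (2 m v w)
    then have "w \<in> lead V y s W N2 m" using x by (auto simp: lead_def)
    then obtain v' where v': "v' \<in> V n" "v' \<oplus> y \<otimes> w \<in> N1 n"
      unfolding lead_eq[symmetric] using 2 by (auto simp: lead_def)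
    have "x \<ominus> (v' \<oplus> y \<otimes> w) \<in> N2 n"
      by (rule ideal_minus[OF gsub_ideal[OF N2]]) (use x v' le in \<open>auto simp: le_fun_def\<close>)
    moreover have "x \<ominus> (v' \<oplus> y \<otimes> w) = v \<ominus> v'"
    proof -
      have c: "v \<in> carrier R" "v' \<in> carrier R" "y \<otimes> w \<in> carrier R" using 2 v' car y by auto
      then have "\<ominus> (v' \<oplus> y \<otimes> w) = \<ominus> (y \<otimes> w) \<oplus> \<ominus> v'" by (simp add: minus_add a_comm)
      then show ?thesis using c 2 by (simp add: a_minus_def a_assoc r_neg2)
    qed
    moreover have "v \<ominus> v' \<in> V n" using 2 v' ideal_minus[OF gsub_ideal[OF V]] by blast
    ultimately have d: "x \<ominus> (v' \<oplus> y \<otimes> w) \<in> N1 n" using V_eq[of n] by auto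
    have "(x \<ominus> (v' \<oplus> y \<otimes> w)) \<oplus> (v' \<oplus> y \<otimes> w) \<in> N1 n"
      by (rule ideal_add[OF gsub_ideal[OF N1] d v'(2)])
    moreover have "(x \<ominus> (v' \<oplus> y \<otimes> w)) \<oplus> (v' \<oplus> y \<otimes> w) = x"
      using ideal_carrier[OF gsub_ideal[OF N2] x(1)] ideal_carrier[OF gsub_ideal[OF N1] v'(2)]
      by (simp add: a_minus_def a_assoc l_neg)
    ultimately show ?thesis by simp
  qed
  then show ?thesis using le by (auto simp: le_fun_def)
qed

text \<open>\<open>V + y t^s W\<close> modulo \<open>V\<close> is a quotient of a shifted
  \<open>W\<close>, so a chain is stationary once its traces on \<open>V\<close> and its leading
  coefficients in \<open>W\<close> are.\<close>

lemma noeth_seq_addshift: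
  assumes "noeth_seq S V" "noeth_seq S W"
  shows "noeth_seq S (addshift V y s W)"
  unfolding noeth_seq_def
proof (intro allI impI)
  fix f assume f: "\<forall>k. gsub S (f k) \<and> f k \<le> addshift V y s W \<and> f k \<le> f (Suc k)"
  have mono: "f i \<le> f j" if "i \<le> j" for i j
    using lift_Suc_mono_le[of f, OF _ that] f by blast
  obtain n1 where n1: "\<And>k. k \<ge> n1 \<Longrightarrow> (\<lambda>n. f k n \<inter> V n) = (\<lambda>n. f n1 n \<inter> V n)"
  proof (rule noeth_seqD[OF assms(1), of "\<lambda>k n. f k n \<inter> V n"])
    show "gsub S (\<lambda>n. f k n \<inter> V n)" for k using f gsub_Int V by blast
    show "(\<lambda>n. f k n \<inter> V n) \<le> (\<lambda>n. f (Suc k) n \<inter> V n)" for k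
      using mono[of k "Suc k"] by (auto simp: le_fun_def)
  qed (auto simp: le_fun_def)
  obtain n2 where n2: "\<And>k. k \<ge> n2 \<Longrightarrow> lead V y s W (f k) = lead V y s W (f n2)"
  proof (rule noeth_seqD[OF assms(2), of "\<lambda>k. lead V y s W (f k)"])
    show "gsub S (lead V y s W (f k))" for k using f gsub_lead by blast
    show "lead V y s W (f k) \<le> W" for k by (auto simp: le_fun_def lead_def)
    show "lead V y s W (f k) \<le> lead V y s W (f (Suc k))" for k
    proof -
      have "f k n \<subseteq> f (Suc k) n" for n using mono[of k "Suc k"] by (simp add: le_fun_def)
      then show ?thesis unfolding le_fun_def lead_def by blast
    qed
  qed auto
  let ?n = "max n1 n2"
  have "f k = f ?n" if k: "k \<ge> ?n" for k
  proof
    fix n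
    have "f ?n n \<inter> addshift V y s W n = f k n \<inter> addshift V y s W n"
    proof (rule addshift_eq)
      show "f ?n n \<inter> V n = f k n \<inter> V n" for n
        using n1[of k] n1[of ?n] k by (metis max.bounded_iff max.cobounded1)
      show "lead V y s W (f ?n) = lead V y s W (f k)"
        using n2[of k] n2[of ?n] k by simp
    qed (use f mono[OF k] in auto)
    then show "f k n = f ?n n" using f unfolding le_fun_def by blast
  qed
  then show "\<exists>n. \<forall>k\<ge>n. f k = f n" by blast
qed

end

text \<open>\<open>powsum g W q\<close> is \<open>W + g t W + \<dots> + (g t)\<^sup>q\<^sup>-\<^sup>1 W\<close>.\<close>

primrec powsum :: "'a \<Rightarrow> (nat \<Rightarrow> 'a set) \<Rightarrow> nat \<Rightarrow> nat \<Rightarrow> 'a set" where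
  "powsum g W 0 = (\<lambda>_. {\<zero>})"
| "powsum g W (Suc q) = addshift (powsum g W q) (g [^] q) q W"

context
  fixes S :: "'a set" and W :: "nat \<Rightarrow> 'a set" and g :: 'a
  assumes W: "gsub S W" and g: "g \<in> carrier R" and S: "S \<subseteq> carrier R" and ntW: "noeth_seq S W"
begin

private lemma gsub_zero: "gsub S (\<lambda>_. {\<zero>})"
  by (rule gsubI) (use S zeroideal in auto)

private lemma gsub_powsum: "gsub S (powsum g W q)"
  by (induction q) (use gsub_zero gsub_addshift W g S in auto)

private lemma powsum_mono: "i \<le> j \<Longrightarrow> powsum g W i n \<subseteq> powsum g W j n"
proof (induction j)
  case (Suc j)
  have "powsum g W j n \<subseteq> powsum g W (Suc j) n"
    using addshift_superset[OF gsub_powsum W _ S] g by simp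
  then show ?case using Suc by (cases "i = Suc j") auto
qed auto

private lemma powsum_shift: "x \<in> powsum g W q n \<Longrightarrow> g \<otimes> x \<in> powsum g W (Suc q) (Suc n)"
proof (induction q arbitrary: x)
  case 0
  have "\<zero> \<in> powsum g W (Suc 0) (Suc n)" using ideal_zero gsub_ideal gsub_powsum by blast
  then show ?case using 0 g by simp
next
  case (Suc q)
  have "x \<in> addshift (powsum g W q) (g [^] q) q W n" using Suc by simp
  then show ?case
  proof (cases rule: addshiftE)
    case 1
    then show ?thesis using Suc.IH powsum_mono[of "Suc q" "Suc (Suc q)" "Suc n"] by auto
  next
    case (2 m v w)
    have c: "v \<in> carrier R" "w \<in> carrier R"
      using 2 ideal_carrier gsub_ideal gsub_powsum W by blast+
    have "g \<otimes> x = g \<otimes> v \<oplus> g [^] Suc q \<otimes> w"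
      using 2 c g by (simp add: r_distr m_ac)
    moreover have "g \<otimes> v \<oplus> g [^] Suc q \<otimes> w \<in> addshift (powsum g W (Suc q)) (g [^] Suc q) (Suc q) W (m + Suc q)"
      by (rule addshiftI) (use Suc.IH 2 in auto)
    ultimately show ?thesis using 2 by simp
  qed
qed

lemma gsub_UN_powsum: "gsub (insert g S) (\<lambda>n. \<Union>q. powsum g W q n)"
proof (rule gsubI)
  have I: "ideal (powsum g W q n) R" for q n using gsub_ideal gsub_powsum by blast
  fix n
  show "ideal (\<Union>q. powsum g W q n) R"
  proof (rule ideal_commI)
    show "(\<Union>q. powsum g W q n) \<subseteq> carrier R" using I ideal_carrier by blast
    show "\<zero> \<in> (\<Union>q. powsum g W q n)" using I ideal_zero by blast
    show "x \<oplus> y \<in> (\<Union>q. powsum g W q n)" if xy: "x \<in> (\<Union>q. powsum g W q n)" "y \<in> (\<Union>q. powsum g W q n)" for x y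
    proof -
      obtain i j where "x \<in> powsum g W i n" "y \<in> powsum g W j n" using xy by blast
      then have "x \<in> powsum g W (max i j) n" "y \<in> powsum g W (max i j) n"
        using powsum_mono[of i "max i j" n] powsum_mono[of j "max i j" n] by auto
      then show ?thesis using I ideal_add by blast
    qed
    show "a \<otimes> x \<in> (\<Union>q. powsum g W q n)" if "a \<in> carrier R" "x \<in> (\<Union>q. powsum g W q n)" for a x
      using that I ideal_mult by blast
  qed
next
  fix n h x assume h: "h \<in> insert g S" "x \<in> (\<Union>q. powsum g W q n)"
  then obtain q where x: "x \<in> powsum g W q n" by blast
  show "h \<otimes> x \<in> (\<Union>q. powsum g W q (Suc n))"
    using h x powsum_shift[OF x] gsub_mult[OF gsub_powsum _ x] by blast
qed

lemma UN_powsum_superset: "W n \<subseteq> (\<Union>q. powsum g W q n)"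
proof
  fix w assume w: "w \<in> W n"
  have "\<zero> \<oplus> g [^] (0::nat) \<otimes> w \<in> addshift (powsum g W 0) (g [^] (0::nat)) 0 W (n + 0)"
    by (rule addshiftI) (use w in auto)
  moreover have "w \<in> carrier R" using w ideal_carrier gsub_ideal W by blast
  ultimately have "w \<in> powsum g W (Suc 0) n" by simp
  then show "w \<in> (\<Union>q. powsum g W q n)" by blast
qed

text \<open>Hilbert's basis theorem: the ideals of leading coefficients form a doubly increasing family,
  hence only finitely many of them are distinct.\<close>

lemma noeth_seq_UN_powsum: "noeth_seq (insert g S) (\<lambda>n. \<Union>q. powsum g W q n)"
  unfolding noeth_seq_def
proof (intro allI impI)
  fix f assume f: "\<forall>k. gsub (insert g S) (f k) \<and> f k \<le> (\<lambda>n. \<Union>q. powsum g W q n) \<and> f k \<le> f (Suc k)"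
  have mono: "f i \<le> f j" if "i \<le> j" for i j
    using lift_Suc_mono_le[of f, OF _ that] f by blast
  have fS: "gsub S (f k)" for k using f gsub_subset by blast
  have car: "x \<in> powsum g W q n \<Longrightarrow> x \<in> carrier R" "x \<in> W n \<Longrightarrow> x \<in> carrier R" for x q n
    using ideal_carrier gsub_ideal gsub_powsum W by blast+
  \<comment> \<open>\<open>L k q\<close> collects the coefficients at \<open>(g t)^q\<close> of
    members of \<open>f k\<close> in stage \<open>q + 1\<close>. It grows with \<open>k\<close>
    since \<open>f\<close> does, and with \<open>q\<close> since \<open>f k\<close> is closed under
    multiplication by \<open>g t\<close>.\<close>
  define L where "L = (\<lambda>k q. lead (powsum g W q) (g [^] q) q W (f k))"
  have L1: "gsub S (L k q)" for k q
    unfolding L_def by (rule gsub_lead[OF gsub_powsum W _ S fS]) (use g in simp)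
  have L2: "L k q \<le> W" for k q by (auto simp: L_def lead_def le_fun_def)
  have L3: "L k q \<le> L j q" if "k \<le> j" for k j q
    using mono[OF that] unfolding L_def lead_def le_fun_def by blast
  have L4: "L k q \<le> L k (Suc q)" for k q
    unfolding le_fun_def
  proof (intro allI subsetI)
    fix n w assume "w \<in> L k q n"
    then obtain v where *: "w \<in> W n" "v \<in> powsum g W q (n + q)" "v \<oplus> g [^] q \<otimes> w \<in> f k (n + q)"
      by (auto simp: L_def lead_def)
    have "g \<otimes> v \<oplus> g [^] Suc q \<otimes> w = g \<otimes> (v \<oplus> g [^] q \<otimes> w)"
      using * g car by (simp add: r_distr m_ac)
    also have "\<dots> \<in> f k (n + Suc q)" using gsub_mult[of "insert g S" "f k" g, OF _ _ *(3)] f by simp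
    finally have "g \<otimes> v \<oplus> g [^] Suc q \<otimes> w \<in> f k (n + Suc q)" .
    moreover have "g \<otimes> v \<in> powsum g W (Suc q) (n + Suc q)" using powsum_shift[OF *(2)] by simp
    ultimately show "w \<in> L k (Suc q) n" using *(1) unfolding L_def lead_def by blast
  qed
  have L5: "L k q \<le> L k p" if "q \<le> p" for k p q
    using lift_Suc_mono_le[of "L k", OF L4 that] .
  \<comment> \<open>The diagonal is a single chain in \<open>W\<close>. Once it is stationary it
    controls all columns beyond \<open>n0\<close>; the finitely many columns up to \<open>n0\<close>
    are handled one by one.\<close>
  obtain n0 where n0: "\<And>k. k \<ge> n0 \<Longrightarrow> L k k = L n0 n0"
  proof (rule noeth_seqD[OF ntW, of "\<lambda>k. L k k"])
    show "L k k \<le> L (Suc k) (Suc k)" for k using L3[of k "Suc k" k] L4[of "Suc k" k] by simp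
  qed (use L1 L2 in auto)
  have "\<exists>m. \<forall>k\<ge>m. L k q = L m q" for q
    using noeth_seqD[OF ntW, of "\<lambda>k. L k q"] L1 L2 L3 by (metis le_SucI order_refl)
  then obtain m where m: "\<And>q k. k \<ge> m q \<Longrightarrow> L k q = L (m q) q" by metis
  define N where "N = Max (insert n0 (m ` {..n0}))"
  have N0: "n0 \<le> N" by (simp add: N_def)
  have Nm: "m q \<le> N" if "q \<le> n0" for q
    unfolding N_def
  proof (rule Max_ge)
    show "m q \<in> insert n0 (m ` {..n0})" using that by (intro insertI2 imageI) simp
  qed simp
  have LN: "L k q = L N q" if k: "k \<ge> N" for k q
  proof (cases "q \<le> n0")
    case True
    then have "m q \<le> N" "m q \<le> k" using Nm[OF True] k by auto
    then show ?thesis using m[of q k] m[of q N] by simp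
  next
    case False
    \<comment> \<open>For \<open>q > n0\<close> the entry lies between the diagonal entries at
      \<open>n0\<close> and at \<open>max j q\<close>, which coincide.\<close>
    have "L j q = L n0 n0" if j: "j \<ge> n0" for j
    proof (rule antisym)
      have "L j q \<le> L (max j q) (max j q)"
        using L3[of j "max j q" q] L5[of q "max j q" "max j q"] by simp
      then show "L j q \<le> L n0 n0" using n0[of "max j q"] j by simp
      show "L n0 n0 \<le> L j q" using L3[of n0 j n0] L5[of n0 q j] j False by simp
    qed
    from this[of k] this[of N] show ?thesis using N0 k by simp
  qed
  have "f k = f N" if k: "k \<ge> N" for k
  proof
    fix n
    have eq: "f N n \<inter> powsum g W q n = f k n \<inter> powsum g W q n" for q
    proof (induction q arbitrary: n)
      case 0
      then show ?case using ideal_zero[OF gsub_ideal[OF fS]] by auto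
    next
      case (Suc q)
      show ?case unfolding powsum.simps
        by (rule addshift_eq[OF gsub_powsum W _ S fS fS mono[OF k] Suc])
          (use g LN[OF k, of q] in \<open>auto simp: L_def\<close>)
    qed
    have un: "f j n = (\<Union>q. f j n \<inter> powsum g W q n)" for j
    proof -
      have "f j \<le> (\<lambda>n. \<Union>q. powsum g W q n)" using f by simp
      then have "f j n \<subseteq> (\<Union>q. powsum g W q n)" by (rule le_funD)
      then show ?thesis by blast
    qed
    show "f k n = f N n"
      by (subst un[of k], subst un[of N]) (simp only: eq)
  qed
  then show "\<exists>n. \<forall>k\<ge>n. f k = f n" by blast
qed

end

end

locale noeth_cring = cring R + noetherian_ring R for R (structure)
begin

lemma ideal_chain_stable:
  assumes "\<And>k. ideal (f k) R" "\<And>k :: nat. f k \<subseteq> f (Suc k)"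
  shows "\<exists>n. \<forall>k\<ge>n. f k = f n"
proof -
  have mono: "f i \<subseteq> f j" if "i \<le> j" for i j
    using lift_Suc_mono_le[of f, OF assms(2) that] .
  have "subset.chain {I. ideal I R} (range f)"
    unfolding pred_on.chain_def
  proof (intro conjI ballI)
    show "range f \<subseteq> {I. ideal I R}" using assms(1) by blast
    fix A B assume "A \<in> range f" "B \<in> range f"
    then obtain i j where "A = f i" "B = f j" by blast
    then show "(\<subset>)\<^sup>=\<^sup>= A B \<or> (\<subset>)\<^sup>=\<^sup>= B A"
      using mono[of i j] mono[of j i] nat_le_linear[of i j] by blast
  qed
  then have "\<Union> (range f) \<in> range f" using ideal_chain_is_trivial by blast
  then obtain n where "\<Union> (range f) = f n" by blast
  then have "\<forall>k\<ge>n. f k = f n" using mono by blast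
  then show ?thesis by blast
qed

text \<open>\<open>W\<close> is the algebra \<open>R[g t | g \<in> S]\<close>, built from
  \<open>R\<close> in degree 0 by adjoining one generator at a time. The clause on
  \<open>W 0\<close> is what later forces all powers of the ideal generated by \<open>S\<close> into
  \<open>W\<close>.\<close>

lemma exists_noetherian_gsub:
  assumes "finite S" "S \<subseteq> carrier R"
  shows "\<exists>W. gsub S W \<and> W 0 = carrier R \<and> noeth_seq S W"
  using assms
proof (induction S)
  case empty
  let ?W = "\<lambda>n::nat. if n = 0 then carrier R else {\<zero>}"
  have "gsub {} ?W" by (rule gsubI) (use oneideal zeroideal in auto)
  moreover have "noeth_seq {} ?W" unfolding noeth_seq_def
  proof (intro allI impI)
    fix f assume f: "\<forall>k. gsub {} (f k) \<and> f k \<le> ?W \<and> f k \<le> f (Suc k)"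
    have I: "ideal (f k n) R" for k n using f gsub_ideal by blast
    have "\<exists>n. \<forall>k\<ge>n. f k 0 = f n 0"
      by (rule ideal_chain_stable) (use I f in \<open>auto simp: le_fun_def\<close>)
    then obtain n where n: "\<forall>k\<ge>n. f k 0 = f n 0" by blast
    have "f k (Suc i) = {\<zero>}" for k i
    proof -
      have "f k (Suc i) \<subseteq> ?W (Suc i)" using f unfolding le_fun_def by blast
      then show ?thesis using ideal_zero[OF I[of k "Suc i"]] by auto
    qed
    note zero = this
    have "f k i = f n i" if k: "k \<ge> n" for k i
    proof (cases i)
      case 0
      show ?thesis unfolding 0 using n[rule_format, OF k] .
    qed (simp add: zero)
    then have "\<forall>k\<ge>n. f k = f n" by (intro allI impI ext)
    then show "\<exists>n. \<forall>k\<ge>n. f k = f n" by blast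
  qed
  ultimately show ?case by (intro exI[of _ ?W]) simp
next
  case (insert g S)
  then obtain W where W: "gsub S W" "W 0 = carrier R" "noeth_seq S W" by auto
  have g: "g \<in> carrier R" and S: "S \<subseteq> carrier R" using insert by auto
  let ?W = "\<lambda>n. \<Union>q. powsum g W q n"
  have "gsub (insert g S) ?W" "noeth_seq (insert g S) ?W"
    using gsub_UN_powsum noeth_seq_UN_powsum W g S by auto
  moreover have "?W 0 = carrier R"
  proof
    show "?W 0 \<subseteq> carrier R" using gsub_ideal[OF calculation(1), of 0] ideal_carrier by blast
    show "carrier R \<subseteq> ?W 0" using UN_powsum_superset[OF W(1) g S W(3), of 0] W(2) by simp
  qed
  ultimately show ?case by blast
qed

end

section \<open>Powers of ideals, and the reduction equation as finite generation\<close>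

context cring
begin

lemma pow_ideal: "ideal J R \<Longrightarrow> ideal (ideal_pow R J n) R"
proof (induction n)
  case 0 then show ?case by (simp add: nat_pow_def ideals_set_def oneideal)
next
  case (Suc n) then show ?case by (simp add: nat_pow_def ideals_set_def ideal_prod_is_ideal)
qed

lemma ideals_one [simp]: "\<one>\<^bsub>ideals_set R\<^esub> = carrier R"
  by (simp add: ideals_set_def)

lemma pow_0: "ideal_pow R J 0 = carrier R"
  by simp

lemma pow_Suc: "ideal_pow R J (Suc n) = ideal_prod R (ideal_pow R J n) J"
  by (simp add: nat_pow_def ideals_set_def)

lemma pow_1: "ideal J R \<Longrightarrow> ideal_pow R J (Suc 0) = J"
  unfolding pow_Suc pow_0 by (simp add: ideal_prod_commute[OF oneideal] ideal_prod_one)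

lemma ideal_prod_least:
  assumes "ideal K R" "\<And>a b. \<lbrakk>a \<in> A; b \<in> B\<rbrakk> \<Longrightarrow> a \<otimes> b \<in> K"
  shows "ideal_prod R A B \<subseteq> K"
proof
  fix x assume "x \<in> ideal_prod R A B"
  then show "x \<in> K" by induction (use assms ideal_add in auto)
qed

lemma gsub_pow:
  assumes "ideal J R" shows "gsub J (ideal_pow R J)"
proof (rule gsubI)
  fix n g x assume "g \<in> J" "x \<in> ideal_pow R J n"
  then have "x \<otimes> g \<in> ideal_pow R J (Suc n)" unfolding pow_Suc by (blast intro: ideal_prod.prod)
  then show "g \<otimes> x \<in> ideal_pow R J (Suc n)"
    using \<open>g \<in> J\<close> \<open>x \<in> _\<close> assms pow_ideal m_comm by (metis ideal_carrier)
qed (use assms pow_ideal in blast)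

text \<open>Closure under the degree 1 part extends to the whole Rees algebra: for fixed
  \<open>x\<close> the admissible \<open>a\<close> form an ideal, so it is enough to treat products
  \<open>b g\<close> with \<open>g\<close> in \<open>J\<close>, where \<open>g\<close> is applied
  first.\<close>

lemma pow_mult_gsub:
  assumes J: "ideal J R" and N: "gsub J N"
  shows "a \<in> ideal_pow R J n \<Longrightarrow> x \<in> N s \<Longrightarrow> a \<otimes> x \<in> N (n + s)"
proof (induction n arbitrary: a x s)
  case 0
  then show ?case using ideal_mult[OF gsub_ideal[OF N]] by (simp add: pow_0)
next
  case (Suc n)
  have xR: "x \<in> carrier R" using Suc.prems ideal_carrier gsub_ideal[OF N] by blast
  have "a \<in> ideal_prod R (ideal_pow R J n) J" using Suc.prems(1) unfolding pow_Suc .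
  moreover have "ideal_prod R (ideal_pow R J n) J \<subseteq> {a \<in> carrier R. a \<otimes> x \<in> N (Suc n + s)}"
  proof (rule ideal_prod_least)
    have "ideal {a \<in> carrier R. x \<otimes> a \<in> N (Suc n + s)} R"
      by (rule ideal.helper_max_prime[OF gsub_ideal[OF N] cring_axioms xR])
    moreover have "{a \<in> carrier R. x \<otimes> a \<in> N (Suc n + s)} = {a \<in> carrier R. a \<otimes> x \<in> N (Suc n + s)}"
      using xR m_comm by auto
    ultimately show "ideal {a \<in> carrier R. a \<otimes> x \<in> N (Suc n + s)} R" by simp
    fix b g assume bg: "b \<in> ideal_pow R J n" "g \<in> J"
    have c: "b \<in> carrier R" "g \<in> carrier R" using bg J pow_ideal ideal_carrier by blast+
    have "b \<otimes> (g \<otimes> x) \<in> N (n + Suc s)" by (rule Suc.IH) (use bg gsub_mult[OF N] Suc.prems in auto)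
    then show "b \<otimes> g \<in> {a \<in> carrier R. a \<otimes> x \<in> N (Suc n + s)}" using c xR by (simp add: m_assoc)
  qed
  ultimately show ?case by blast
qed

lemma pow_mult:
  assumes "ideal J R" "a \<in> ideal_pow R J i" "b \<in> ideal_pow R J j"
  shows "a \<otimes> b \<in> ideal_pow R J (i + j)"
  using pow_mult_gsub[OF assms(1) gsub_pow[OF assms(1)] assms(2,3)] .

lemma pow_le_gsub:
  assumes "ideal J R" "gsub J N" "N 0 = carrier R"
  shows "ideal_pow R J \<le> N"
proof (unfold le_fun_def, intro allI subsetI)
  fix n a assume a: "a \<in> ideal_pow R J n"
  have "a \<otimes> \<one> \<in> N (n + 0)" by (rule pow_mult_gsub[OF assms(1,2) a]) (simp add: assms(3))
  then show "a \<in> N n" using ideal_carrier[OF pow_ideal[OF assms(1)] a] by simp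
qed

lemma pow_subset:
  assumes "ideal J R" "ideal I R" "J \<subseteq> I"
  shows "ideal_pow R J n \<subseteq> ideal_pow R I n"
  using pow_le_gsub[OF assms(1) gsub_subset[OF gsub_pow[OF assms(2)] assms(3)]] by (simp add: pow_0 le_fun_def)

lemma reduction_pow:
  assumes J: "ideal J R" and I: "ideal I R"
    and r: "ideal_prod R J (ideal_pow R I r) = ideal_pow R I (Suc r)"
  shows "n \<ge> r \<Longrightarrow> ideal_pow R I (Suc n) = ideal_prod R J (ideal_pow R I n)"
proof (induction n rule: dec_induct)
  case base then show ?case using r by simp
next
  case (step n)
  then show ?case
    using ideal_prod_assoc[OF J pow_ideal[OF I] I] by (metis pow_Suc)
qed

end

context noeth_cring
begin

text \<open>The Rees algebra is generated over \<open>R\<close> by \<open>S t\<close> for finitely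
  many generators \<open>S\<close> of \<open>J\<close>, hence it embeds into the Noetherian
  \<open>W\<close> of these generators.\<close>

lemma noeth_seq_pow:
  assumes J: "ideal J R"
  shows "noeth_seq J (ideal_pow R J)"
proof -
  obtain S where S: "S \<subseteq> carrier R" "finite S" "J = Idl S" using finetely_gen[OF J] by blast
  obtain W where W: "gsub S W" "W 0 = carrier R" "noeth_seq S W" using exists_noetherian_gsub S by blast
  have "S \<subseteq> J" using S genideal_self by blast
  moreover have "ideal_pow R J \<le> W"
    by (rule pow_le_gsub[where N = W, OF J]) (use gsub_Idl[OF W(1) S(1)] W(2) S in simp_all)
  ultimately show ?thesis using noeth_seq_le[OF noeth_seq_subset[OF W(3)]] by blast
qed

text \<open>From degree \<open>r\<close> on, \<R>(I) is produced by multiplication with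
  \<open>J\<close>. So it is generated over \<R>(J) by generators of
  \<open>I^0, \<dots>, I^r\<close>, finitely many in all.\<close>

lemma noeth_seq_reduction_pow:
  assumes J: "ideal J R" and I: "ideal I R"
    and r: "ideal_prod R J (ideal_pow R I r) = ideal_pow R I (Suc r)"
  shows "noeth_seq J (ideal_pow R I)"
proof -
  \<comment> \<open>A pair \<open>(y, s)\<close> stands for the homogeneous element
    \<open>y t^s\<close>; each one is adjoined by adding the shifted cyclic module
    \<open>y t^s \<R>(J)\<close>.\<close>
  have fin: "\<exists>V. gsub J V \<and> noeth_seq J V \<and> (\<forall>(y,s)\<in>T. y \<in> V s)" if "finite T" "T \<subseteq> carrier R \<times> UNIV" for T
    using that
  proof (induction T)
    case empty
    then show ?case using noeth_seq_pow[OF J] gsub_pow[OF J] by blast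
  next
    case (insert ys T)
    then obtain V where V: "gsub J V" "noeth_seq J V" "\<forall>(y,s)\<in>T. y \<in> V s" by auto
    obtain y s where ys: "ys = (y, s)" "y \<in> carrier R" using insert by auto
    have JR: "J \<subseteq> carrier R" using J ideal_carrier by blast
    let ?V = "addshift V y s (ideal_pow R J)"
    note hyps = V(1) gsub_pow[OF J] ys(2) JR
    have "\<zero> \<oplus> y \<otimes> \<one> \<in> addshift V y s (ideal_pow R J) (0 + s)"
      by (rule addshiftI) (use V in \<open>auto simp: pow_0 intro: ideal_zero gsub_ideal\<close>)
    then have "y \<in> ?V s" using ys by simp
    moreover have "\<forall>(y,s)\<in>T. y \<in> ?V s" using V(3) addshift_superset[OF hyps] by blast
    moreover have "gsub J ?V" using gsub_addshift[OF hyps] .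
    moreover have "noeth_seq J ?V" using noeth_seq_addshift[OF hyps V(2) noeth_seq_pow[OF J]] .
    ultimately show ?case using ys(1) by blast
  qed
  have "\<exists>A. A \<subseteq> carrier R \<and> finite A \<and> ideal_pow R I s = Idl A" for s
    using finetely_gen[OF pow_ideal[OF I]] by blast
  then obtain A where A: "\<And>s. A s \<subseteq> carrier R" "\<And>s. finite (A s)" "\<And>s. ideal_pow R I s = Idl (A s)"
    by metis
  obtain V where V: "gsub J V" "noeth_seq J V" "\<forall>(y,s)\<in>(\<Union>s\<in>{..r}. A s \<times> {s}). y \<in> V s"
    using fin[of "\<Union>s\<in>{..r}. A s \<times> {s}"] A by fast
  have low: "ideal_pow R I s \<subseteq> V s" if "s \<le> r" for s
    unfolding A(3) by (rule genideal_minimal) (use gsub_ideal[OF V(1)] V(3) that in auto)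
  have high: "ideal_pow R I n \<subseteq> V n" if "n \<ge> r" for n
    using that
  proof (induction n rule: dec_induct)
    case base then show ?case using low by simp
  next
    case (step n)
    then show ?case unfolding reduction_pow[OF J I r step(1)]
      by (intro ideal_prod_least) (use gsub_ideal[OF V(1)] gsub_mult[OF V(1)] in auto)
  qed
  have "ideal_pow R I \<le> V" using low high by (metis le_fun_def nle_le)
  then show ?thesis using noeth_seq_le V by blast
qed

end

section \<open>Eventually polynomial functions\<close>

definition evpoly :: "(nat \<Rightarrow> nat) \<Rightarrow> rat poly \<Rightarrow> bool" where
  "evpoly h Q \<longleftrightarrow> (\<forall>\<^sub>F n in sequentially. of_nat (h n) = poly Q (of_nat n))"

lemma evpolyD: "evpoly h Q \<Longrightarrow> \<exists>N. \<forall>n\<ge>N. of_nat (h n) = poly Q (of_nat n)"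
  unfolding evpoly_def eventually_sequentially by blast

lemma evpolyI: "(\<And>n. n \<ge> N \<Longrightarrow> of_nat (h n) = poly Q (of_nat n)) \<Longrightarrow> evpoly h Q"
  unfolding evpoly_def eventually_sequentially by blast

text \<open>Induction along Horner's scheme \<open>a + n q(n)\<close>. It needs the bound
  \<open>e\<close> away from 0, not mere positivity: \<open>n e\<close> then outweighs
  \<open>a\<close>.\<close>

lemma poly_eventually_pos:
  fixes p :: "rat poly"
  shows "Polynomial.lead_coeff p > 0 \<Longrightarrow> \<exists>e>0. \<exists>N. \<forall>n\<ge>N. poly p (of_nat n) \<ge> e"
proof (induction p)
  case (pCons a q)
  show ?case
  proof (cases "q = 0")
    case True
    then show ?thesis using pCons.prems by (auto intro!: exI[of _ a])
  next
    case False
    then obtain e N where e: "e > 0" "\<forall>n\<ge>N. poly q (of_nat n) \<ge> e"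
      using pCons by auto
    obtain m :: nat where m: "of_nat m > (e + \<bar>a\<bar>) / e" using reals_Archimedean2 by blast
    have "poly (pCons a q) (of_nat n) \<ge> e" if n: "n \<ge> max N m" for n
    proof -
      have "(of_nat m :: rat) \<le> of_nat n" using n by simp
      then have "(e + \<bar>a\<bar>) / e < of_nat n" using m by linarith
      then have "e + \<bar>a\<bar> < of_nat n * e" using e(1) by (simp add: pos_divide_less_eq)
      also have "\<dots> \<le> of_nat n * poly q (of_nat n)"
        using e(2) n by (intro mult_left_mono) auto
      finally show ?thesis by simp
    qed
    then show ?thesis using e(1) by blast
  qed
qed simp

text \<open>This excludes cancellation when Hilbert polynomials are added, so that the degree of a
  sum is the maximum of the degrees.\<close>

lemma evpoly_lead_coeff_nonneg:
  assumes "evpoly h Q" shows "Polynomial.lead_coeff Q \<ge> 0"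
proof (rule ccontr)
  assume "\<not> ?thesis"
  then have "Polynomial.lead_coeff (- Q) > 0" by simp
  then obtain e N where e: "e > 0" "\<forall>n\<ge>N. poly (- Q) (of_nat n) \<ge> e"
    using poly_eventually_pos by blast
  obtain M where "\<And>n. n \<ge> M \<Longrightarrow> of_nat (h n) = poly Q (of_nat n)" using evpolyD[OF assms] by blast
  then have "poly Q (of_nat (max M N)) = of_nat (h (max M N))" by simp
  also have "\<dots> \<ge> 0" by simp
  finally show False using e(1) e(2)[rule_format, of "max M N"] by simp
qed

lemma evpoly_zero:
  assumes "evpoly h Q" "\<And>n. h n = 0" shows "Q = 0"
proof (rule ccontr)
  assume "Q \<noteq> 0"
  then have fin: "finite {x. poly Q x = 0}" by (rule poly_roots_finite)
  obtain M where "\<forall>n\<ge>M. of_nat (h n) = poly Q (of_nat n)" using evpolyD[OF assms(1)] by blast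
  then have "of_nat ` {M..} \<subseteq> {x. poly Q x = 0}" using assms(2) by auto
  then have "finite (of_nat ` {M..} :: rat set)" using fin finite_subset by blast
  then have "finite {M..}" by (rule finite_imageD) (simp add: inj_on_def)
  then show False by (simp add: infinite_Ici)
qed

lemma poly_deg_add:
  fixes p q :: "rat poly"
  assumes "Polynomial.lead_coeff p \<ge> 0" "Polynomial.lead_coeff q \<ge> 0"
  shows "poly_deg (p + q) = max (poly_deg p) (poly_deg q)"
proof (cases "p = 0 \<or> q = 0")
  case True
  then show ?thesis by (auto simp: poly_deg_def)
next
  case False
  then have pos: "Polynomial.lead_coeff p > 0" "Polynomial.lead_coeff q > 0"
    using assms by (simp_all add: order_less_le)
  consider "Polynomial.degree p < Polynomial.degree q" | "Polynomial.degree q < Polynomial.degree p"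
    | "Polynomial.degree p = Polynomial.degree q" by linarith
  then show ?thesis
  proof cases
    case 1
    then have "Polynomial.degree (p + q) = Polynomial.degree q" by (rule degree_add_eq_right)
    then show ?thesis using False 1 by (auto simp: poly_deg_def)
  next
    case 2
    then have "Polynomial.degree (p + q) = Polynomial.degree p" by (rule degree_add_eq_left)
    then show ?thesis using False 2 by (auto simp: poly_deg_def)
  next
    case 3
    have c: "Polynomial.coeff (p + q) (Polynomial.degree p) > 0" using pos 3 by simp
    then have "Polynomial.degree (p + q) \<ge> Polynomial.degree p"
      by (intro le_degree) simp
    moreover have "Polynomial.degree (p + q) \<le> Polynomial.degree p"
      using degree_add_le_max[of p q] 3 by simp
    moreover have "p + q \<noteq> 0" using c by (metis coeff_0 less_irrefl)
    ultimately show ?thesis using False 3 by (simp add: poly_deg_def)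
  qed
qed

lemma evpoly_add:
  assumes "evpoly h Q" "evpoly g P" shows "evpoly (\<lambda>n. h n + g n) (Q + P)"
  using assms unfolding evpoly_def by eventually_elim simp

lemma evpoly_shift:
  assumes "evpoly h Q" and g: "\<And>n. g (n + s) = h n"
  shows "\<exists>P. evpoly g P \<and> poly_deg P = poly_deg Q"
proof (intro exI conjI)
  let ?P = "pcompose Q [:- of_nat s, 1:]"
  obtain N where N: "\<And>n. n \<ge> N \<Longrightarrow> of_nat (h n) = poly Q (of_nat n)" using evpolyD[OF assms(1)] by blast
  show "evpoly g ?P"
  proof (rule evpolyI)
    fix n assume n: "n \<ge> N + s"
    then obtain m where m: "n = m + s" "m \<ge> N" by (metis add_le_imp_le_right le_add2 le_add_diff_inverse2 order_trans)
    then show "of_nat (g n) = poly ?P (of_nat n)"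
      using N[OF m(2)] g by (simp add: poly_pcompose)
  qed
  show "poly_deg ?P = poly_deg Q"
    by (auto simp: poly_deg_def pcompose_eq_0 degree_pcompose)
qed

lemma pcompose_pow: "pcompose (p ^ n) q = pcompose p (q :: rat poly) ^ n"
  by (induction n) (simp_all add: pcompose_mult one_pCons)

text \<open>The forward difference of \<open>c x^(k+1) / (k+1)\<close> has the same leading term
  \<open>c x^k\<close> as \<open>Q\<close>; subtracting it lowers the degree, and induction
  finishes.\<close>

lemma antidifference:
  fixes Q :: "rat poly"
  shows "\<exists>F. (\<forall>x. poly F (x + 1) - poly F x = poly Q x) \<and>
    Polynomial.degree F = (if Q = 0 then 0 else Suc (Polynomial.degree Q))"
\<comment> \<open>The measure places the zero polynomial strictly below the constants, which
  \<open>degree\<close> alone would not do.\<close>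
proof (induction "if Q = 0 then 0 else Suc (Polynomial.degree Q)" arbitrary: Q rule: less_induct)
  case (less Q)
  show ?case
  proof (cases "Q = 0")
    case True
    then show ?thesis by (intro exI[of _ 0]) simp
  next
    case False
    define k c where "k = Polynomial.degree Q" and "c = Polynomial.lead_coeff Q"
    define G where "G = Polynomial.monom (c / of_nat (Suc k)) (Suc k)"
    define D where "D = pcompose G [:1, 1:] - G"
    have c: "c \<noteq> 0" using False by (simp add: c_def)
    have G: "G = Polynomial.smult (c / of_nat (Suc k)) ([:0, 1:] ^ Suc k)"
      by (simp only: G_def monom_altdef)
    have D: "D = Polynomial.smult (c / of_nat (Suc k)) ([:1, 1:] ^ Suc k - [:0, 1:] ^ Suc k)"
      unfolding D_def G by (simp only: pcompose_smult pcompose_pow smult_diff_right) (simp add: pcompose_pCons)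
    have coeffD: "Polynomial.coeff D i = c / of_nat (Suc k) * (of_nat (Suc k choose i) - (if i = Suc k then 1 else 0))" for i
    proof -
      have "Polynomial.coeff ([:1, 1::rat:] ^ Suc k) i = of_nat (Suc k choose i)"
        by (cases "i \<le> Suc k") (simp_all add: coeff_linear_poly_power binomial_eq_0 degree_linear_power coeff_eq_0 del: power_Suc)
      moreover have "Polynomial.coeff ([:0, 1::rat:] ^ Suc k) i = (if i = Suc k then 1 else 0)"
        unfolding monom_altdef[of "1::rat" "Suc k", unfolded smult_1_left, symmetric]
        by (auto simp: coeff_monom)
      ultimately show ?thesis unfolding D by (simp only: coeff_smult coeff_diff)
    qed
    have degD: "Polynomial.degree D \<le> k"
    proof (rule degree_le, intro allI impI)
      fix i assume "k < i"
      then show "Polynomial.coeff D i = 0" by (cases "i = Suc k") (simp_all add: coeffD binomial_eq_0)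
    qed
    have "Polynomial.coeff D k = c" by (simp add: coeffD del: of_nat_Suc)
    then have "Polynomial.coeff (Q - D) k = 0" by (simp add: c_def k_def)
    moreover have "Polynomial.degree (Q - D) \<le> k" using degree_diff_le_max[of Q D] degD k_def by simp
    ultimately have lt: "(if Q - D = 0 then 0 else Suc (Polynomial.degree (Q - D))) \<le> k"
      by (metis Suc_leI le_neq_implies_less leading_coeff_0_iff zero_le)
    then have "(if Q - D = 0 then 0 else Suc (Polynomial.degree (Q - D))) < (if Q = 0 then 0 else Suc (Polynomial.degree Q))"
      using False by (simp only: k_def if_False)
    then obtain F where F: "\<And>x. poly F (x + 1) - poly F x = poly (Q - D) x"
      "Polynomial.degree F = (if Q - D = 0 then 0 else Suc (Polynomial.degree (Q - D)))"
      using less.hyps[of "Q - D"] by blast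
    have "poly (G + F) (x + 1) - poly (G + F) x = poly Q x" for x
    proof -
      have "poly D x = poly G (x + 1) - poly G x"
        by (simp add: D_def poly_pcompose add.commute)
      then show ?thesis using F(1)[of x] by simp
    qed
    moreover have "Polynomial.degree G = Suc k" using c by (simp add: G_def degree_monom_eq del: of_nat_Suc)
    then have "Polynomial.degree (G + F) = Suc k" using F(2) lt by (simp add: degree_add_eq_left)
    ultimately show ?thesis using False k_def by (intro exI[of _ "G + F"]) simp
  qed
qed

text \<open>The increment from \<open>n\<close> to \<open>n + 1\<close> is \<open>g (n + 1)\<close>,
  so the antidifference is taken of \<open>Q (x + 1)\<close>. For \<open>Q = 0\<close> the sum is
  eventually constant, and whether that constant vanishes is left to the user of the lemma.\<close>

lemma evpoly_sum:
  assumes g: "evpoly g Q" and h: "\<And>n. h (Suc n) = h n + g (Suc n)"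
  obtains P where "evpoly h P" "Q \<noteq> 0 \<Longrightarrow> poly_deg P = poly_deg Q + 1" "Q = 0 \<Longrightarrow> Polynomial.degree P = 0"
proof -
  let ?Q = "pcompose Q [:1, 1:]"
  obtain F where F: "\<And>x. poly F (x + 1) - poly F x = poly ?Q x"
    "Polynomial.degree F = (if ?Q = 0 then 0 else Suc (Polynomial.degree ?Q))"
    using antidifference by blast
  obtain N where N: "\<And>n. n \<ge> N \<Longrightarrow> of_nat (g n) = poly Q (of_nat n)" using evpolyD[OF g] by blast
  define c where "c = of_nat (h N) - poly F (of_nat N)"
  have Q0: "?Q = 0 \<longleftrightarrow> Q = 0" by (auto simp: pcompose_eq_0)
  show ?thesis
  proof (rule that[of "F + [:c:]"])
    show "evpoly h (F + [:c:])"
    proof (rule evpolyI)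
      fix n assume "n \<ge> N"
      then show "of_nat (h n) = poly (F + [:c:]) (of_nat n)"
      proof (induction n rule: dec_induct)
        case base show ?case by (simp add: c_def)
      next
        case (step n)
        have "of_nat (h (Suc n)) = poly (F + [:c:]) (of_nat n) + poly Q (of_nat (Suc n))"
          using step N[of "Suc n"] h[of n] by simp
        also have "poly Q (of_nat (Suc n)) = poly F (of_nat n + 1) - poly F (of_nat n)"
          using F(1)[of "of_nat n"] by (simp add: poly_pcompose)
        finally show ?case by (simp add: add.commute)
      qed
    qed
    show "Polynomial.degree (F + [:c:]) = 0" if "Q = 0"
      using F(2) that degree_add_le_max[of F "[:c:]"] by simp
    show "poly_deg (F + [:c:]) = poly_deg Q + 1" if "Q \<noteq> 0"
    proof -
      have d: "Polynomial.degree F = Suc (Polynomial.degree Q)" using F(2) that Q0 by (simp add: degree_pcompose)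
      then have "Polynomial.degree (F + [:c:]) = Suc (Polynomial.degree Q)" by (simp add: degree_add_eq_left)
      moreover from this have "F + [:c:] \<noteq> 0" by auto
      ultimately show ?thesis using that by (simp add: poly_deg_def)
    qed
  qed
qed

text \<open>The base \<open>n + 1\<close> instead of \<open>n\<close> keeps the bound valid at
  \<open>n = 0\<close> as well.\<close>

lemma poly_growth:
  fixes p :: "rat poly"
  shows "\<exists>C. \<forall>n::nat. poly p (of_nat n) \<le> of_nat C * (of_nat n + 1) ^ Polynomial.degree p"
proof (induction p)
  case 0
  show ?case by simp
next
  case (pCons a q)
  then obtain C where C: "\<And>n. poly q (of_nat n) \<le> of_nat C * (of_nat n + 1) ^ Polynomial.degree q" by blast
  obtain A :: nat where A: "\<bar>a\<bar> \<le> of_nat A" using real_arch_simple by blast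
  show ?case
  proof (cases "q = 0")
    case True
    then show ?thesis using A by (intro exI[of _ A]) auto
  next
    case False
    have "poly (pCons a q) (of_nat n) \<le> of_nat (A + C) * (of_nat n + 1) ^ Suc (Polynomial.degree q)" for n
    proof -
      have "of_nat n * poly q (of_nat n) \<le> of_nat n * (of_nat C * (of_nat n + 1) ^ Polynomial.degree q)"
        using C by (intro mult_left_mono) auto
      also have "\<dots> \<le> (of_nat n + 1) * (of_nat C * (of_nat n + 1) ^ Polynomial.degree q)"
        by (intro mult_right_mono) auto
      finally have 1: "of_nat n * poly q (of_nat n) \<le> of_nat C * (of_nat n + 1) ^ Suc (Polynomial.degree q)"
        by (simp add: algebra_simps)
      have "(1::rat) \<le> (of_nat n + 1) ^ Suc (Polynomial.degree q)" by (intro one_le_power) simp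
      then have "of_nat A * 1 \<le> (of_nat A :: rat) * (of_nat n + 1) ^ Suc (Polynomial.degree q)"
        by (intro mult_left_mono) auto
      then have "a \<le> of_nat A * (of_nat n + 1) ^ Suc (Polynomial.degree q)" using A by linarith
      then show ?thesis using 1 by (simp only: poly_pCons of_nat_add distrib_right)
    qed
    then show ?thesis using False by (intro exI[of _ "A + C"]) (simp del: power_Suc)
  qed
qed

text \<open>At most \<open>n + 1\<close> summands, each bounded by the growth of \<open>Q\<close>,
  give exponent \<open>degree Q + 1\<close>; the terms before \<open>h\<close> becomes polynomial
  contribute the constant \<open>D\<close>. For \<open>Q = 0\<close> only \<open>D\<close> remains
  and the exponent is 0.\<close>

lemma evpoly_sum_growth:
  assumes "evpoly h Q"
  shows "\<exists>C. \<forall>n. (\<Sum>j\<le>n. h j) \<le> C * (n + 1) ^ nat (poly_deg Q + 1)"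
proof -
  obtain N where N: "\<And>n. n \<ge> N \<Longrightarrow> of_nat (h n) = poly Q (of_nat n)" using evpolyD[OF assms] by blast
  obtain C where C: "\<And>n. poly Q (of_nat n) \<le> of_nat C * (of_nat n + 1) ^ Polynomial.degree Q"
    using poly_growth by blast
  define D where "D = (\<Sum>j<N. h j)"
  define p where "p = nat (poly_deg Q + 1)"
  have "(\<Sum>j\<le>n. h j) \<le> (D + C) * (n + 1) ^ p" for n
  proof (cases "Q = 0")
    case True
    have "(\<Sum>j\<le>n. h j) \<le> D"
    proof -
      have "(\<Sum>j\<le>n. h j) = (\<Sum>j\<in>{..n} \<inter> {..<N}. h j)"
        by (rule sum.mono_neutral_right) (use N True in \<open>auto simp: not_less\<close>)
      also have "\<dots> \<le> D" unfolding D_def by (rule sum_mono2) auto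
      finally show ?thesis .
    qed
    moreover have "D * 1 \<le> (D + C) * (n + 1) ^ p" by (intro mult_mono) auto
    ultimately show ?thesis by simp
  next
    case False
    let ?d = "Polynomial.degree Q"
    have hC: "h j \<le> C * (n + 1) ^ ?d" if "j \<ge> N" "j \<le> n" for j
    proof -
      have "(of_nat (h j) :: rat) \<le> of_nat (C * (j + 1) ^ ?d)"
        using C[of j] N that(1) by (simp add: add.commute)
      then have "h j \<le> C * (j + 1) ^ ?d" by (simp only: of_nat_le_iff)
      also have "\<dots> \<le> C * (n + 1) ^ ?d" using that by (intro mult_left_mono power_mono) auto
      finally show ?thesis .
    qed
    have "(\<Sum>j\<le>n. h j) \<le> (\<Sum>j\<in>{..<N} \<union> {N..n}. h j)" by (rule sum_mono2) auto
    also have "\<dots> = D + (\<Sum>j\<in>{N..n}. h j)"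
      unfolding D_def by (rule sum.union_disjoint) auto
    also have "(\<Sum>j\<in>{N..n}. h j) \<le> (\<Sum>j\<in>{N..n}. C * (n + 1) ^ ?d)"
      by (rule sum_mono) (use hC in auto)
    also have "\<dots> = card {N..n} * (C * (n + 1) ^ ?d)" by simp
    also have "\<dots> \<le> (n + 1) * (C * (n + 1) ^ ?d)"
      by (intro mult_right_mono) auto
    also have "\<dots> = C * (n + 1) ^ Suc ?d" by (simp only: power_Suc ac_simps)
    also have "D + C * (n + 1) ^ Suc ?d \<le> D * (n + 1) ^ Suc ?d + C * (n + 1) ^ Suc ?d"
      using one_le_power[of "n + 1" "Suc ?d"] by (intro add_mono) (simp_all del: power_Suc)
    finally show ?thesis using False by (simp add: p_def poly_deg_def nat_add_distrib distrib_right del: power_Suc)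
  qed
  then show ?thesis unfolding p_def by blast
qed

text \<open>The binomial coefficient is at least \<open>q^l / l!\<close>. If \<open>l > d\<close>,
  then \<open>q^l \<ge> q q^d\<close> beats the bound \<open>K q^d\<close> as soon as
  \<open>q\<close> exceeds \<open>K\<close>.\<close>

lemma growth_exponent_le:
  fixes C e l d :: nat
  assumes "\<And>q. (q + l) choose l \<le> C * (e * q + 1) ^ d"
  shows "l \<le> d"
proof (rule ccontr)
  assume "\<not> l \<le> d"
  then have l: "l \<ge> Suc d" by simp
  define K where "K = fact l * C * (e + 1) ^ d"
  have le: "q ^ l \<le> K * q ^ d" if q: "q \<ge> 1" for q
  proof -
    have "q ^ l \<le> fact l * ((q + l) choose l)"
    proof (induction l)
      case (Suc l)
      have "q ^ Suc l \<le> (q + Suc l) * (fact l * ((q + l) choose l))"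
        unfolding power_Suc by (intro mult_mono Suc) auto
      also have "\<dots> = fact l * ((q + Suc l) * ((q + l) choose l))" by (simp only: ac_simps)
      also have "(q + Suc l) * ((q + l) choose l) = Suc l * ((q + Suc l) choose Suc l)"
        using Suc_times_binomial_eq[of "q + l" l] by (simp add: mult.commute)
      finally show ?case by (simp add: algebra_simps del: power_Suc)
    qed simp
    also have "\<dots> \<le> fact l * (C * (e * q + 1) ^ d)" by (intro mult_left_mono assms) auto
    also have "\<dots> \<le> fact l * (C * ((e + 1) * q) ^ d)"
      using q by (intro mult_left_mono power_mono) auto
    also have "\<dots> = K * q ^ d" unfolding K_def power_mult_distrib by simp
    finally show ?thesis .
  qed
  define q where "q = Suc K"
  have "q * q ^ d \<le> q ^ l"
    using power_increasing[OF l, of q] by (simp add: q_def)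
  also have "\<dots> \<le> K * q ^ d" by (rule le) (simp add: q_def)
  finally show False by (simp add: q_def)
qed

section \<open>Homogeneous primes and Hilbert polynomials\<close>

lemma mult_module_simps [simp]:
  "carrier (mult_module S H) = H" "mult (mult_module S H) = mult S" "one (mult_module S H) = one S"
  "zero (mult_module S H) = zero S" "add (mult_module S H) = add S" "smult (mult_module S H) = mult S"
  by (simp_all add: mult_module_def)

lemma (in cring) module_mult_module: "module R (mult_module R (carrier R))"
proof (rule moduleI)
  show "abelian_group (mult_module R (carrier R))"
    by (rule abelian_groupI)
      (auto simp: a_ac intro: bexI[of _ "\<ominus> x" for x] l_neg)
qed (auto simp: cring_axioms l_distr r_distr m_assoc)

locale noeth_local = noeth_cring R for R (structure) +
  fixes \<mm> :: "'a set"
  assumes maximal: "maximalideal \<mm> R"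
    and nonunit: "\<lbrakk>a \<in> carrier R; a \<notin> \<mm>\<rbrakk> \<Longrightarrow> a \<in> Units R"
begin

lemma m_ideal: "ideal \<mm> R" using maximal maximalideal.axioms(1) by blast
lemma m_carrier: "a \<in> \<mm> \<Longrightarrow> a \<in> carrier R" using m_ideal ideal_carrier by blast
lemma one_notin_m: "\<one> \<notin> \<mm>"
  using maximalideal.I_notcarr[OF maximal] ideal.one_imp_carrier[OF m_ideal] by blast

lemma m_eqI: "\<lbrakk>ideal K R; \<mm> \<subseteq> K; \<one> \<notin> K\<rbrakk> \<Longrightarrow> K = \<mm>"
  using maximalideal.I_maximal[OF maximal, of K] ideal_carrier by blast

sublocale L: local_module R "mult_module R (carrier R)" \<mm>
  by (rule local_module.intro[OF module_mult_module])
    (use m_carrier nonunit in \<open>unfold_locales; blast\<close>)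

lemma sub_iff_ideal: "L.sub K \<longleftrightarrow> ideal K R"
proof
  assume K: "L.sub K"
  show "ideal K R"
    by (rule ideal_commI)
      (use L.sub_carrier[OF K] L.sub_zero[OF K] L.sub_add[OF K] L.sub_smult[OF K] in auto)
next
  assume K: "ideal K R"
  show "L.sub K"
    by (rule L.subI)
      (use ideal_carrier[OF K] ideal_zero[OF K] ideal_add[OF K] ideal_mult[OF K] in auto)
qed

text \<open>The generators of \<open>\<mm>\<close> are treated one after another: if the earlier
  ones carry \<open>y\<close> into \<open>L\<close>, replace \<open>y\<close> by
  \<open>a^d y\<close> with the last power that still lies outside \<open>L\<close>. The earlier
  generators keep carrying it into \<open>L\<close>, and now so does \<open>a\<close>.\<close>

lemma socle_element:
  assumes L: "ideal L R" and K: "ideal K R" and y0: "y0 \<in> K" "y0 \<notin> L"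
    and nil: "\<And>a. a \<in> \<mm> \<Longrightarrow> \<exists>c::nat. \<forall>x\<in>K. a [^] c \<otimes> x \<in> L"
  shows "\<exists>y\<in>K. y \<notin> L \<and> (\<forall>a\<in>\<mm>. a \<otimes> y \<in> L)"
proof -
  obtain S where S: "S \<subseteq> carrier R" "finite S" "\<mm> = Idl S" using finetely_gen[OF m_ideal] by blast
  have Sm: "S \<subseteq> \<mm>" using S genideal_self by blast
  have "\<exists>y\<in>K. y \<notin> L \<and> (\<forall>a\<in>S. a \<otimes> y \<in> L)"
    using S(2) Sm
  proof (induction S)
    case empty
    then show ?case using y0 by blast
  next
    case (insert a S)
    then obtain y where y: "y \<in> K" "y \<notin> L" "\<forall>a\<in>S. a \<otimes> y \<in> L" by blast
    have a: "a \<in> \<mm>" "a \<in> carrier R" and yR: "y \<in> carrier R"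
      using insert m_carrier y ideal_carrier[OF K] by auto
    define c where "c = (LEAST c::nat. a [^] c \<otimes> y \<in> L)"
    have "\<exists>c::nat. a [^] c \<otimes> y \<in> L" using nil[OF a(1)] y by blast
    then have c: "a [^] c \<otimes> y \<in> L" unfolding c_def by (rule LeastI_ex)
    have "c \<noteq> 0" using c y yR by (cases c) auto
    then obtain d where d: "c = Suc d" by (cases c) auto
    have nd: "a [^] d \<otimes> y \<notin> L" using not_less_Least[of d "\<lambda>c. a [^] c \<otimes> y \<in> L"] d c_def by simp
    show ?case
    proof (intro bexI conjI ballI)
      show "a [^] d \<otimes> y \<in> K" using ideal_mult[OF K] a y by simp
      show "a [^] d \<otimes> y \<notin> L" by (rule nd)
      fix b assume b: "b \<in> insert a S"
      then have bR: "b \<in> carrier R" using insert m_carrier by auto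
      show "b \<otimes> (a [^] d \<otimes> y) \<in> L"
      proof (cases "b = a")
        case True
        then show ?thesis using c d a yR by (simp add: m_ac)
      next
        case False
        then have "a [^] d \<otimes> (b \<otimes> y) \<in> L" using y b ideal_mult[OF L] a by simp
        then show ?thesis using a yR bR by (simp add: m_ac)
      qed
    qed
  qed
  then obtain y where y: "y \<in> K" "y \<notin> L" "\<forall>a\<in>S. a \<otimes> y \<in> L" by blast
  have yR: "y \<in> carrier R" using y ideal_carrier[OF K] by blast
  have "ideal {a \<in> carrier R. y \<otimes> a \<in> L} R"
    by (rule ideal.helper_max_prime[OF L cring_axioms yR])
  moreover have "S \<subseteq> {a \<in> carrier R. y \<otimes> a \<in> L}" using y(3) S(1) yR m_comm by auto
  ultimately have "\<mm> \<subseteq> {a \<in> carrier R. y \<otimes> a \<in> L}" unfolding S(3) by (rule genideal_minimal)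
  then have "\<forall>a\<in>\<mm>. a \<otimes> y \<in> L" using yR m_comm by auto
  then show ?thesis using y by blast
qed

text \<open>As long as \<open>X\<close> has not reached \<open>K\<close>, a socle element of
  \<open>K / X\<close> adjoins another simple factor. If no composition series existed, this would
  never stop, contradicting the chain condition in \<open>R\<close>.\<close>

lemma has_len_exists:
  assumes L: "ideal L R" and K: "ideal K R" and LK: "L \<subseteq> K"
    and nil: "\<And>a. a \<in> \<mm> \<Longrightarrow> \<exists>c::nat. \<forall>x\<in>K. a [^] c \<otimes> x \<in> L"
  shows "\<exists>k. L.has_len L K k"
proof (rule ccontr)
  assume neg: "\<not> ?thesis"
  let ?P = "\<lambda>X. ideal X R \<and> L \<subseteq> X \<and> X \<subseteq> K \<and> \<not> (\<exists>k. L.has_len X K k)"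
  have grow: "\<exists>Y. ?P Y \<and> X \<subset> Y" if X: "?P X" for X
  proof -
    have "X \<noteq> K" using X L.has_len.refl[of K] K by (auto simp: sub_iff_ideal)
    then obtain y0 where "y0 \<in> K" "y0 \<notin> X" using X by blast
    moreover have "\<exists>c::nat. \<forall>x\<in>K. a [^] c \<otimes> x \<in> X" if "a \<in> \<mm>" for a
      using nil[OF that] X by blast
    ultimately obtain y where y: "y \<in> K" "y \<notin> X" "\<forall>a\<in>\<mm>. a \<otimes> y \<in> X"
      using socle_element[of X K y0] X K by blast
    have yR: "y \<in> carrier R" using y ideal_carrier[OF K] by blast
    have sX: "L.sub X" and sK: "L.sub K" using X K by (simp_all add: sub_iff_ideal)
    let ?Y = "L.cyc_ext X y"
    have 1: "L.has_len X ?Y (Suc 0)"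
      by (rule L.has_len.step[OF L.has_len.refl[OF sX]]) (use y yR in auto)
    have 2: "X \<subseteq> ?Y" "y \<in> ?Y" "L.sub ?Y"
      using L.cyc_ext_superset[OF sX] L.cyc_ext_mem[OF sX] L.sub_cyc_ext[OF sX] yR by auto
    have 3: "?Y \<subseteq> K" by (rule L.cyc_ext_least[OF sK]) (use X y in auto)
    have "\<not> (\<exists>k. L.has_len ?Y K k)" using L.has_len_trans[OF _ 1] X by blast
    then show ?thesis using 2 3 X y by (intro exI[of _ ?Y]) (auto simp: sub_iff_ideal)
  qed
  have start: "?P L" using L LK neg by simp
  have "\<exists>f. \<forall>k. ?P (f k) \<and> f k \<subset> f (Suc k)"
  proof (rule dependent_nat_choice)
    show "\<exists>X. ?P X" using start by (rule exI)
    show "\<exists>Y. ?P Y \<and> X \<subset> Y" if "?P X" for X and n :: nat using that by (rule grow)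
  qed
  then obtain f where f: "\<And>k. ?P (f k) \<and> f k \<subset> f (Suc k)" by blast
  have "\<exists>n. \<forall>k\<ge>n. f k = f n"
  proof (rule ideal_chain_stable)
    show "ideal (f k) R" for k using f[of k] by simp
    show "f k \<subseteq> f (Suc k)" for k using f[of k] by (simp add: psubset_imp_subset)
  qed
  then obtain n where "\<forall>k\<ge>n. f k = f n" by (rule exE)
  from this[rule_format, of "Suc n"] have "f (Suc n) = f n" by simp
  then show False using f[of n] by simp
qed

text \<open>A natural number, meaningful only where a composition series exists; it is unique by
  \<open>has_len_unique\<close>.\<close>

definition len :: "'a set \<Rightarrow> 'a set \<Rightarrow> nat" where
  "len L K = (THE k. L.has_len L K k)"

lemma len_eq: "L.has_len L K k \<Longrightarrow> len L K = k"
  unfolding len_def using L.has_len_unique by blast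

lemma len_self: "ideal K R \<Longrightarrow> len K K = 0"
  by (rule len_eq) (simp add: L.has_len.refl sub_iff_ideal)

lemma len_add:
  assumes "L.has_len A B i" "L.has_len B C j"
  shows "len A C = len A B + len B C"
  using len_eq[OF L.has_len_trans[OF assms(2,1)]] len_eq[OF assms(1)] len_eq[OF assms(2)] by simp

text \<open>The exponent may depend on \<open>a\<close> but not on the degree \<open>n\<close>. This
  uniformity places a power of \<open>a\<close> in the degree 0 part of the annihilator of
  \<open>N / N'\<close>.\<close>

definition nilp :: "(nat \<Rightarrow> 'a set) \<Rightarrow> (nat \<Rightarrow> 'a set) \<Rightarrow> bool" where
  "nilp N' N \<longleftrightarrow> (\<forall>a\<in>\<mm>. \<exists>c::nat. \<forall>n. \<forall>x\<in>N n. a [^] c \<otimes> x \<in> N' n)"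

lemma nilp_mono: "\<lbrakk>nilp N' N; N' \<le> N''\<rbrakk> \<Longrightarrow> nilp N'' N"
  unfolding nilp_def le_fun_def by blast

lemma nilp_has_len:
  assumes "gsub S N'" "gsub S N" "N' \<le> N" "nilp N' N"
  shows "L.has_len (N' n) (N n) (len (N' n) (N n))"
proof -
  have "\<exists>k. L.has_len (N' n) (N n) k"
  proof (rule has_len_exists)
    show "\<exists>c::nat. \<forall>x\<in>N n. a [^] c \<otimes> x \<in> N' n" if "a \<in> \<mm>" for a
      using assms(4) that unfolding nilp_def by blast
    show "N' n \<subseteq> N n" using assms(3) by (rule le_funD)
  qed (use assms gsub_ideal in simp_all)
  then show ?thesis using len_eq by auto
qed

end

locale noeth_local_ideal = noeth_local R \<mm> for R (structure) and \<mm> +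
  fixes J :: "'a set"
  assumes J: "ideal J R"
begin

abbreviation Jp :: "nat \<Rightarrow> 'a set" where "Jp \<equiv> ideal_pow R J"

lemma Jp_ideal: "ideal (Jp n) R" using pow_ideal[OF J] .
lemma Jp_gsub: "gsub J Jp" using gsub_pow[OF J] .
lemma Jp_nt: "noeth_seq J Jp" using noeth_seq_pow[OF J] .
lemma J_carrier: "J \<subseteq> carrier R" using J ideal_carrier by blast
lemma Jp_carrier: "a \<in> Jp n \<Longrightarrow> a \<in> carrier R" using ideal_carrier[OF Jp_ideal] .

text \<open>The homogeneous primes of the Rees algebra of \<open>J\<close> that contain \<open>\<mm>\<close>.\<close>

definition hprime :: "(nat \<Rightarrow> 'a set) \<Rightarrow> bool" where
  "hprime P \<longleftrightarrow> gsub J P \<and> P \<le> Jp \<and> P 0 = \<mm> \<and>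
     (\<forall>i j a b. a \<in> Jp i \<longrightarrow> b \<in> Jp j \<longrightarrow> a \<otimes> b \<in> P (i + j) \<longrightarrow> a \<in> P i \<or> b \<in> P j)"

lemma hprime_gsub: "hprime P \<Longrightarrow> gsub J P" by (simp add: hprime_def)
lemma hprime_le: "hprime P \<Longrightarrow> P \<le> Jp" by (simp add: hprime_def)
lemma hprime_0: "hprime P \<Longrightarrow> P 0 = \<mm>" by (simp add: hprime_def)
lemma hprimeD: "\<lbrakk>hprime P; a \<in> Jp i; b \<in> Jp j; a \<otimes> b \<in> P (i + j)\<rbrakk> \<Longrightarrow> a \<in> P i \<or> b \<in> P j"
  unfolding hprime_def by blast

text \<open>As \<open>P 0 = \<mm>\<close>, multiplication by \<open>a\<close> in
  \<open>\<mm>\<close> maps \<R>(J) into \<open>P\<close>, so the exponent 1 serves.\<close>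

lemma hprime_nilp:
  assumes "hprime P" "P \<le> N" shows "nilp N Jp"
  unfolding nilp_def
proof
  fix a assume a: "a \<in> \<mm>"
  have "a [^] (1::nat) \<otimes> x \<in> N n" if x: "x \<in> Jp n" for n x
  proof -
    have "x \<otimes> a \<in> P (n + 0)"
      by (rule pow_mult_gsub[OF J hprime_gsub[OF assms(1)] x]) (use assms a hprime_0 in auto)
    then show ?thesis using a x m_comm m_carrier Jp_carrier assms(2) by (auto simp: le_fun_def)
  qed
  then show "\<exists>c::nat. \<forall>n. \<forall>x\<in>Jp n. a [^] c \<otimes> x \<in> N n" by blast
qed

definition ann :: "(nat \<Rightarrow> 'a set) \<Rightarrow> (nat \<Rightarrow> 'a set) \<Rightarrow> nat \<Rightarrow> 'a set" where
  "ann N' N n = {a \<in> Jp n. \<forall>s. \<forall>x\<in>N s. a \<otimes> x \<in> N' (n + s)}"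

text \<open>The annihilator in \<R>(J) of the class of the single homogeneous element
  \<open>x t^s\<close> modulo \<open>N'\<close>.\<close>

definition annx :: "(nat \<Rightarrow> 'a set) \<Rightarrow> nat \<Rightarrow> 'a \<Rightarrow> nat \<Rightarrow> 'a set" where
  "annx N' s x n = {a \<in> Jp n. a \<otimes> x \<in> N' (n + s)}"

lemma gsub_annx:
  assumes N': "gsub J N'" and x: "x \<in> carrier R"
  shows "gsub J (annx N' s x)"
proof (rule gsubI)
  fix n
  show "ideal (annx N' s x n) R"
  proof (rule ideal_commI)
    show "annx N' s x n \<subseteq> carrier R" using Jp_carrier by (auto simp: annx_def)
    show "\<zero> \<in> annx N' s x n"
      using ideal_zero[OF Jp_ideal] ideal_zero[OF gsub_ideal[OF N']] x by (simp add: annx_def)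
    have c: "a \<in> annx N' s x n \<Longrightarrow> a \<in> carrier R" for a
      using Jp_carrier by (auto simp: annx_def)
    show "a \<oplus> b \<in> annx N' s x n" if ab: "a \<in> annx N' s x n" "b \<in> annx N' s x n" for a b
      using ab c[OF ab(1)] c[OF ab(2)] ideal_add[OF Jp_ideal] ideal_add[OF gsub_ideal[OF N']] x
      by (simp add: annx_def l_distr)
    show "a \<otimes> b \<in> annx N' s x n" if ab: "a \<in> carrier R" "b \<in> annx N' s x n" for a b
      using ab c[OF ab(2)] ideal_mult[OF Jp_ideal] ideal_mult[OF gsub_ideal[OF N']] x
      by (simp add: annx_def m_assoc)
  qed
next
  fix n g a assume g: "g \<in> J" "a \<in> annx N' s x n"
  then have a: "a \<in> Jp n" "a \<otimes> x \<in> N' (n + s)" by (simp_all add: annx_def)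
  have "g \<otimes> a \<in> Jp (Suc n)" using gsub_mult[OF Jp_gsub g(1) a(1)] .
  moreover have "g \<otimes> (a \<otimes> x) \<in> N' (Suc (n + s))" using gsub_mult[OF N' g(1) a(2)] .
  ultimately show "g \<otimes> a \<in> annx N' s x (Suc n)"
    using g(1) J_carrier Jp_carrier[OF a(1)] x by (auto simp: annx_def m_assoc)
qed

lemma annx_le: "annx N' s x \<le> Jp" by (auto simp: annx_def le_fun_def)

lemma ann_le_annx: "x \<in> N s \<Longrightarrow> ann N' N \<le> annx N' s x"
  by (auto simp: ann_def annx_def le_fun_def)

lemma gsub_ann:
  assumes N': "gsub J N'" and N: "gsub J N"
  shows "gsub J (ann N' N)"
proof -
  let ?S = "{(s, x). x \<in> N s}"
  have ne: "(0, \<zero>) \<in> ?S" using ideal_zero[OF gsub_ideal[OF N]] by simp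
  have g: "gsub J (annx N' (fst p) (snd p))" if "p \<in> ?S" for p
    using gsub_annx[OF N'] ideal_carrier[OF gsub_ideal[OF N]] that by auto
  have eq: "ann N' N n = (\<Inter>p\<in>?S. annx N' (fst p) (snd p) n)" for n
    using ne by (auto simp: ann_def annx_def)
  show ?thesis
  proof (rule gsubI)
    show "ideal (ann N' N n) R" for n
      unfolding eq by (rule i_Intersect) (use gsub_ideal[OF g] ne in auto)
    show "h \<otimes> a \<in> ann N' N (Suc n)" if h: "h \<in> J" and a: "a \<in> ann N' N n" for n h a
      unfolding eq
    proof (rule INT_I)
      fix p assume p: "p \<in> ?S"
      have "a \<in> annx N' (fst p) (snd p) n" using a p unfolding eq by (rule INT_D)
      then show "h \<otimes> a \<in> annx N' (fst p) (snd p) (Suc n)" by (rule gsub_mult[OF g[OF p] h])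
    qed
  qed
qed

text \<open>A maximal annihilator of a homogeneous element is prime.\<close>

lemma associated_hprime:
  assumes N': "gsub J N'" and N: "gsub J N" and le: "N' \<le> N" and ne: "N' \<noteq> N" and nil: "nilp N' N"
  obtains s x where "x \<in> N s" "x \<notin> N' s" "hprime (annx N' s x)"
proof -
  let ?F = "\<lambda>A. \<exists>s x. x \<in> N s \<and> x \<notin> N' s \<and> A = annx N' s x"
  have car: "x \<in> N s \<Longrightarrow> x \<in> carrier R" for x s using ideal_carrier[OF gsub_ideal[OF N]] .
  obtain s0 where "N' s0 \<noteq> N s0" using ne by blast
  then obtain x0 where "x0 \<in> N s0" "x0 \<notin> N' s0" using le by (auto simp: le_fun_def)
  then have F0: "?F (annx N' s0 x0)" by blast
  have F: "gsub J A \<and> A \<le> Jp" if "?F A" for A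
    using that gsub_annx[OF N'] car annx_le by blast
  obtain A where "?F A" and A: "\<And>B. ?F B \<Longrightarrow> \<not> A < B"
    using noeth_seq_maximal[OF Jp_nt, of ?F, OF F F0] by blast
  then obtain s x where x: "x \<in> N s" "x \<notin> N' s" "A = annx N' s x" by blast
  have xR: "x \<in> carrier R" using car x by blast
  have prime: "a \<in> A i \<or> b \<in> A j" if ab: "a \<in> Jp i" "b \<in> Jp j" "a \<otimes> b \<in> A (i + j)" for i j a b
  proof (rule ccontr)
    assume neg: "\<not> ?thesis"
    have abR: "a \<in> carrier R" "b \<in> carrier R" using ab Jp_carrier by auto
    have bx: "b \<otimes> x \<in> N (j + s)" by (rule pow_mult_gsub[OF J N ab(2) x(1)])
    have bx': "b \<otimes> x \<notin> N' (j + s)" using neg ab x by (auto simp: annx_def)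
    \<comment> \<open>The class of \<open>b x\<close> is nonzero and its annihilator contains that
      of \<open>x\<close>; maximality makes them equal, and \<open>a\<close>, which kills
      \<open>b x\<close>, must then kill \<open>x\<close>.\<close>
    have "annx N' s x \<le> annx N' (j + s) (b \<otimes> x)"
      unfolding le_fun_def
    proof (intro allI subsetI)
      fix n c assume "c \<in> annx N' s x n"
      then have c: "c \<in> Jp n" "c \<otimes> x \<in> N' (n + s)" by (auto simp: annx_def)
      have "b \<otimes> (c \<otimes> x) \<in> N' (j + (n + s))" by (rule pow_mult_gsub[OF J N' ab(2) c(2)])
      then show "c \<in> annx N' (j + s) (b \<otimes> x) n"
        using c xR abR Jp_carrier[OF c(1)] by (simp add: annx_def m_ac add_ac)
    qed
    moreover have "\<not> A < annx N' (j + s) (b \<otimes> x)" using A bx bx' by blast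
    ultimately have eq: "annx N' (j + s) (b \<otimes> x) = A" using x(3) by (simp add: less_le)
    have "a \<otimes> (b \<otimes> x) \<in> N' (i + (j + s))"
      using ab x xR abR by (simp add: annx_def m_assoc add.assoc)
    then have "a \<in> A i" using ab unfolding eq[symmetric] by (simp add: annx_def)
    then show False using neg by blast
  qed
  have one: "\<one> \<notin> A 0" using x xR by (simp add: annx_def)
  have IA: "ideal (A n) R" for n using gsub_ideal[OF gsub_annx[OF N' xR]] x by blast
  have "\<mm> \<subseteq> A 0"
  proof
    fix a assume a: "a \<in> \<mm>"
    then obtain c :: nat where c: "a [^] c \<otimes> x \<in> N' s" using nil x unfolding nilp_def by blast
    have aR: "a \<in> carrier R" using a m_carrier by blast
    \<comment> \<open>Nilpotence puts a power of \<open>a\<close> into \<open>A 0\<close>, and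
      primeness then gives \<open>a\<close> itself, so that \<open>A 0\<close> is exactly
      \<open>\<mm>\<close>.\<close>
    have "a [^] c \<in> A 0 \<Longrightarrow> a \<in> A 0" for c :: nat
    proof (induction c)
      case 0 then show ?case using one by simp
    next
      case (Suc c)
      then show ?case using prime[of "a [^] c" 0 a 0] aR by (auto simp: pow_0)
    qed
    moreover have "a [^] c \<in> A 0" using c aR x by (simp add: annx_def pow_0)
    ultimately show "a \<in> A 0" by blast
  qed
  then have "A 0 = \<mm>" using m_eqI[OF IA] one by blast
  then have "hprime A"
    unfolding hprime_def using prime gsub_annx[OF N' xR] x annx_le by blast
  then show ?thesis using that x by blast
qed

text \<open>Multiplication by \<open>x t^s\<close> induces an isomorphism from \<R>(J) modulo the
  annihilator onto \<open>(N' + \<R>(J) x t^s) / N'\<close>, raising degrees by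
  \<open>s\<close>.\<close>

lemma len_annx:
  assumes N': "gsub J N'" and x: "x \<in> carrier R" and P: "hprime (annx N' s x)"
  shows "L.has_len (N' (n + s)) (addshift N' x s Jp (n + s)) (len (annx N' s x n) (Jp n))"
proof -
  interpret LL: local_module_map R "mult_module R (carrier R)" "mult_module R (carrier R)" \<mm> ..
  have 1: "L.has_len (annx N' s x n) (Jp n) (len (annx N' s x n) (Jp n))"
    by (rule nilp_has_len[OF hprime_gsub[OF P] Jp_gsub hprime_le[OF P] hprime_nilp[OF P order_refl]])
  have "L.has_len (N' (n + s)) {z \<oplus>\<^bsub>mult_module R (carrier R)\<^esub> x \<otimes> a | z a. z \<in> N' (n + s) \<and> a \<in> Jp n} (len (annx N' s x n) (Jp n))"
  proof (rule LL.has_len_map[OF 1])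
    fix a assume a: "a \<in> Jp n"
    show "x \<otimes> a \<in> N' (n + s) \<longleftrightarrow> a \<in> annx N' s x n"
      using a x Jp_carrier by (simp add: annx_def m_comm)
  qed (use x Jp_carrier gsub_ideal[OF N'] in \<open>auto simp: r_distr m_ac sub_iff_ideal\<close>)
  then show ?thesis by (simp add: addshift_def)
qed

section \<open>Chains of homogeneous primes and Hilbert polynomials\<close>

primrec hchain :: "(nat \<Rightarrow> 'a set) \<Rightarrow> nat \<Rightarrow> bool" where
  "hchain T 0 \<longleftrightarrow> hprime T"
| "hchain T (Suc k) \<longleftrightarrow> hprime T \<and> (\<exists>T'. T < T' \<and> hchain T' k)"

abbreviation hfun :: "(nat \<Rightarrow> 'a set) \<Rightarrow> nat \<Rightarrow> nat" where
  "hfun P \<equiv> \<lambda>n. len (P n) (Jp n)"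

text \<open>Only the lower estimate of the dimension is asserted here: the chain has length degree
  plus 1, which is 0 when the Hilbert polynomial is 0.\<close>

definition good :: "(nat \<Rightarrow> 'a set) \<Rightarrow> rat poly \<Rightarrow> bool" where
  "good T Q \<longleftrightarrow> evpoly (hfun T) Q \<and> hchain T (nat (poly_deg Q + 1))"

text \<open>The two clauses on primes bound the dimension of \<open>N / N'\<close> from below and from above: a chain
  of primes above the annihilator that is long enough, and, below every prime containing the
  annihilator, one whose residue ring has a Hilbert polynomial of small degree.\<close>

definition hilbert_dim :: "(nat \<Rightarrow> 'a set) \<Rightarrow> (nat \<Rightarrow> 'a set) \<Rightarrow> rat poly \<Rightarrow> bool" where
  "hilbert_dim N' N Q \<longleftrightarrow> evpoly (\<lambda>n. len (N' n) (N n)) Q \<and>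
     (N' \<noteq> N \<longrightarrow>
       (\<exists>T. ann N' N \<le> T \<and> hchain T (nat (poly_deg Q + 1))) \<and>
       (\<forall>T. hprime T \<and> ann N' N \<le> T \<longrightarrow>
          (\<exists>P QP. hprime P \<and> P \<le> T \<and> evpoly (hfun P) QP \<and> poly_deg QP \<le> poly_deg Q)))"

text \<open>Prime filtration: a homogeneous \<open>x\<close> with prime annihilator \<open>P\<close> splits off a shifted copy of
  \<open>\<R>(J) / P\<close>, and Noetherian induction applies to \<open>N' + \<R>(J) x\<close>.\<close>

lemma devissage:
  assumes N: "gsub J N" and ntN: "noeth_seq J N"
    and N': "gsub J N'" "N' \<le> N" "nilp N' N"
    and good: "\<And>T. hprime T \<Longrightarrow> ann N' N \<le> T \<Longrightarrow> \<exists>Q. good T Q"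
  shows "\<exists>Q. hilbert_dim N' N Q"
proof -
  \<comment> \<open>Both hypotheses are carried inside the induction, since they pass from
    \<open>N'\<close> to larger submodules: the quotient gets smaller and its annihilator
    larger.\<close>
  have "nilp N' N \<longrightarrow> (\<forall>T. hprime T \<longrightarrow> ann N' N \<le> T \<longrightarrow> (\<exists>Q. good T Q)) \<longrightarrow> (\<exists>Q. hilbert_dim N' N Q)"
    using ntN _ N'(1,2)
  proof (rule noeth_seq_induct; intro impI)
    fix N' assume N': "gsub J N'" "N' \<le> N" and nil: "nilp N' N"
      and IH: "\<And>N''. \<lbrakk>gsub J N''; N'' \<le> N; N' < N''\<rbrakk> \<Longrightarrow>
        nilp N'' N \<longrightarrow> (\<forall>T. hprime T \<longrightarrow> ann N'' N \<le> T \<longrightarrow> (\<exists>Q. good T Q)) \<longrightarrow> (\<exists>Q. hilbert_dim N'' N Q)"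
      and gd: "\<forall>T. hprime T \<longrightarrow> ann N' N \<le> T \<longrightarrow> (\<exists>Q. good T Q)"
    show "\<exists>Q. hilbert_dim N' N Q"
    proof (cases "N' = N")
      case True
      have "hilbert_dim N' N 0" unfolding hilbert_dim_def
        using True len_self gsub_ideal[OF N] by (auto intro!: evpolyI)
      then show ?thesis by blast
    next
      case False
      obtain s x where x: "x \<in> N s" "x \<notin> N' s" and P: "hprime (annx N' s x)"
        using associated_hprime[OF N'(1) N N'(2) False nil] by blast
      have xR: "x \<in> carrier R" using x ideal_carrier[OF gsub_ideal[OF N]] by blast
      let ?P = "annx N' s x"
      have annP: "ann N' N \<le> ?P" by (rule ann_le_annx) (rule x(1))
      obtain QP where QP: "good ?P QP" using gd P annP by blast
      define N2 where "N2 = addshift N' x s Jp"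
      note hyps = N'(1) Jp_gsub xR J_carrier
      have N2: "gsub J N2" unfolding N2_def by (rule gsub_addshift[OF hyps])
      have le1: "N' \<le> N2" unfolding N2_def le_fun_def using addshift_superset[OF hyps] by blast
      have "\<zero> \<oplus> x \<otimes> \<one> \<in> addshift N' x s Jp (0 + s)"
        by (rule addshiftI) (use ideal_zero[OF gsub_ideal[OF N'(1)]] in \<open>auto simp: pow_0\<close>)
      then have xN2: "x \<in> N2 s" using xR by (simp add: N2_def)
      have lt: "N' < N2" using le1 xN2 x(2) by (metis less_le)
      have le2: "N2 \<le> N"
        unfolding le_fun_def
      proof (intro allI subsetI)
        fix n y assume "y \<in> N2 n"
        then have "y \<in> addshift N' x s Jp n" by (simp add: N2_def)
        then show "y \<in> N n"
        proof (cases rule: addshiftE)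
          case 1 then show ?thesis using N'(2) by (auto simp: le_fun_def)
        next
          case (2 m v w)
          have "w \<otimes> x \<in> N (m + s)" by (rule pow_mult_gsub[OF J N]) (use 2 x in auto)
          then have "x \<otimes> w \<in> N n" using 2 xR Jp_carrier m_comm by simp
          moreover have "v \<in> N n" using 2 N'(2) by (auto simp: le_fun_def)
          ultimately show ?thesis using 2 ideal_add[OF gsub_ideal[OF N]] by simp
        qed
      qed
      have nil2: "nilp N2 N" using nilp_mono[OF nil le1] .
      have annle: "ann N' N \<le> ann N2 N" using le1 unfolding ann_def le_fun_def by blast
      obtain Q2 where Q2: "hilbert_dim N2 N Q2" using IH[OF N2 le2 lt] nil2 gd annle order_trans by blast
      have hl2: "L.has_len (N2 n) (N n) (len (N2 n) (N n))" for n
        by (rule nilp_has_len[OF N2 N le2 nil2])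
      have "nilp N' N2" using nil le2 unfolding nilp_def le_fun_def by blast
      then have hl1: "L.has_len (N' n) (N2 n) (len (N' n) (N2 n))" for n
        by (rule nilp_has_len[OF N'(1) N2 le1])
      have sum: "len (N' n) (N n) = len (N' n) (N2 n) + len (N2 n) (N n)" for n
        by (rule len_add[OF hl1 hl2])
      \<comment> \<open>The split-off copy of \<R>(J) / P starts in degree \<open>s\<close>;
        translating its polynomial by \<open>s\<close> does not change the degree.\<close>
      have "len (N' (n + s)) (N2 (n + s)) = hfun ?P n" for n
        unfolding N2_def by (rule len_eq[OF len_annx[OF N'(1) xR P]])
      then obtain Q1 where Q1: "evpoly (\<lambda>n. len (N' n) (N2 n)) Q1" "poly_deg Q1 = poly_deg QP"
        using evpoly_shift[of "hfun ?P" QP "\<lambda>n. len (N' n) (N2 n)" s] QP unfolding good_def by blast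
      have Q2e: "evpoly (\<lambda>n. len (N2 n) (N n)) Q2" using Q2 unfolding hilbert_dim_def by blast
      define Q where "Q = Q1 + Q2"
      have Qe: "evpoly (\<lambda>n. len (N' n) (N n)) Q"
        unfolding sum Q_def by (rule evpoly_add[OF Q1(1) Q2e])
      have degQ: "poly_deg Q = max (poly_deg QP) (poly_deg Q2)"
        unfolding Q_def Q1(2)[symmetric]
        by (rule poly_deg_add[OF evpoly_lead_coeff_nonneg[OF Q1(1)] evpoly_lead_coeff_nonneg[OF Q2e]])
      have "\<exists>T. ann N' N \<le> T \<and> hchain T (nat (poly_deg Q + 1))"
      proof (cases "poly_deg Q2 \<le> poly_deg QP")
        case True
        then show ?thesis using QP annP degQ unfolding good_def by auto
      next
        case deg: False
        \<comment> \<open>If \<open>N2 = N\<close>, then \<open>Q2 = 0\<close> would have degree -1,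
          which no polynomial undercuts.\<close>
        have "N2 \<noteq> N"
        proof
          assume "N2 = N"
          then have "len (N2 n) (N n) = 0" for n using len_self gsub_ideal[OF N] by simp
          then have "Q2 = 0" using evpoly_zero[OF Q2e] by blast
          then show False using deg by (auto simp: poly_deg_def split: if_splits)
        qed
        then obtain T where "ann N2 N \<le> T" "hchain T (nat (poly_deg Q2 + 1))"
          using Q2 unfolding hilbert_dim_def by blast
        then show ?thesis using annle degQ deg by (intro exI[of _ T]) (auto simp: max_def)
      qed
      moreover have "\<exists>P QP. hprime P \<and> P \<le> T \<and> evpoly (hfun P) QP \<and> poly_deg QP \<le> poly_deg Q"
        if T: "hprime T" "ann N' N \<le> T" for T
      proof (cases "?P \<le> T")
        case True
        then show ?thesis using P QP degQ unfolding good_def by (metis max.cobounded1)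
      next
        case False
        then obtain n p where p: "p \<in> ?P n" "p \<notin> T n" unfolding le_fun_def by blast
        have pJ: "p \<in> Jp n" "p \<otimes> x \<in> N' (n + s)" using p by (auto simp: annx_def)
        have pR: "p \<in> carrier R" using pJ Jp_carrier by blast
        have "ann N2 N \<le> T"
          unfolding le_fun_def
        proof (intro allI subsetI)
          fix i a assume a: "a \<in> ann N2 N i"
          then have aJ: "a \<in> Jp i" by (simp add: ann_def)
          have aR: "a \<in> carrier R" using aJ Jp_carrier by blast
          have "p \<otimes> a \<in> ann N' N (n + i)"
            unfolding ann_def
          proof (intro CollectI conjI allI ballI)
            show "p \<otimes> a \<in> Jp (n + i)" by (rule pow_mult[OF J pJ(1) aJ])
            fix t z assume z: "z \<in> N t"
            have zR: "z \<in> carrier R" using z ideal_carrier[OF gsub_ideal[OF N]] by blast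
            have "a \<otimes> z \<in> N2 (i + t)" using a z by (simp add: ann_def)
            then have "a \<otimes> z \<in> addshift N' x s Jp (i + t)" by (simp add: N2_def)
            then have "p \<otimes> (a \<otimes> z) \<in> N' (n + (i + t))"
            proof (cases rule: addshiftE)
              case 1 then show ?thesis using pow_mult_gsub[OF J N'(1) pJ(1)] by blast
            next
              case (2 m v w)
              have vw: "v \<in> carrier R" "w \<in> carrier R"
                using 2 ideal_carrier[OF gsub_ideal[OF N'(1)]] Jp_carrier by auto
              have "w \<otimes> (p \<otimes> x) \<in> N' (m + (n + s))" by (rule pow_mult_gsub[OF J N'(1) 2(3) pJ(2)])
              moreover have "m + (n + s) = n + (i + t)" using 2(1) by simp
              ultimately have "w \<otimes> (p \<otimes> x) \<in> N' (n + (i + t))" by simp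
              moreover have "p \<otimes> v \<in> N' (n + (i + t))" by (rule pow_mult_gsub[OF J N'(1) pJ(1) 2(2)])
              moreover have "p \<otimes> (a \<otimes> z) = p \<otimes> v \<oplus> w \<otimes> (p \<otimes> x)"
                using 2(4) vw pR xR by (simp add: r_distr m_ac)
              ultimately show ?thesis using ideal_add[OF gsub_ideal[OF N'(1)]] by simp
            qed
            then show "p \<otimes> a \<otimes> z \<in> N' (n + i + t)" using pR aR zR by (simp add: m_assoc add.assoc)
          qed
          then have "p \<otimes> a \<in> T (n + i)" using T by (auto simp: le_fun_def)
          then show "a \<in> T i" using hprimeD[OF T(1) pJ(1) aJ] p(2) by blast
        qed
        moreover have "N2 \<noteq> N"
        proof
          assume "N2 = N"
          then have "\<one> \<in> ann N2 N 0"
            using ideal_carrier[OF gsub_ideal[OF N]] by (auto simp: ann_def pow_0)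
          then have "\<one> \<in> T 0" using calculation by (auto simp: le_fun_def)
          then show False using hprime_0[OF T(1)] one_notin_m by simp
        qed
        ultimately obtain P' QP' where "hprime P'" "P' \<le> T" "evpoly (hfun P') QP'" "poly_deg QP' \<le> poly_deg Q2"
          using Q2 T unfolding hilbert_dim_def by blast
        then show ?thesis using degQ by (intro exI[of _ P'] exI[of _ QP']) auto
      qed
      ultimately have "hilbert_dim N' N Q" unfolding hilbert_dim_def using Qe by blast
      then show ?thesis by blast
    qed
  qed
  then show ?thesis using N' good by blast
qed

lemma hchain_hprime: "hchain T k \<Longrightarrow> hprime T"
  by (cases k) auto

text \<open>The powers of a degree 1 form outside \<open>P\<close> show that \<R>(J) / P is nonzero
  in every degree, which keeps its Hilbert polynomial from being 0.\<close>

lemma hprime_power: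
  assumes P: "hprime P" and f: "f \<in> J" "f \<notin> P (Suc 0)"
  shows "f [^] (n::nat) \<in> Jp n \<and> f [^] n \<notin> P n"
proof (induction n)
  case 0
  then show ?case using hprime_0[OF P] one_notin_m by (simp add: pow_0)
next
  case (Suc n)
  have f1: "f \<in> Jp (Suc 0)" using f pow_1[OF J] by simp
  have "f [^] n \<otimes> f \<in> Jp (n + Suc 0)" by (rule pow_mult[OF J]) (use Suc f1 in auto)
  moreover have "f [^] n \<otimes> f \<notin> P (n + Suc 0)" using hprimeD[OF P _ f1] Suc f(2) by blast
  ultimately show ?case by simp
qed

text \<open>Noetherian induction on \<open>P\<close>: for \<open>f \<in> J - P\<^sub>1\<close> the Hilbert function of \<open>\<R>(J) / P\<close> is the sum
  function of that of \<open>\<R>(J) / (P + f t \<R>(J))\<close>, which only involves strictly larger primes.\<close>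

lemma all_hprimes_good:
  assumes "hprime P" shows "\<exists>Q. good P Q"
proof -
  have "hprime P \<longrightarrow> (\<exists>Q. good P Q)"
    using Jp_nt _ hprime_gsub[OF assms] hprime_le[OF assms]
  proof (rule noeth_seq_induct; intro impI)
    fix P assume P: "hprime P" and IH: "\<And>T. \<lbrakk>gsub J T; T \<le> Jp; P < T\<rbrakk> \<Longrightarrow> hprime T \<longrightarrow> (\<exists>Q. good T Q)"
    have Pg: "gsub J P" and Ple: "P \<le> Jp" using hprime_gsub[OF P] hprime_le[OF P] by auto
    have nilP: "nilp P Jp" using hprime_nilp[OF P order_refl] .
    show "\<exists>Q. good P Q"
    proof (cases "J \<subseteq> P (Suc 0)")
      case True
      \<comment> \<open>Here \<open>P\<close> is the maximal homogeneous ideal: the residue ring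
        sits in degree 0, its Hilbert polynomial is 0, and the chain of length 0 suffices.\<close>
      have "P n = Jp n" if n: "n \<ge> 1" for n
      proof
        show "P n \<subseteq> Jp n" using Ple by (auto simp: le_fun_def)
        obtain m where m: "n = Suc m" using n by (cases n) auto
        show "Jp n \<subseteq> P n" unfolding m pow_Suc
        proof (rule ideal_prod_least[OF gsub_ideal[OF Pg]])
          fix a b assume ab: "a \<in> Jp m" "b \<in> J"
          then show "a \<otimes> b \<in> P (Suc m)" using pow_mult_gsub[OF J Pg ab(1), of b "Suc 0"] True by auto
        qed
      qed
      then have "hfun P n = 0" if "n \<ge> 1" for n using len_self[OF Jp_ideal] that by simp
      then have "evpoly (hfun P) 0" by (intro evpolyI[of 1]) simp
      then have "good P 0" using P by (simp add: good_def poly_deg_def)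
      then show ?thesis by blast
    next
      case False
      then obtain f where f: "f \<in> J" "f \<notin> P (Suc 0)" by blast
      have fR: "f \<in> carrier R" using f J_carrier by blast
      have f1: "f \<in> Jp (Suc 0)" using f pow_1[OF J] by simp
      \<comment> \<open>\<open>f t\<close> is a nonzerodivisor modulo \<open>P\<close>, so the
        submodule it generates is a copy of \<R>(J) / P shifted by one degree.\<close>
      have "annx P (Suc 0) f n = P n" for n
      proof
        show "annx P (Suc 0) f n \<subseteq> P n" using hprimeD[OF P _ f1] f(2) by (auto simp: annx_def)
        show "P n \<subseteq> annx P (Suc 0) f n"
        proof
          fix a assume a: "a \<in> P n"
          then have "a \<in> Jp n" using Ple by (auto simp: le_fun_def)
          moreover have "f \<otimes> a \<in> P (Suc n)" using gsub_mult[OF Pg f(1) a] .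
          ultimately show "a \<in> annx P (Suc 0) f n" using fR Jp_carrier by (simp add: annx_def m_comm)
        qed
      qed
      then have Pf: "annx P (Suc 0) f = P" by blast
      define N' where "N' = addshift P f (Suc 0) Jp"
      note hyps = Pg Jp_gsub fR J_carrier
      have N': "gsub J N'" unfolding N'_def by (rule gsub_addshift[OF hyps])
      have le1: "P \<le> N'" unfolding N'_def le_fun_def using addshift_superset[OF hyps] by blast
      have "\<zero> \<oplus> f \<otimes> \<one> \<in> addshift P f (Suc 0) Jp (0 + Suc 0)"
        by (rule addshiftI) (use ideal_zero[OF gsub_ideal[OF Pg]] in \<open>auto simp: pow_0\<close>)
      then have fN': "f \<in> N' (Suc 0)" using fR by (simp add: N'_def)
      have le2: "N' \<le> Jp"
        unfolding le_fun_def
      proof (intro allI subsetI)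
        fix n y assume "y \<in> N' n"
        then have "y \<in> addshift P f (Suc 0) Jp n" by (simp add: N'_def)
        then show "y \<in> Jp n"
        proof (cases rule: addshiftE)
          case 1 then show ?thesis using le_funD[OF Ple, of n] by blast
        next
          case (2 m v w)
          have "f \<otimes> w \<in> Jp n" using gsub_mult[OF Jp_gsub f(1) 2(3)] 2(1) by simp
          moreover have "v \<in> Jp n" using 2(2) le_funD[OF Ple, of n] by blast
          ultimately show ?thesis unfolding 2(4) by (intro ideal_add[OF Jp_ideal])
        qed
      qed
      have nil': "nilp N' Jp" using hprime_nilp[OF P le1] .
      have N'0: "N' 0 = \<mm>" using hprime_0[OF P] by (simp add: N'_def addshift_def)
      have ne: "N' \<noteq> Jp" using N'0 one_notin_m pow_0[of J] by (metis one_closed)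
      \<comment> \<open>\<open>N'\<close> is an ideal and hence annihilates \<R>(J) / N'. Primes
        over this annihilator therefore contain \<open>P\<close> and \<open>f\<close>, are strictly
        larger than \<open>P\<close>, and fall under the induction hypothesis.\<close>
      have annN': "N' \<le> ann N' Jp"
        unfolding le_fun_def
      proof (intro allI subsetI)
        fix n a assume a: "a \<in> N' n"
        then have aJ: "a \<in> Jp n" using le2 by (auto simp: le_fun_def)
        have "a \<otimes> x \<in> N' (n + t)" if x: "x \<in> Jp t" for t x
          using pow_mult_gsub[OF J N' x a] x aJ Jp_carrier by (simp add: m_comm add.commute)
        then show "a \<in> ann N' Jp n" using aJ by (simp add: ann_def)
      qed
      have lt: "P < T" if "ann N' Jp \<le> T" for T
      proof -
        have "N' \<le> T" using annN' that by (rule order_trans)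
        then have "P \<le> T" "f \<in> T (Suc 0)" using le1 fN' by (auto simp: le_fun_def)
        then show ?thesis using f(2) by (metis less_le)
      qed
      have "\<exists>Q. hilbert_dim N' Jp Q"
      proof (rule devissage[OF Jp_gsub Jp_nt N' le2 nil'])
        fix T assume "hprime T" "ann N' Jp \<le> T"
        then show "\<exists>Q. good T Q" using IH[of T] lt hprime_gsub hprime_le by blast
      qed
      then obtain Q' where Q': "hilbert_dim N' Jp Q'" by blast
      then obtain T where T: "ann N' Jp \<le> T" "hchain T (nat (poly_deg Q' + 1))"
        using ne unfolding hilbert_dim_def by blast
      have chain: "hchain P (Suc (nat (poly_deg Q' + 1)))"
        using P lt T by auto
      have step: "hfun P (Suc n) = hfun P n + len (N' (Suc n)) (Jp (Suc n))" for n
      proof -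
        have "L.has_len (P (Suc n)) (N' (Suc n)) (hfun P n)"
          using len_annx[OF Pg fR, of "Suc 0" n] P unfolding N'_def Pf by simp
        then show ?thesis
          using len_add[OF _ nilp_has_len[OF N' Jp_gsub le2 nil']] len_eq by metis
      qed
      have "evpoly (\<lambda>n. len (N' n) (Jp n)) Q'" using Q' unfolding hilbert_dim_def by blast
      then obtain Q where Q: "evpoly (hfun P) Q" "Q' \<noteq> 0 \<Longrightarrow> poly_deg Q = poly_deg Q' + 1"
        "Q' = 0 \<Longrightarrow> Polynomial.degree Q = 0"
        using evpoly_sum[of "\<lambda>n. len (N' n) (Jp n)" Q' "hfun P"] step by blast
      \<comment> \<open>For \<open>Q' = 0\<close> summation only shows that \<open>Q\<close> is
        constant; that it has degree 0 and not -1 comes from the powers of \<open>f\<close> outside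
        \<open>P\<close>.\<close>
      have Q0: "Q \<noteq> 0"
      proof
        assume "Q = 0"
        obtain M where M: "\<And>n. n \<ge> M \<Longrightarrow> of_nat (hfun P n) = poly Q (of_nat n)"
          using evpolyD[OF Q(1)] by blast
        have "hfun P M = 0" using M[of M] \<open>Q = 0\<close> by simp
        then have "L.has_len (P M) (Jp M) 0"
          using nilp_has_len[OF Pg Jp_gsub Ple nilP, of M] by simp
        then have "P M = Jp M" by (rule L.has_len_0D)
        then show False using hprime_power[OF P f, of M] by blast
      qed
      have "nat (poly_deg Q + 1) = Suc (nat (poly_deg Q' + 1))"
      proof (cases "Q' = 0")
        case True
        then show ?thesis using Q(3) Q0 by (simp add: poly_deg_def)
      next
        case False
        then show ?thesis using Q(2) by (simp add: poly_deg_def)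
      qed
      then have "good P Q" unfolding good_def using Q(1) chain by simp
      then show ?thesis by blast
    qed
  qed
  then show ?thesis using assms by blast
qed

theorem devissage_pow:
  assumes "gsub J N" "noeth_seq J N" "gsub J N'" "N' \<le> N" "nilp N' N"
  shows "\<exists>Q. hilbert_dim N' N Q"
  using devissage[OF assms] all_hprimes_good by blast

end

section \<open>Chains of primes in the Rees algebra\<close>

text \<open>The recursion peels off the smallest prime \<open>q\<close>, as the inductions on the
  length require; \<open>l\<close> counts inclusions, not primes.\<close>

primrec pchain :: "('a, 'b) ring_scheme \<Rightarrow> 'a set \<Rightarrow> nat \<Rightarrow> bool" where
  "pchain A q 0 \<longleftrightarrow> primeideal q A"
| "pchain A q (Suc l) \<longleftrightarrow> primeideal q A \<and> (\<exists>q'. q \<subset> q' \<and> pchain A q' l)"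

lemma pchain_prime: "pchain A q l \<Longrightarrow> primeideal q A"
  by (cases l) auto

context cring
begin

lemma ideal_finsum:
  assumes "ideal K R" "finite S" "\<And>i. i \<in> S \<Longrightarrow> f i \<in> K"
  shows "finsum R f S \<in> K"
  using assms(2,3)
proof (induction S)
  case empty then show ?case using ideal_zero[OF assms(1)] by simp
next
  case (insert x S)
  then have "f \<in> S \<rightarrow> carrier R" "f x \<in> carrier R" using ideal_carrier[OF assms(1)] by auto
  then show ?case using insert ideal_add[OF assms(1)] by simp
qed

interpretation U: UP_cring R "UP R"
  by unfold_locales

text \<open>Elements of \<open>UP R\<close> are coefficient functions, so coefficients are read off
  by application throughout.\<close>

lemma UP_coeff: "p \<in> carrier (UP R) \<Longrightarrow> up_ring.coeff (UP R) p n = p n"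
  by (simp add: UP_def)

lemma UP_apply:
  assumes "p \<in> carrier (UP R)"
  shows UP_apply_closed: "p n \<in> carrier R"
    and UP_apply_add: "q \<in> carrier (UP R) \<Longrightarrow> (p \<oplus>\<^bsub>UP R\<^esub> q) n = p n \<oplus> q n"
    and UP_apply_mult: "q \<in> carrier (UP R) \<Longrightarrow> (p \<otimes>\<^bsub>UP R\<^esub> q) n = (\<Oplus>i\<in>{..n}. p i \<otimes> q (n - i))"
    and UP_apply_uminus: "(\<ominus>\<^bsub>UP R\<^esub> p) n = \<ominus> (p n)"
    and UP_apply_smult: "a \<in> carrier R \<Longrightarrow> (a \<odot>\<^bsub>UP R\<^esub> p) n = a \<otimes> p n"
proof -
  show "p n \<in> carrier R" using U.coeff_closed[OF assms, of n] UP_coeff[OF assms] by simp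
  show "(p \<oplus>\<^bsub>UP R\<^esub> q) n = p n \<oplus> q n" if "q \<in> carrier (UP R)"
    using U.coeff_add[OF assms that, of n] assms that by (simp add: UP_coeff del: U.coeff_add)
  show "(p \<otimes>\<^bsub>UP R\<^esub> q) n = (\<Oplus>i\<in>{..n}. p i \<otimes> q (n - i))" if "q \<in> carrier (UP R)"
    using U.coeff_mult[OF assms that, of n] assms that by (simp add: UP_coeff del: U.coeff_mult)
  show "(\<ominus>\<^bsub>UP R\<^esub> p) n = \<ominus> (p n)"
    using U.coeff_a_inv[OF assms, of n] assms by (simp add: UP_coeff del: U.coeff_a_inv)
  show "(a \<odot>\<^bsub>UP R\<^esub> p) n = a \<otimes> p n" if "a \<in> carrier R"
    using U.coeff_smult[OF that assms, of n] assms that by (simp add: UP_coeff del: U.coeff_smult)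
qed

lemma UP_apply_zero [simp]: "\<zero>\<^bsub>UP R\<^esub> n = \<zero>"
  by (simp add: UP_def)

lemma UP_apply_one: "\<one>\<^bsub>UP R\<^esub> n = (if n = 0 then \<one> else \<zero>)"
  by (simp add: UP_def)

abbreviation mon :: "'a \<Rightarrow> nat \<Rightarrow> nat \<Rightarrow> 'a" where
  "mon a n \<equiv> up_ring.monom (UP R) a n"

lemma mon_apply: "a \<in> carrier R \<Longrightarrow> mon a n i = (if i = n then a else \<zero>)"
  by (simp add: UP_def)

lemma mon_closed: "a \<in> carrier R \<Longrightarrow> mon a n \<in> carrier (UP R)"
  by simp

lemma mon_mult: "\<lbrakk>a \<in> carrier R; b \<in> carrier R\<rbrakk> \<Longrightarrow> mon a i \<otimes>\<^bsub>UP R\<^esub> mon b j = mon (a \<otimes> b) (i + j)"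
  by (simp add: U.monom_mult)

lemma mon_add: "\<lbrakk>a \<in> carrier R; b \<in> carrier R\<rbrakk> \<Longrightarrow> mon (a \<oplus> b) i = mon a i \<oplus>\<^bsub>UP R\<^esub> mon b i"
  by simp

lemma mon_smult: "\<lbrakk>a \<in> carrier R; b \<in> carrier R\<rbrakk> \<Longrightarrow> mon (a \<otimes> b) i = a \<odot>\<^bsub>UP R\<^esub> mon b i"
  by (rule ext) (simp add: mon_apply UP_apply_smult)

lemma mon_one: "mon \<one> 0 = \<one>\<^bsub>UP R\<^esub>" by simp

lemma mon_zero: "mon \<zero> n = \<zero>\<^bsub>UP R\<^esub>" by simp

lemma mon_smult_eq: "\<lbrakk>a \<in> carrier R; p \<in> carrier (UP R)\<rbrakk> \<Longrightarrow> mon a 0 \<otimes>\<^bsub>UP R\<^esub> p = a \<odot>\<^bsub>UP R\<^esub> p"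
  by (rule U.monom_mult_is_smult)

lemma UP_is_cring: "cring (UP R)" by (rule U.UP_cring)
lemma UP_is_module: "module R (UP R)" by (rule U.module_axioms)

lemma UP_bound: "p \<in> carrier (UP R) \<Longrightarrow> \<exists>n. \<forall>i\<ge>n. p i = \<zero>"
proof -
  assume "p \<in> carrier (UP R)"
  then obtain n where n: "bound \<zero> n p" using bound_upD[of p] by (auto simp: UP_def)
  then have "\<forall>i\<ge>Suc n. p i = \<zero>" by (auto simp: bound_def)
  then show ?thesis by blast
qed

lemma rees_simps [simp]:
  "mult (rees_algebra R K) = mult (UP R)" "one (rees_algebra R K) = one (UP R)"
  "zero (rees_algebra R K) = zero (UP R)" "add (rees_algebra R K) = add (UP R)"
  by (simp_all add: rees_algebra_def)

lemma rees_mem: "p \<in> carrier (rees_algebra R K) \<longleftrightarrow> p \<in> carrier (UP R) \<and> (\<forall>n. p n \<in> ideal_pow R K n)"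
  by (auto simp: rees_algebra_def UP_coeff)

lemma rees_mon_mem:
  assumes "ideal K R" "a \<in> ideal_pow R K n" shows "mon a n \<in> carrier (rees_algebra R K)"
  using assms ideal_carrier[OF pow_ideal[OF assms(1)]] ideal_zero[OF pow_ideal[OF assms(1)]]
  by (auto simp: rees_mem mon_apply)

lemma rees_cring:
  assumes K: "ideal K R" shows "cring (rees_algebra R K)"
proof -
  have C: "ring (UP R)" using UP_is_cring by (rule cring.axioms)
  have I: "ideal (ideal_pow R K n) R" for n by (rule pow_ideal[OF K])
  have "subring (carrier (rees_algebra R K)) (UP R)"
  proof (rule ring.subringI[OF C])
    show "carrier (rees_algebra R K) \<subseteq> carrier (UP R)" by (auto simp: rees_mem)
    have "\<one> \<in> ideal_pow R K 0" by (simp add: pow_0)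
    then show "\<one>\<^bsub>UP R\<^esub> \<in> carrier (rees_algebra R K)"
      using rees_mon_mem[OF K, of \<one> 0] by simp
    fix p q assume p: "p \<in> carrier (rees_algebra R K)" and q: "q \<in> carrier (rees_algebra R K)"
    show "\<ominus>\<^bsub>UP R\<^esub> p \<in> carrier (rees_algebra R K)"
      using p I ideal_uminus by (auto simp: rees_mem UP_apply_uminus)
    show "p \<oplus>\<^bsub>UP R\<^esub> q \<in> carrier (rees_algebra R K)"
      using p q I ideal_add by (auto simp: rees_mem UP_apply_add)
    have "(p \<otimes>\<^bsub>UP R\<^esub> q) n \<in> ideal_pow R K n" for n
    proof -
      have "p i \<otimes> q (n - i) \<in> ideal_pow R K n" if "i \<le> n" for i
        using pow_mult[OF K, of "p i" i "q (n - i)" "n - i"] p q that by (simp add: rees_mem)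
      then have "(\<Oplus>i\<in>{..n}. p i \<otimes> q (n - i)) \<in> ideal_pow R K n"
        by (intro ideal_finsum[OF I]) auto
      then show ?thesis using p q by (simp add: rees_mem UP_apply_mult)
    qed
    then show "p \<otimes>\<^bsub>UP R\<^esub> q \<in> carrier (rees_algebra R K)" using p q by (simp add: rees_mem)
  qed
  then have "subcring (carrier (rees_algebra R K)) (UP R)" by (rule cring.subcringI'[OF UP_is_cring])
  moreover have "carrier (rees_algebra R K) \<subseteq> carrier (UP R)" by (auto simp: rees_mem)
  ultimately have "cring (UP R\<lparr>carrier := carrier (rees_algebra R K)\<rparr>)"
    using ring.subcring_iff[OF C] by blast
  then show ?thesis by (simp add: rees_algebra_def)
qed

end

context noeth_local_ideal
begin

definition A where "A = rees_algebra R J"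

lemma A_simps [simp]:
  "mult A = mult (UP R)" "one A = one (UP R)" "zero A = zero (UP R)" "add A = add (UP R)"
  by (simp_all add: A_def)

lemma A_mem: "p \<in> carrier A \<longleftrightarrow> p \<in> carrier (UP R) \<and> (\<forall>n. p n \<in> Jp n)"
  unfolding A_def by (rule rees_mem)

lemma A_UP: "p \<in> carrier A \<Longrightarrow> p \<in> carrier (UP R)" by (simp add: A_mem)
lemma A_Jp: "p \<in> carrier A \<Longrightarrow> p n \<in> Jp n" by (simp add: A_mem)

lemma A_mon: "a \<in> Jp n \<Longrightarrow> mon a n \<in> carrier A"
  unfolding A_def by (rule rees_mon_mem[OF J])

lemma A_const: "a \<in> carrier R \<Longrightarrow> mon a 0 \<in> carrier A"
  by (rule A_mon) (simp add: pow_0)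

lemma A_smult: "\<lbrakk>a \<in> carrier R; p \<in> carrier A\<rbrakk> \<Longrightarrow> a \<odot>\<^bsub>UP R\<^esub> p = mon a 0 \<otimes>\<^bsub>A\<^esub> p"
  by (simp add: mon_smult_eq A_UP)

sublocale A: cring A unfolding A_def by (rule rees_cring[OF J])

text \<open>Ideals of \<open>A\<close>, homogeneous or not, and truncations are measured as
  \<open>R\<close>-submodules of the one ambient module \<open>R[t]\<close>.\<close>

sublocale V: local_module R "UP R" \<mm>
  by (rule local_module.intro[OF UP_is_module])
    (use m_carrier nonunit in \<open>unfold_locales; blast\<close>)

definition hat :: "(nat \<Rightarrow> 'a set) \<Rightarrow> (nat \<Rightarrow> 'a) set" where
  "hat T = {p \<in> carrier A. \<forall>n. p n \<in> T n}"

lemma hat_ideal: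
  assumes T: "gsub J T" shows "ideal (hat T) A"
proof (rule A.ideal_commI)
  have I: "ideal (T n) R" for n using gsub_ideal[OF T] .
  show "hat T \<subseteq> carrier A" by (auto simp: hat_def)
  show "\<zero>\<^bsub>A\<^esub> \<in> hat T" using A.zero_closed ideal_zero[OF I] by (simp add: hat_def)
  show "p \<oplus>\<^bsub>A\<^esub> q \<in> hat T" if "p \<in> hat T" "q \<in> hat T" for p q
    using that A.a_closed[of p q] ideal_add[OF I] by (simp add: hat_def UP_apply_add A_UP)
  show "a \<otimes>\<^bsub>A\<^esub> p \<in> hat T" if ap: "a \<in> carrier A" "p \<in> hat T" for a p
  proof -
    have p: "p \<in> carrier A" "\<And>n. p n \<in> T n" using ap by (auto simp: hat_def)
    have "a i \<otimes> p (n - i) \<in> T n" if "i \<le> n" for i n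
      using pow_mult_gsub[OF J T A_Jp[OF ap(1), of i] p(2)[of "n - i"]] that by simp
    then have "(\<Oplus>i\<in>{..n}. a i \<otimes> p (n - i)) \<in> T n" for n
      by (intro ideal_finsum[OF I]) auto
    then show ?thesis using A.m_closed[OF ap(1) p(1)] ap p by (simp add: hat_def UP_apply_mult A_UP)
  qed
qed

lemma hat_mon: "a \<in> T n \<Longrightarrow> a \<in> Jp n \<Longrightarrow> gsub J T \<Longrightarrow> mon a n \<in> hat T"
  using A_mon[of a n] Jp_carrier[of a n] ideal_zero[OF gsub_ideal] by (simp add: hat_def mon_apply)

text \<open>Lowest terms: if \<open>i\<close> and \<open>j\<close> are the first degrees in which
  \<open>p\<close> and \<open>q\<close> leave \<open>T\<close>, all other summands of the
  coefficient of \<open>p q\<close> in degree \<open>i + j\<close> lie in \<open>T\<close>, hence so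
  does \<open>p i \<otimes> q j\<close>.\<close>

lemma hat_prime:
  assumes T: "hprime T" shows "primeideal (hat T) A"
proof (rule primeidealI[OF hat_ideal[OF hprime_gsub[OF T]] A.cring_axioms])
  have I: "ideal (T n) R" for n using gsub_ideal[OF hprime_gsub[OF T]] .
  have "\<one>\<^bsub>A\<^esub> \<notin> hat T"
  proof
    assume "\<one>\<^bsub>A\<^esub> \<in> hat T"
    then have "\<one>\<^bsub>UP R\<^esub> 0 \<in> T 0" by (simp add: hat_def)
    then show False using hprime_0[OF T] one_notin_m by (simp add: UP_apply_one)
  qed
  then show "carrier A \<noteq> hat T" using A.one_closed by blast
  fix p q assume p: "p \<in> carrier A" and q: "q \<in> carrier A" and pq: "p \<otimes>\<^bsub>A\<^esub> q \<in> hat T"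
  show "p \<in> hat T \<or> q \<in> hat T"
  proof (rule ccontr)
    assume "\<not> ?thesis"
    then have exp: "\<exists>n. p n \<notin> T n" and exq: "\<exists>n. q n \<notin> T n" using p q by (auto simp: hat_def)
    define i j where "i = (LEAST n. p n \<notin> T n)" and "j = (LEAST n. q n \<notin> T n)"
    have i: "p i \<notin> T i" "\<And>k. k < i \<Longrightarrow> p k \<in> T k"
      unfolding i_def by (rule LeastI_ex[OF exp]) (drule not_less_Least, blast)
    have j: "q j \<notin> T j" "\<And>k. k < j \<Longrightarrow> q k \<in> T k"
      unfolding j_def by (rule LeastI_ex[OF exq]) (drule not_less_Least, blast)
    let ?f = "\<lambda>k. p k \<otimes> q (i + j - k)"
    have fR: "?f k \<in> carrier R" for k using p q by (simp add: UP_apply_closed A_UP)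
    have rest: "?f k \<in> T (i + j)" if k: "k \<in> {..i+j} - {i}" for k
    proof (cases "k < i")
      case True
      have "q (i + j - k) \<otimes> p k \<in> T ((i + j - k) + k)"
        by (rule pow_mult_gsub[OF J hprime_gsub[OF T] A_Jp[OF q] i(2)[OF True]])
      then show ?thesis using k p q by (simp add: m_comm UP_apply_closed A_UP)
    next
      case False
      then have "i + j - k < j" using k by auto
      then have "p k \<otimes> q (i + j - k) \<in> T (k + (i + j - k))"
        using pow_mult_gsub[OF J hprime_gsub[OF T] A_Jp[OF p] j(2)] by blast
      then show ?thesis using k by simp
    qed
    have s: "(\<Oplus>k\<in>{..i+j} - {i}. ?f k) \<in> T (i + j)" by (rule ideal_finsum[OF I]) (use rest in auto)
    have "insert i ({..i+j} - {i}) = {..i+j}" by auto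
    then have "(\<Oplus>k\<in>{..i+j}. ?f k) = ?f i \<oplus> (\<Oplus>k\<in>{..i+j} - {i}. ?f k)"
      using finsum_insert[of "{..i+j} - {i}" i ?f] fR fR[of i] by simp
    moreover have "(\<Oplus>k\<in>{..i+j}. ?f k) \<in> T (i + j)"
      using pq p q by (simp add: hat_def UP_apply_mult A_UP)
    ultimately have "?f i \<in> T (i + j)"
      using ideal_add_cancel[OF I fR[of i] s] by simp
    then have "p i \<otimes> q j \<in> T (i + j)" by (simp only: add_diff_cancel_left')
    then show False using hprimeD[OF T A_Jp[OF p] A_Jp[OF q]] i(1) j(1) by blast
  qed
qed

lemma hat_less:
  assumes "hprime T" "hprime T'" "T < T'" shows "hat T \<subset> hat T'"
proof -
  have "hat T \<subseteq> hat T'" using assms(3) by (auto simp: hat_def less_fun_def le_fun_def)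
  moreover have "\<not> T' \<le> T" using assms(3) by (simp add: less_le_not_le)
  then obtain n a where a: "a \<in> T' n" "a \<notin> T n" unfolding le_fun_def by blast
  have aJ: "a \<in> Jp n" using a hprime_le[OF assms(2)] by (auto simp: le_fun_def)
  have "mon a n \<in> hat T'" using hat_mon a aJ hprime_gsub assms by blast
  moreover have "mon a n \<notin> hat T"
  proof
    assume "mon a n \<in> hat T"
    then have "mon a n n \<in> T n" by (simp add: hat_def)
    then show False using a Jp_carrier[OF aJ] by (simp add: mon_apply)
  qed
  ultimately show ?thesis by blast
qed

lemma hchain_pchain: "hchain T k \<Longrightarrow> pchain A (hat T) k"
proof (induction k arbitrary: T)
  case 0 then show ?case using hat_prime by simp
next
  case (Suc k)
  then obtain T' where T': "hprime T" "T < T'" "hchain T' k" by auto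
  then have "hat T \<subset> hat T'" "pchain A (hat T') k" "primeideal (hat T) A"
    using hat_less[OF T'(1) hchain_hprime[OF T'(3)] T'(2)] Suc.IH[OF T'(3)] hat_prime[OF T'(1)] by auto
  then show ?case unfolding pchain.simps by (intro conjI exI)
qed

text \<open>The graded pieces of the largest homogeneous ideal contained in
  \<open>q\<close>.\<close>

definition hpart :: "(nat \<Rightarrow> 'a) set \<Rightarrow> nat \<Rightarrow> 'a set" where
  "hpart q n = {a \<in> Jp n. mon a n \<in> q}"

definition over_m :: "(nat \<Rightarrow> 'a) set \<Rightarrow> bool" where
  "over_m q \<longleftrightarrow> primeideal q A \<and> (\<forall>a\<in>\<mm>. mon a 0 \<in> q)"

lemma over_m_prime: "over_m q \<Longrightarrow> primeideal q A" by (simp add: over_m_def)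
lemma over_m_ideal: "over_m q \<Longrightarrow> ideal q A" using over_m_prime primeideal.axioms(1) by blast

lemma over_m_one: "over_m q \<Longrightarrow> \<one>\<^bsub>A\<^esub> \<notin> q"
  using ideal.one_imp_carrier[OF over_m_ideal] primeideal.I_notcarr[OF over_m_prime] by metis

text \<open>\<open>hprime\<close> tests primeness on homogeneous elements only, where it is
  inherited from \<open>q\<close>. The degree 0 part contains \<open>\<mm>\<close> and misses 1, so
  it is \<open>\<mm>\<close>.\<close>

lemma hpart_hprime:
  assumes q: "over_m q" shows "hprime (hpart q)"
proof -
  have I: "ideal q A" using over_m_ideal[OF q] .
  have g: "gsub J (hpart q)"
  proof (rule gsubI)
    fix n
    show "ideal (hpart q n) R"
    proof (rule ideal_commI)
      show "hpart q n \<subseteq> carrier R" using Jp_carrier by (auto simp: hpart_def)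
      show "\<zero> \<in> hpart q n"
        using ideal_zero[OF Jp_ideal] A.ideal_zero[OF I] by (simp add: hpart_def mon_zero)
      show "a \<oplus> b \<in> hpart q n" if ab: "a \<in> hpart q n" "b \<in> hpart q n" for a b
      proof -
        have "a \<in> carrier R" "b \<in> carrier R" using ab Jp_carrier by (auto simp: hpart_def)
        then show ?thesis
          using ab A.ideal_add[OF I] ideal_add[OF Jp_ideal] by (simp add: hpart_def mon_add)
      qed
      show "a \<otimes> b \<in> hpart q n" if ab: "a \<in> carrier R" "b \<in> hpart q n" for a b
      proof -
        have b: "b \<in> Jp n" "mon b n \<in> q" using ab by (auto simp: hpart_def)
        have "mon a 0 \<otimes>\<^bsub>A\<^esub> mon b n \<in> q" using A.ideal_mult[OF I A_const[OF ab(1)] b(2)] .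
        then show ?thesis
          using ab(1) b ideal_mult[OF Jp_ideal] Jp_carrier[OF b(1)] by (simp add: hpart_def mon_mult)
      qed
    qed
  next
    fix n g a assume ga: "g \<in> J" "a \<in> hpart q n"
    have a: "a \<in> Jp n" "mon a n \<in> q" using ga by (auto simp: hpart_def)
    have g1: "g \<in> Jp (Suc 0)" using ga pow_1[OF J] by simp
    have "mon g (Suc 0) \<otimes>\<^bsub>A\<^esub> mon a n \<in> q" using A.ideal_mult[OF I A_mon[OF g1] a(2)] .
    then have "mon (g \<otimes> a) (Suc n) \<in> q" using Jp_carrier[OF g1] Jp_carrier[OF a(1)] by (simp add: mon_mult)
    then show "g \<otimes> a \<in> hpart q (Suc n)"
      using gsub_mult[OF Jp_gsub ga(1) a(1)] unfolding hpart_def by blast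
  qed
  have "\<mm> \<subseteq> hpart q 0" using q m_carrier by (auto simp: hpart_def over_m_def pow_0)
  moreover have "\<one> \<notin> hpart q 0" using over_m_one[OF q] by (simp add: hpart_def mon_one)
  ultimately have "hpart q 0 = \<mm>" using m_eqI gsub_ideal[OF g] by blast
  moreover have "a \<in> hpart q i \<or> b \<in> hpart q j"
    if ab: "a \<in> Jp i" "b \<in> Jp j" "a \<otimes> b \<in> hpart q (i + j)" for i j a b
  proof -
    have "mon a i \<otimes>\<^bsub>A\<^esub> mon b j \<in> q"
      using ab Jp_carrier by (simp add: hpart_def mon_mult)
    then show ?thesis
      using primeideal.I_prime[OF over_m_prime[OF q] A_mon[OF ab(1)] A_mon[OF ab(2)]] ab
      by (simp add: hpart_def)
  qed
  moreover have "hpart q \<le> Jp" by (auto simp: hpart_def le_fun_def)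
  ultimately show ?thesis unfolding hprime_def using g by blast
qed

text \<open>The polynomials of degree less than (not equal to) \<open>n\<close>.\<close>

definition trunc :: "nat \<Rightarrow> (nat \<Rightarrow> 'a) set" where
  "trunc n = {p \<in> carrier A. \<forall>i\<ge>n. p i = \<zero>}"

lemma A_sub: 
  assumes K: "ideal K A" shows "V.sub K"
proof (rule V.subI)
  show "K \<subseteq> carrier (UP R)" using A.ideal_carrier[OF K] A_UP by blast
  show "\<zero>\<^bsub>UP R\<^esub> \<in> K" using A.ideal_zero[OF K] by simp
  show "x \<oplus>\<^bsub>UP R\<^esub> y \<in> K" if "x \<in> K" "y \<in> K" for x y using A.ideal_add[OF K that] by simp
  show "a \<odot>\<^bsub>UP R\<^esub> x \<in> K" if "a \<in> carrier R" "x \<in> K" for a x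
    using A.ideal_mult[OF K A_const[OF that(1)] that(2)] that A.ideal_carrier[OF K that(2)]
    by (simp add: mon_smult_eq A_UP)
qed

lemma trunc_sub: "V.sub (trunc n)"
proof (rule V.subI)
  have A: "V.sub (carrier A)" using A_sub[OF A.oneideal] .
  show "trunc n \<subseteq> carrier (UP R)" using A_UP by (auto simp: trunc_def)
  show "\<zero>\<^bsub>UP R\<^esub> \<in> trunc n" using V.sub_zero[OF A] by (simp add: trunc_def)
  show "x \<oplus>\<^bsub>UP R\<^esub> y \<in> trunc n" if "x \<in> trunc n" "y \<in> trunc n" for x y
    using that V.sub_add[OF A, of x y] by (simp add: trunc_def UP_apply_add A_UP)
  show "a \<odot>\<^bsub>UP R\<^esub> x \<in> trunc n" if "a \<in> carrier R" "x \<in> trunc n" for a x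
    using that V.sub_smult[OF A, of a x] by (simp add: trunc_def UP_apply_smult A_UP)
qed

lemma trunc_mono: "m \<le> n \<Longrightarrow> trunc m \<subseteq> trunc n"
  by (auto simp: trunc_def)

lemma trunc_exists: "p \<in> carrier A \<Longrightarrow> \<exists>n. p \<in> trunc n"
  using UP_bound[OF A_UP] by (auto simp: trunc_def)

lemma trunc_mult:
  assumes p: "p \<in> trunc m" and q: "q \<in> trunc n" shows "p \<otimes>\<^bsub>A\<^esub> q \<in> trunc (m + n)"
proof -
  have pq: "p \<in> carrier A" "q \<in> carrier A" using p q by (auto simp: trunc_def)
  have "(\<Oplus>k\<in>{..i}. p k \<otimes> q (i - k)) = \<zero>" if i: "i \<ge> m + n" for i
  proof -
    have "p k \<otimes> q (i - k) = \<zero>" for k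
    proof (cases "k < m")
      case True
      then have "q (i - k) = \<zero>" using q i by (simp add: trunc_def)
      then show ?thesis using pq by (simp add: UP_apply_closed A_UP)
    next
      case False
      then have "p k = \<zero>" using p by (simp add: trunc_def)
      then show ?thesis using pq by (simp add: UP_apply_closed A_UP)
    qed
    then show ?thesis by simp
  qed
  then show ?thesis
    using A.m_closed[OF pq] pq by (simp add: trunc_def UP_apply_mult A_UP)
qed

lemma trunc_Suc_split:
  assumes p: "p \<in> trunc (Suc n)"
  obtains p' where "p' \<in> trunc n" "p = p' \<oplus>\<^bsub>UP R\<^esub> mon (p n) n" "\<And>i. i < n \<Longrightarrow> p' i = p i"
proof -
  have pA: "p \<in> carrier A" using p by (simp add: trunc_def)
  have m: "mon (p n) n \<in> carrier A" using A_mon[OF A_Jp[OF pA]] .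
  have R: "p i \<in> carrier R" for i using pA by (simp add: UP_apply_closed A_UP)
  let ?p' = "p \<ominus>\<^bsub>A\<^esub> mon (p n) n"
  have c: "?p' \<in> carrier A" using pA m by (rule A.minus_closed)
  have eq: "p = ?p' \<oplus>\<^bsub>A\<^esub> mon (p n) n"
    using pA m by (simp only: a_minus_def A.a_assoc A.l_neg A.r_zero A.a_inv_closed)
  have ap: "p i = ?p' i \<oplus> mon (p n) n i" for i
  proof -
    have "(?p' \<oplus>\<^bsub>UP R\<^esub> mon (p n) n) i = ?p' i \<oplus> mon (p n) n i"
      by (rule UP_apply_add) (use c m A_UP in auto)
    then show ?thesis using eq by simp
  qed
  have cR: "?p' i \<in> carrier R" for i using UP_apply_closed[OF A_UP[OF c]] .
  have low: "?p' i = p i" if "i \<noteq> n" for i using ap[of i] that cR[of i] R by (simp add: mon_apply)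
  have "?p' n = \<zero>" using ap[of n] cR[of n] R[of n]
    by (metis mon_apply add.r_cancel_one')
  then have "?p' \<in> trunc n" using c low p unfolding trunc_def
    by (smt (verit) Suc_leI le_neq_implies_less mem_Collect_eq)
  then show ?thesis using that[of ?p'] eq low by simp
qed

lemma hat_le:
  assumes q: "ideal q A" and T: "T \<le> hpart q" shows "hat T \<subseteq> q"
proof
  have z: "\<zero> \<in> hpart q i" for i
    using ideal_zero[OF Jp_ideal] A.ideal_zero[OF q] by (simp add: hpart_def mon_zero)
  have ind: "\<lbrakk>p \<in> trunc n; \<And>i. p i \<in> hpart q i\<rbrakk> \<Longrightarrow> p \<in> q" for n p
  proof (induction n arbitrary: p)
    case 0
    have "p = \<zero>\<^bsub>A\<^esub>"
    proof
      show "p i = \<zero>\<^bsub>A\<^esub> i" for i using 0(1) by (simp add: trunc_def)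
    qed
    then show ?case using A.ideal_zero[OF q] by metis
  next
    case (Suc n)
    obtain p' where p': "p' \<in> trunc n" "p = p' \<oplus>\<^bsub>UP R\<^esub> mon (p n) n" "\<And>i. i < n \<Longrightarrow> p' i = p i"
      using trunc_Suc_split[OF Suc.prems(1)] by blast
    have "p' i \<in> hpart q i" for i
    proof (cases "i < n")
      case True then show ?thesis using p'(3) Suc.prems(2)[of i] by simp
    next
      case False
      then have "p' i = \<zero>" using p'(1) by (simp add: trunc_def)
      then show ?thesis using z by simp
    qed
    then have "p' \<in> q" using Suc.IH p'(1) by simp
    moreover have "mon (p n) n \<in> q" using Suc.prems(2)[of n] by (simp add: hpart_def)
    ultimately have "p' \<oplus>\<^bsub>A\<^esub> mon (p n) n \<in> q" by (rule A.ideal_add[OF q])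
    then show ?case using p'(2) by simp
  qed
  fix p assume p: "p \<in> hat T"
  then obtain n where "p \<in> trunc n" using trunc_exists by (auto simp: hat_def)
  moreover have "p i \<in> hpart q i" for i using p le_funD[OF T, of i] by (auto simp: hat_def)
  ultimately show "p \<in> q" by (rule ind)
qed

text \<open>For a homogeneous ideal the filtration by degree has the graded pieces as factors, so
  its lengths are the partial sums of the Hilbert function.\<close>

lemma has_len_hat:
  assumes T: "hprime T"
  shows "V.has_len (hat T \<inter> trunc n) (trunc n) (\<Sum>j<n. hfun T j)"
proof (induction n)
  case 0
  have "trunc 0 = {\<zero>\<^bsub>UP R\<^esub>}" using V.sub_zero[OF trunc_sub] by (auto simp: trunc_def)
  moreover have "\<zero>\<^bsub>UP R\<^esub> \<in> hat T" using A.ideal_zero[OF hat_ideal[OF hprime_gsub[OF T]]] by simp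
  ultimately show ?case using V.has_len.refl[OF trunc_sub, of 0] by simp
next
  case (Suc n)
  interpret LV: local_module_map R "mult_module R (carrier R)" "UP R" \<mm> ..
  have Tg: "gsub J T" using hprime_gsub[OF T] .
  have hs: "V.sub (hat T)" using A_sub[OF hat_ideal[OF Tg]] .
  \<comment> \<open>\<open>?Y\<close> is \<open>?X + trunc n\<close>. The factor
    \<open>?Y / ?X\<close> is the previous truncation by the second isomorphism theorem, and
    \<open>trunc (Suc n) / ?Y\<close> is the degree \<open>n\<close> piece, reached by
    \<open>a \<mapsto> a t^n\<close>.\<close>
  let ?X = "hat T \<inter> trunc (Suc n)"
  let ?Y = "{z \<oplus>\<^bsub>UP R\<^esub> x | z x. z \<in> ?X \<and> x \<in> trunc n}"
  have X: "V.sub ?X" using V.sub_Int[OF hs trunc_sub] .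
  have "trunc n \<inter> ?X = hat T \<inter> trunc n" using trunc_mono[of n "Suc n"] by auto
  then have 1: "V.has_len ?X ?Y (\<Sum>j<n. hfun T j)" using V.has_len_sum[OF _ X] Suc by simp
  have Y: "V.sub ?Y" using V.has_len_sub[OF 1] by blast
  have T1: "L.has_len (T n) (Jp n) (hfun T n)"
    by (rule nilp_has_len[OF Tg Jp_gsub hprime_le[OF T] hprime_nilp[OF T order_refl]])
  have Yn: "y n \<in> T n" if y: "y \<in> ?Y" for y
  proof -
    obtain z x where zx: "y = z \<oplus>\<^bsub>UP R\<^esub> x" "z \<in> ?X" "x \<in> trunc n" using y by blast
    have UPzx: "z \<in> carrier (UP R)" "x \<in> carrier (UP R)" using zx A_UP by (auto simp: trunc_def)
    have "y n = z n" using zx UPzx UP_apply_closed[OF UPzx(1), of n]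
      by (simp add: UP_apply_add trunc_def)
    then show ?thesis using zx by (simp add: hat_def)
  qed
  have zeroX: "\<zero>\<^bsub>UP R\<^esub> \<in> ?X" and zeroA: "\<zero>\<^bsub>UP R\<^esub> \<in> trunc n"
    using V.sub_zero[OF X] V.sub_zero[OF trunc_sub] by auto
  have XY: "?X \<subseteq> ?Y"
  proof
    fix z assume z: "z \<in> ?X"
    then have "z = z \<oplus>\<^bsub>UP R\<^esub> \<zero>\<^bsub>UP R\<^esub>" using V.sub_carrier[OF X] by simp
    then show "z \<in> ?Y" using z zeroA by blast
  qed
  have AY: "trunc n \<subseteq> ?Y"
  proof
    fix z assume z: "z \<in> trunc n"
    then have "z = \<zero>\<^bsub>UP R\<^esub> \<oplus>\<^bsub>UP R\<^esub> z" using V.sub_carrier[OF trunc_sub] by simp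
    then show "z \<in> ?Y" using z zeroX by blast
  qed
  have monX: "mon a n \<in> trunc (Suc n)" if "a \<in> Jp n" for a
    using A_mon[OF that] Jp_carrier[OF that] by (simp add: trunc_def mon_apply)
  have 2: "V.has_len ?Y {z \<oplus>\<^bsub>UP R\<^esub> mon a n | z a. z \<in> ?Y \<and> a \<in> Jp n} (hfun T n)"
  proof (rule LV.has_len_map[OF T1])
    show "mon a n \<in> carrier (UP R)" if "a \<in> Jp n" for a using that Jp_carrier mon_closed by blast
    show "mon (a \<oplus>\<^bsub>mult_module R (carrier R)\<^esub> b) n = mon a n \<oplus>\<^bsub>UP R\<^esub> mon b n"
      if "a \<in> Jp n" "b \<in> Jp n" for a b
      using Jp_carrier[OF that(1)] Jp_carrier[OF that(2)] by (simp add: mon_add)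
    show "mon (b \<odot>\<^bsub>mult_module R (carrier R)\<^esub> a) n = b \<odot>\<^bsub>UP R\<^esub> mon a n"
      if "b \<in> carrier R" "a \<in> Jp n" for a b
      using that(1) Jp_carrier[OF that(2)] by (simp add: mon_smult)
    show "V.sub ?Y" by (rule Y)
    show "mon a n \<in> ?Y \<longleftrightarrow> a \<in> T n" if a: "a \<in> Jp n" for a
    proof
      assume "mon a n \<in> ?Y"
      then have "mon a n n \<in> T n" by (rule Yn)
      then show "a \<in> T n" using Jp_carrier[OF a] by (simp add: mon_apply)
    next
      assume "a \<in> T n"
      then have "mon a n \<in> ?X" using hat_mon[OF _ a Tg] monX[OF a] by blast
      then show "mon a n \<in> ?Y" using XY by blast
    qed
  qed
  have "{z \<oplus>\<^bsub>UP R\<^esub> mon a n | z a. z \<in> ?Y \<and> a \<in> Jp n} = trunc (Suc n)"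
  proof
    have YA: "?Y \<subseteq> trunc (Suc n)"
    proof
      fix y assume "y \<in> ?Y"
      then obtain z x where zx: "y = z \<oplus>\<^bsub>UP R\<^esub> x" "z \<in> ?X" "x \<in> trunc n" by blast
      then have "z \<in> trunc (Suc n)" "x \<in> trunc (Suc n)" using trunc_mono[of n "Suc n"] by auto
      then show "y \<in> trunc (Suc n)" unfolding zx(1) by (rule V.sub_add[OF trunc_sub])
    qed
    show "{z \<oplus>\<^bsub>UP R\<^esub> mon a n | z a. z \<in> ?Y \<and> a \<in> Jp n} \<subseteq> trunc (Suc n)"
    proof
      fix y assume "y \<in> {z \<oplus>\<^bsub>UP R\<^esub> mon a n | z a. z \<in> ?Y \<and> a \<in> Jp n}"
      then obtain z a where za: "y = z \<oplus>\<^bsub>UP R\<^esub> mon a n" "z \<in> ?Y" "a \<in> Jp n"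
        by (elim CollectE exE conjE) blast
      show "y \<in> trunc (Suc n)"
        unfolding za(1) using subsetD[OF YA za(2)] monX[OF za(3)] by (rule V.sub_add[OF trunc_sub])
    qed
    show "trunc (Suc n) \<subseteq> {z \<oplus>\<^bsub>UP R\<^esub> mon a n | z a. z \<in> ?Y \<and> a \<in> Jp n}"
    proof
      fix p assume p: "p \<in> trunc (Suc n)"
      then have "p n \<in> Jp n" using A_Jp by (simp add: trunc_def)
      moreover obtain p' where "p' \<in> trunc n" "p = p' \<oplus>\<^bsub>UP R\<^esub> mon (p n) n"
        using trunc_Suc_split[OF p] by blast
      ultimately show "p \<in> {z \<oplus>\<^bsub>UP R\<^esub> mon a n | z a. z \<in> ?Y \<and> a \<in> Jp n}" using AY by blast
    qed
  qed
  then have "V.has_len ?Y (trunc (Suc n)) (hfun T n)" using 2 by simp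
  from V.has_len_trans[OF this 1] show ?case by simp
qed

lemma over_m_sub: "over_m q \<Longrightarrow> V.sub (q \<inter> trunc n)"
  using V.sub_Int[OF A_sub[OF over_m_ideal] trunc_sub] .

text \<open>The homogeneous ideal \<open>hat T\<close> lies inside \<open>q\<close>, so the
  truncations of \<open>A / q\<close> are quotients of those of \<open>A / hat T\<close>. This is
  where an inhomogeneous prime meets a Hilbert function.\<close>

lemma has_len_over_m:
  assumes q: "over_m q" and T: "hprime T" "T \<le> hpart q"
  shows "\<exists>k\<le>(\<Sum>j<n. hfun T j). V.has_len (q \<inter> trunc n) (trunc n) k"
proof -
  have "hat T \<inter> trunc n \<subseteq> q \<inter> trunc n" using hat_le[OF over_m_ideal[OF q] T(2)] by blast
  then obtain i j where "V.has_len (q \<inter> trunc n) (trunc n) j" "i + j = (\<Sum>j<n. hfun T j)"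
    using V.has_len_split[OF has_len_hat[OF T(1)] over_m_sub[OF q], of n n] by blast
  then show ?thesis by (intro exI[of _ j]) simp
qed

text \<open>As \<open>q\<close> is prime and \<open>f\<close> is outside it, multiplication by
  \<open>f\<close> is injective on \<open>A / q\<close>; it raises the truncation degree by at most
  \<open>e\<close>.\<close>

lemma has_len_over_m_mult:
  assumes q: "over_m q" and f: "f \<in> trunc e" "f \<notin> q" and k: "V.has_len (q \<inter> trunc n) (trunc n) k"
  shows "\<exists>X. V.has_len (q \<inter> trunc (n + e)) X k \<and> X = {z \<oplus>\<^bsub>UP R\<^esub> f \<otimes>\<^bsub>A\<^esub> x | z x. z \<in> q \<inter> trunc (n + e) \<and> x \<in> trunc n}"
proof -
  interpret VV: local_module_map R "UP R" "UP R" \<mm> ..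
  have fA: "f \<in> carrier A" using f by (simp add: trunc_def)
  have trunc_A: "x \<in> trunc m \<Longrightarrow> x \<in> carrier A" for x m by (simp add: trunc_def)
  have "V.has_len (q \<inter> trunc (n + e)) {z \<oplus>\<^bsub>UP R\<^esub> f \<otimes>\<^bsub>A\<^esub> x | z x. z \<in> q \<inter> trunc (n + e) \<and> x \<in> trunc n} k"
  proof (rule VV.has_len_map[OF k])
    show "f \<otimes>\<^bsub>A\<^esub> x \<in> carrier (UP R)" if "x \<in> trunc n" for x
      using A_UP[OF A.m_closed[OF fA trunc_A[OF that]]] .
    show "f \<otimes>\<^bsub>A\<^esub> (x \<oplus>\<^bsub>UP R\<^esub> y) = f \<otimes>\<^bsub>A\<^esub> x \<oplus>\<^bsub>UP R\<^esub> f \<otimes>\<^bsub>A\<^esub> y" if "x \<in> trunc n" "y \<in> trunc n" for x y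
      using A.r_distr[OF trunc_A[OF that(1)] trunc_A[OF that(2)] fA] by simp
    show "f \<otimes>\<^bsub>A\<^esub> (a \<odot>\<^bsub>UP R\<^esub> x) = a \<odot>\<^bsub>UP R\<^esub> (f \<otimes>\<^bsub>A\<^esub> x)" if "a \<in> carrier R" "x \<in> trunc n" for a x
      using A_smult[OF that(1) trunc_A[OF that(2)]] A_smult[OF that(1) A.m_closed[OF fA trunc_A[OF that(2)]]]
        A.m_lcomm[OF fA A_const[OF that(1)] trunc_A[OF that(2)]] by simp
    show "V.sub (q \<inter> trunc (n + e))" by (rule over_m_sub[OF q])
    show "f \<otimes>\<^bsub>A\<^esub> x \<in> q \<inter> trunc (n + e) \<longleftrightarrow> x \<in> q \<inter> trunc n" if x: "x \<in> trunc n" for x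
    proof
      assume "f \<otimes>\<^bsub>A\<^esub> x \<in> q \<inter> trunc (n + e)"
      then show "x \<in> q \<inter> trunc n"
        using primeideal.I_prime[OF over_m_prime[OF q] fA trunc_A[OF x]] f x by blast
    next
      assume "x \<in> q \<inter> trunc n"
      then show "f \<otimes>\<^bsub>A\<^esub> x \<in> q \<inter> trunc (n + e)"
        using A.ideal_mult[OF over_m_ideal[OF q] fA] trunc_mult[OF f(1) x] by (simp add: add.commute)
    qed
  qed
  then show ?thesis by blast
qed

text \<open>Multiplication by \<open>f\<close> embeds \<open>A / q\<close> into itself with image in \<open>q' / q\<close>.\<close>

lemma over_m_len_step:
  assumes q: "over_m q" and q': "over_m q'" and sub: "q \<subseteq> q'" and f: "f \<in> trunc e" "f \<notin> q" "f \<in> q'"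
    and k: "V.has_len (q \<inter> trunc n) (trunc n) k" and k': "V.has_len (q' \<inter> trunc (n + e)) (trunc (n + e)) k'"
    and k'': "V.has_len (q \<inter> trunc (n + e)) (trunc (n + e)) k''"
  shows "k + k' \<le> k''"
proof -
  obtain X where X: "V.has_len (q \<inter> trunc (n + e)) X k"
    "X = {z \<oplus>\<^bsub>UP R\<^esub> f \<otimes>\<^bsub>A\<^esub> x | z x. z \<in> q \<inter> trunc (n + e) \<and> x \<in> trunc n}"
    using has_len_over_m_mult[OF q f(1,2) k] by blast
  have "f \<otimes>\<^bsub>A\<^esub> x \<in> q' \<inter> trunc (n + e)" if "x \<in> trunc n" for x
    using ideal.I_r_closed[OF over_m_ideal[OF q'] f(3), of x] trunc_mult[OF f(1) that] that
    by (simp add: trunc_def add.commute)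
  then have "X \<subseteq> q' \<inter> trunc (n + e)"
    unfolding X(2) using V.sub_add[OF over_m_sub[OF q']] sub by blast
  then show ?thesis using V.has_len_two[OF k'' X(1) _ k' order_refl] by blast
qed

lemma over_m_len_mono:
  assumes q: "over_m q" and le: "n \<le> m"
    and k: "V.has_len (q \<inter> trunc n) (trunc n) k" and k': "V.has_len (q \<inter> trunc m) (trunc m) k'"
  shows "k \<le> k'"
proof (cases "n = m")
  case True
  then show ?thesis using k k' V.has_len_unique by blast
next
  case False
  then obtain e where m: "m = n + e" "e \<ge> 1" using le by (metis less_imp_add_positive le_neq_implies_less Suc_leI One_nat_def)
  \<comment> \<open>Monotonicity is the case of multiplication by 1. It needs
    \<open>e \<ge> 1\<close>, since \<open>trunc 0\<close> is zero; hence the separate case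
    \<open>n = m\<close>.\<close>
  have f: "\<one>\<^bsub>A\<^esub> \<in> trunc e" using A.one_closed m(2) by (simp add: trunc_def UP_apply_one)
  obtain X where X: "V.has_len (q \<inter> trunc m) X k"
    "X = {z \<oplus>\<^bsub>UP R\<^esub> \<one>\<^bsub>A\<^esub> \<otimes>\<^bsub>A\<^esub> x | z x. z \<in> q \<inter> trunc m \<and> x \<in> trunc n}"
    using has_len_over_m_mult[OF q f over_m_one[OF q] k] m(1) by blast
  have "\<one>\<^bsub>A\<^esub> \<otimes>\<^bsub>A\<^esub> x \<in> trunc m" if "x \<in> trunc n" for x
    using trunc_mult[OF f that] by (simp add: m(1) add.commute)
  then have "X \<subseteq> trunc m" unfolding X(2) using V.sub_add[OF trunc_sub] by blast
  then show ?thesis using V.has_len_mono[OF k' X(1)] by blast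
qed

lemma over_m_len_pos:
  assumes q: "over_m q" and k: "V.has_len (q \<inter> trunc (Suc n)) (trunc (Suc n)) k"
  shows "1 \<le> k"
proof (rule ccontr)
  assume "\<not> 1 \<le> k"
  then have "k = 0" by simp
  then have "q \<inter> trunc (Suc n) = trunc (Suc n)" using V.has_len_0D k by blast
  moreover have "\<one>\<^bsub>A\<^esub> \<in> trunc (Suc n)" using A.one_closed by (simp add: trunc_def UP_apply_one)
  ultimately show False using over_m_one[OF q] by blast
qed

text \<open>The inequality of \<open>over_m_len_step\<close> turns into Pascal's rule when degrees
  advance in steps of \<open>e\<close>, so the binomial coefficients are lower bounds. The offset
  \<open>Suc\<close> ensures that 1 is present already at \<open>n = 0\<close>.\<close>

lemma pchain_growth:
  assumes "pchain A q l" "over_m q"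
  shows "\<exists>e. \<forall>n k. V.has_len (q \<inter> trunc (Suc (e * n))) (trunc (Suc (e * n))) k \<longrightarrow> ((n + l) choose l) \<le> k"
  using assms
proof (induction l arbitrary: q)
  case 0
  then show ?case using over_m_len_pos by auto
next
  case (Suc l)
  then obtain q' where q': "q \<subset> q'" "pchain A q' l" by auto
  have om': "over_m q'" using Suc.prems q' pchain_prime unfolding over_m_def by blast
  obtain e' where e': "\<And>n k. V.has_len (q' \<inter> trunc (Suc (e' * n))) (trunc (Suc (e' * n))) k \<Longrightarrow> ((n + l) choose l) \<le> k"
    using Suc.IH[OF q'(2) om'] by blast
  obtain f where f: "f \<in> q'" "f \<notin> q" using q' by blast
  then obtain d where d: "f \<in> trunc d" using trunc_exists A.ideal_carrier[OF over_m_ideal[OF om']] by blast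
  \<comment> \<open>One step width must serve both the bound for \<open>q'\<close> and the degree of
    the multiplier \<open>f\<close>; the wider steps only enlarge the truncations of
    \<open>A / q'\<close>.\<close>
  define E where "E = max e' d"
  have fE: "f \<in> trunc E" using d trunc_mono[of d E] by (auto simp: E_def)
  \<comment> \<open>Finiteness comes from the homogeneous prime \<open>hpart p\<close> inside
    \<open>p\<close>.\<close>
  have ex: "\<exists>k. V.has_len (p \<inter> trunc n) (trunc n) k" if "over_m p" for p n
    using has_len_over_m[OF that hpart_hprime[OF that] order_refl] by blast
  have "((n + Suc l) choose Suc l) \<le> k" if "V.has_len (q \<inter> trunc (Suc (E * n))) (trunc (Suc (E * n))) k" for n k
    using that
  proof (induction n arbitrary: k)
    case 0
    then show ?case using over_m_len_pos[OF Suc.prems(2)] by simp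
  next
    case (Suc n)
    obtain k1 where k1: "V.has_len (q \<inter> trunc (Suc (E * n))) (trunc (Suc (E * n))) k1"
      using ex[OF \<open>over_m q\<close>] by blast
    have eq: "Suc (E * Suc n) = Suc (E * n) + E" by simp
    obtain k2 where k2: "V.has_len (q' \<inter> trunc (Suc (E * n) + E)) (trunc (Suc (E * n) + E)) k2"
      using ex[OF om'] by blast
    obtain k3 where k3: "V.has_len (q' \<inter> trunc (Suc (e' * Suc n))) (trunc (Suc (e' * Suc n))) k3"
      using ex[OF om'] by blast
    have "((Suc n + l) choose l) \<le> k3" by (rule e'[OF k3])
    also have "\<dots> \<le> k2"
    proof (rule over_m_len_mono[OF om' _ k3 k2])
      have "e' * Suc n \<le> E * Suc n" by (rule mult_le_mono1) (simp add: E_def)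
      then show "Suc (e' * Suc n) \<le> Suc (E * n) + E" using eq by simp
    qed
    finally have 2: "((Suc n + l) choose l) \<le> k2" .
    have 1: "((n + Suc l) choose Suc l) \<le> k1" by (rule Suc.IH[OF k1])
    have "k1 + k2 \<le> k"
      by (rule over_m_len_step[OF \<open>over_m q\<close> om' _ fE f(2) f(1) k1 k2])
        (use q' Suc.prems[unfolded eq] in auto)
    moreover have "((Suc n + Suc l) choose Suc l) = ((n + Suc l) choose Suc l) + ((Suc n + l) choose l)"
      by simp
    ultimately show ?case using 1 2 by linarith
  qed
  then show ?case by blast
qed

text \<open>A chain of length \<open>l\<close> forces growth of order \<open>n^l\<close> on
  \<open>A / q\<close>, while the sum function of the Hilbert function of \<open>T\<close> caps the
  growth at degree plus 1.\<close>

theorem pchain_le_degree: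
  assumes "pchain A q l" "over_m q" "hprime T" "T \<le> hpart q" "evpoly (hfun T) Q"
  shows "l \<le> nat (poly_deg Q + 1)"
proof -
  obtain e where e: "\<And>n k. V.has_len (q \<inter> trunc (Suc (e * n))) (trunc (Suc (e * n))) k \<Longrightarrow> ((n + l) choose l) \<le> k"
    using pchain_growth[OF assms(1,2)] by blast
  obtain C where C: "\<And>n. (\<Sum>j\<le>n. hfun T j) \<le> C * (n + 1) ^ nat (poly_deg Q + 1)"
    using evpoly_sum_growth[OF assms(5)] by blast
  show ?thesis
  proof (rule growth_exponent_le)
    fix n
    obtain k where k: "k \<le> (\<Sum>j<Suc (e * n). hfun T j)"
      "V.has_len (q \<inter> trunc (Suc (e * n))) (trunc (Suc (e * n))) k"
      using has_len_over_m[OF assms(2-4)] by blast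
    have "((n + l) choose l) \<le> k" by (rule e[OF k(2)])
    also have "\<dots> \<le> (\<Sum>j\<le>e * n. hfun T j)" using k(1) by (simp only: lessThan_Suc_atMost)
    also have "\<dots> \<le> C * (e * n + 1) ^ nat (poly_deg Q + 1)" by (rule C)
    finally show "((n + l) choose l) \<le> C * (e * n + 1) ^ nat (poly_deg Q + 1)" .
  qed
qed

end

section \<open>Quotients: chains of primes and lengths\<close>

lemma pchain_iff:
  "pchain A q n \<longleftrightarrow> (\<exists>P. P 0 = q \<and> (\<forall>i\<le>n. primeideal (P i) A) \<and> (\<forall>i<n. P i \<subset> P (Suc i)))"
proof (induction n arbitrary: q)
  case 0
  show ?case by (auto intro: exI[of _ "\<lambda>_. q"])
next
  case (Suc n)
  show ?case
  proof
    assume "pchain A q (Suc n)"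
    then obtain q' P where q: "primeideal q A" "q \<subset> q'" "P 0 = q'" "\<forall>i\<le>n. primeideal (P i) A" "\<forall>i<n. P i \<subset> P (Suc i)"
      using Suc.IH by auto
    show "\<exists>P. P 0 = q \<and> (\<forall>i\<le>Suc n. primeideal (P i) A) \<and> (\<forall>i<Suc n. P i \<subset> P (Suc i))"
    proof (intro exI conjI allI impI)
      let ?P = "case_nat q P"
      show "?P 0 = q" by simp
      show "primeideal (?P i) A" if "i \<le> Suc n" for i using that q by (cases i) auto
      show "?P i \<subset> ?P (Suc i)" if "i < Suc n" for i using that q by (cases i) auto
    qed
  next
    assume "\<exists>P. P 0 = q \<and> (\<forall>i\<le>Suc n. primeideal (P i) A) \<and> (\<forall>i<Suc n. P i \<subset> P (Suc i))"
    then obtain P where P: "P 0 = q" "\<forall>i\<le>Suc n. primeideal (P i) A" "\<forall>i<Suc n. P i \<subset> P (Suc i)" by blast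
    have "pchain A (P (Suc 0)) n"
      unfolding Suc.IH by (rule exI[of _ "\<lambda>i. P (Suc i)"]) (use P in auto)
    moreover have "primeideal q A" "q \<subset> P (Suc 0)" using P by auto
    ultimately show "pchain A q (Suc n)" unfolding pchain.simps by blast
  qed
qed

section \<open>Correspondence of primes under a quotient map\<close>

context cring
begin

context
  fixes a :: "'a set"
  assumes a: "ideal a R"
begin

interpretation Q: cring "R Quot a"
  using ideal.quotient_is_cring[OF a cring_axioms] .

private lemma coset_mult: "\<lbrakk>x \<in> carrier R; y \<in> carrier R\<rbrakk> \<Longrightarrow> (a +> x) \<otimes>\<^bsub>R Quot a\<^esub> (a +> y) = a +> (x \<otimes> y)"
  using ideal.rcoset_mult_add[OF a] by (simp add: FactRing_def)

private lemma Quot_carrierE: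
  assumes "X \<in> carrier (R Quot a)" obtains x where "x \<in> carrier R" "X = a +> x"
  using assms unfolding FactRing_def A_RCOSETS_def'[of R a] by auto

private lemma Quot_carrierI: "x \<in> carrier R \<Longrightarrow> a +> x \<in> carrier (R Quot a)"
  unfolding FactRing_def A_RCOSETS_def'[of R a] by auto

private lemma mem_Union:
  assumes "ideal P (R Quot a)" "x \<in> carrier R"
  shows "x \<in> \<Union>P \<longleftrightarrow> a +> x \<in> P"
  using canonical_proj_vimage_mem_iff[OF a _ assms(2)] Q.ideal_carrier[OF assms(1)] by blast

private lemma Union_image:
  assumes "ideal q R" "a \<subseteq> q" shows "\<Union>((+>) a ` q) = q"
  using ideal_incl_iff[OF a assms(1)] assms(2) by blast

lemma prime_image:
  assumes q: "primeideal q R" and le: "a \<subseteq> q"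
  shows "primeideal ((+>) a ` q) (R Quot a)"
proof -
  have I: "ideal q R" using q primeideal.axioms(1) by blast
  have Q: "ideal ((+>) a ` q) (R Quot a)" by (rule ring_ideal_imp_quot_ideal[OF a I])
  have iff: "a +> x \<in> (+>) a ` q \<longleftrightarrow> x \<in> q" if "x \<in> carrier R" for x
    using mem_Union[OF Q that] Union_image[OF I le] by blast
  show ?thesis
  proof (rule primeidealI[OF Q Q.cring_axioms])
    show "carrier (R Quot a) \<noteq> (+>) a ` q"
    proof
      assume "carrier (R Quot a) = (+>) a ` q"
      then have "x \<in> q" if "x \<in> carrier R" for x using iff[OF that] Quot_carrierI[OF that] by simp
      then show False using primeideal.I_notcarr[OF q] ideal_carrier[OF I] by blast
    qed
    fix X Y assume XY: "X \<in> carrier (R Quot a)" "Y \<in> carrier (R Quot a)" "X \<otimes>\<^bsub>R Quot a\<^esub> Y \<in> (+>) a ` q"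
    obtain x y where xy: "x \<in> carrier R" "X = a +> x" "y \<in> carrier R" "Y = a +> y"
      using XY Quot_carrierE by metis
    have "x \<otimes> y \<in> q" using XY(3) xy coset_mult iff by simp
    then show "X \<in> (+>) a ` q \<or> Y \<in> (+>) a ` q"
      using primeideal.I_prime[OF q xy(1,3)] xy by blast
  qed
qed

lemma prime_Union:
  assumes P: "primeideal P (R Quot a)"
  shows "primeideal (\<Union>P) R" "a \<subseteq> \<Union>P"
proof -
  have I: "ideal P (R Quot a)" using P primeideal.axioms(1) by blast
  have U: "ideal (\<Union>P) R" by (rule quot_ideal_imp_ring_ideal[OF a I])
  show "a \<subseteq> \<Union>P"
  proof
    fix x assume x: "x \<in> a"
    then have "a +> x = \<zero>\<^bsub>R Quot a\<^esub>" using a_rcos_zero[OF a] by (simp add: FactRing_def)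
    then show "x \<in> \<Union>P" using mem_Union[OF I ideal_carrier[OF a x]] Q.ideal_zero[OF I] by simp
  qed
  show "primeideal (\<Union>P) R"
  proof (rule primeidealI[OF U cring_axioms])
    show "carrier R \<noteq> \<Union>P"
    proof
      assume e: "carrier R = \<Union>P"
      have "carrier (R Quot a) \<subseteq> P"
      proof
        fix X assume "X \<in> carrier (R Quot a)"
        then obtain x where "x \<in> carrier R" "X = a +> x" by (rule Quot_carrierE)
        then show "X \<in> P" using mem_Union[OF I] e by blast
      qed
      then show False using primeideal.I_notcarr[OF P] Q.ideal_carrier[OF I] by blast
    qed
    fix x y assume xy: "x \<in> carrier R" "y \<in> carrier R" "x \<otimes> y \<in> \<Union>P"
    then have "(a +> x) \<otimes>\<^bsub>R Quot a\<^esub> (a +> y) \<in> P"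
      using mem_Union[OF I, of "x \<otimes> y"] coset_mult by simp
    then show "x \<in> \<Union>P \<or> y \<in> \<Union>P"
      using primeideal.I_prime[OF P Quot_carrierI Quot_carrierI] xy mem_Union[OF I] by blast
  qed
qed

lemma pchain_Quot:
  "(\<exists>P. pchain (R Quot a) P n) \<longleftrightarrow> (\<exists>q. a \<subseteq> q \<and> pchain R q n)"
proof
  have "pchain (R Quot a) P n \<Longrightarrow> pchain R (\<Union>P) n" for P
  proof (induction n arbitrary: P)
    case 0 then show ?case using prime_Union by simp
  next
    case (Suc n)
    then obtain P' where P': "primeideal P (R Quot a)" "P \<subset> P'" "pchain (R Quot a) P' n" by auto
    have I: "ideal P (R Quot a)" "ideal P' (R Quot a)"
      using P' pchain_prime primeideal.axioms(1) by blast+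
    obtain X where X: "X \<in> P'" "X \<notin> P" using P' by blast
    then obtain x where x: "x \<in> carrier R" "X = a +> x" using Q.ideal_carrier[OF I(2)] Quot_carrierE by metis
    have "x \<in> \<Union>P'" "x \<notin> \<Union>P" using mem_Union[OF I(1) x(1)] mem_Union[OF I(2) x(1)] X x(2) by auto
    then have "\<Union>P \<subset> \<Union>P'" using P'(2) by blast
    then show ?case using Suc.IH[OF P'(3)] prime_Union(1)[OF P'(1)] unfolding pchain.simps by (intro conjI exI)
  qed
  then show "\<exists>P. pchain (R Quot a) P n \<Longrightarrow> \<exists>q. a \<subseteq> q \<and> pchain R q n"
    using prime_Union(2) pchain_prime by blast
  have "pchain R q n \<Longrightarrow> a \<subseteq> q \<Longrightarrow> pchain (R Quot a) ((+>) a ` q) n" for q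
  proof (induction n arbitrary: q)
    case 0 then show ?case using prime_image by simp
  next
    case (Suc n)
    then obtain q' where q': "primeideal q R" "q \<subset> q'" "pchain R q' n" by auto
    have I: "ideal q R" "ideal q' R" using q' pchain_prime primeideal.axioms(1) by blast+
    have le: "a \<subseteq> q'" using q' Suc.prems by blast
    have "(+>) a ` q \<noteq> (+>) a ` q'"
    proof
      assume "(+>) a ` q = (+>) a ` q'"
      then have "\<Union>((+>) a ` q) = \<Union>((+>) a ` q')" by (rule arg_cong)
      then have "q = q'" unfolding Union_image[OF I(1) Suc.prems(2)] Union_image[OF I(2) le] .
      then show False using q'(2) by blast
    qed
    then have "(+>) a ` q \<subset> (+>) a ` q'" using q'(2) by blast
    then show ?case using Suc.IH[OF q'(3) le] prime_image[OF q'(1) Suc.prems(2)] unfolding pchain.simps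
      by (intro conjI exI)
  qed
  then show "\<exists>q. a \<subseteq> q \<and> pchain R q n \<Longrightarrow> \<exists>P. pchain (R Quot a) P n" by blast
qed

lemma krull_dim_Quot:
  "krull_dim (R Quot a) = (SUP n \<in> {n. \<exists>q. a \<subseteq> q \<and> pchain R q n}. ereal (real n))"
proof -
  have "{n. \<exists>P. (\<forall>i\<le>n. primeideal (P i) (R Quot a)) \<and> (\<forall>i<n. P i \<subset> P (Suc i))} =
    {n. \<exists>P. pchain (R Quot a) P n}"
    unfolding pchain_iff by blast
  then show ?thesis unfolding krull_dim_def pchain_Quot by simp
qed

end

section \<open>Chains of submodules of a quotient of two ideals\<close>

context
  fixes L K :: "'a set"
  assumes L: "ideal L R" and K: "ideal K R" and LK: "L \<subseteq> K"
begin

private abbreviation (input) "Qm \<equiv> ideal_quotient R K L"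

private lemma Qm_carrier: "carrier Qm = (+>) L ` K"
  unfolding ideal_quotient_def quot_module_def A_RCOSETS_def' a_r_coset_def'
  by auto

private lemma Qm_zero: "\<zero>\<^bsub>Qm\<^esub> = L"
  by (simp add: ideal_quotient_def quot_module_def)

private lemma Qm_add:
  "\<lbrakk>x \<in> carrier R; y \<in> carrier R\<rbrakk> \<Longrightarrow> (L +> x) \<oplus>\<^bsub>Qm\<^esub> (L +> y) = L +> (x \<oplus> y)"
  using ideal.a_rcos_sum[OF L] by (simp add: ideal_quotient_def quot_module_def set_add_def')

private lemma coset_eq: "\<lbrakk>x \<in> carrier R; y \<in> carrier R\<rbrakk> \<Longrightarrow> L +> x = L +> y \<longleftrightarrow> x \<ominus> y \<in> L"
  using quotient_eq_iff_same_a_r_cos[OF L] by blast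

private lemma coset_self: "x \<in> carrier R \<Longrightarrow> x \<in> L +> x"
  using ideal_zero[OF L] unfolding a_r_coset_def' by force

private lemma coset_sub:
  assumes "ideal C R" "L \<subseteq> C" "x \<in> C" shows "L +> x \<subseteq> C"
  using assms ideal_add[OF assms(1)] unfolding a_r_coset_def' by blast

private lemma coset_memD:
  assumes "x \<in> carrier R" "y \<in> L +> x" shows "y \<in> carrier R" "y \<ominus> x \<in> L" "L +> y = L +> x"
proof -
  obtain l where l: "l \<in> L" "y = l \<oplus> x" using assms unfolding a_r_coset_def' by blast
  have lR: "l \<in> carrier R" using l ideal_carrier[OF L] by blast
  show y: "y \<in> carrier R" using l lR assms by simp
  have "y \<ominus> x = l" using l lR assms by (simp add: a_minus_def a_assoc r_neg)
  then show "y \<ominus> x \<in> L" using l by simp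
  then show "L +> y = L +> x" using coset_eq y assms by blast
qed

text \<open>In \<open>quot_module\<close> a scalar acts by a union over all representatives; these
  yield one and the same coset, so the union collapses.\<close>

private lemma Qm_smult:
  assumes r: "r \<in> carrier R" and x: "x \<in> carrier R"
  shows "r \<odot>\<^bsub>Qm\<^esub> (L +> x) = L +> (r \<otimes> x)"
proof -
  have "r \<odot>\<^bsub>Qm\<^esub> (L +> x) = (\<Union>y\<in>L +> x. L +> (r \<otimes> y))"
    by (simp add: ideal_quotient_def quot_module_def a_r_coset_def')
  moreover have const: "L +> (r \<otimes> y) = L +> (r \<otimes> x)" if y: "y \<in> L +> x" for y
  proof -
    have yR: "y \<in> carrier R" "y \<ominus> x \<in> L" using coset_memD[OF x y] by auto
    have "r \<otimes> y \<ominus> r \<otimes> x = r \<otimes> (y \<ominus> x)" using r x yR by (simp add: a_minus_def r_distr r_minus)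
    then have "r \<otimes> y \<ominus> r \<otimes> x \<in> L" using ideal_mult[OF L r yR(2)] by simp
    then show ?thesis using coset_eq r x yR(1) by simp
  qed
  ultimately have "r \<odot>\<^bsub>Qm\<^esub> (L +> x) = (\<Union>y\<in>L +> x. L +> (r \<otimes> y))" by simp
  moreover have "(\<Union>y\<in>L +> x. L +> (r \<otimes> y)) = (\<Union>y\<in>L +> x. L +> (r \<otimes> x))"
    by (intro SUP_cong[OF HOL.refl] const)
  moreover have "(\<Union>y\<in>L +> x. L +> (r \<otimes> x)) = L +> (r \<otimes> x)" using coset_self[OF x] by blast
  ultimately show ?thesis by simp
qed

private lemma Qm_group: "group (add_monoid Qm)"
proof (rule groupI)
  have KR: "x \<in> K \<Longrightarrow> x \<in> carrier R" for x using ideal_carrier[OF K] .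
  have z: "L = L +> \<zero>" using a_rcos_zero[OF L ideal_zero[OF L]] by simp
  show "\<one>\<^bsub>add_monoid Qm\<^esub> \<in> carrier (add_monoid Qm)"
    using z ideal_zero[OF K] by (auto simp: Qm_zero Qm_carrier)
  fix X assume "X \<in> carrier (add_monoid Qm)"
  then obtain x where x: "x \<in> K" "X = L +> x" by (auto simp: Qm_carrier)
  have "L \<oplus>\<^bsub>Qm\<^esub> (L +> x) = L +> x"
    using Qm_add[OF zero_closed KR[OF x(1)]] z x KR by simp
  then show "\<one>\<^bsub>add_monoid Qm\<^esub> \<otimes>\<^bsub>add_monoid Qm\<^esub> X = X" using x by (simp add: Qm_zero)
  have "(L +> (\<ominus> x)) \<oplus>\<^bsub>Qm\<^esub> (L +> x) = L"
    using Qm_add[of "\<ominus> x" x] z x KR by (simp add: l_neg)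
  then show "\<exists>Y\<in>carrier (add_monoid Qm). Y \<otimes>\<^bsub>add_monoid Qm\<^esub> X = \<one>\<^bsub>add_monoid Qm\<^esub>"
    using x ideal_uminus[OF K x(1)] by (auto simp: Qm_zero Qm_carrier intro!: bexI[of _ "L +> (\<ominus> x)"])
  fix Y assume "Y \<in> carrier (add_monoid Qm)"
  then obtain y where y: "y \<in> K" "Y = L +> y" by (auto simp: Qm_carrier)
  show "X \<otimes>\<^bsub>add_monoid Qm\<^esub> Y \<in> carrier (add_monoid Qm)"
    using x y KR ideal_add[OF K] by (simp add: Qm_carrier Qm_add)
  fix Z assume "Z \<in> carrier (add_monoid Qm)"
  then obtain z where "z \<in> K" "Z = L +> z" by (auto simp: Qm_carrier)
  then show "X \<otimes>\<^bsub>add_monoid Qm\<^esub> Y \<otimes>\<^bsub>add_monoid Qm\<^esub> Z = X \<otimes>\<^bsub>add_monoid Qm\<^esub> (Y \<otimes>\<^bsub>add_monoid Qm\<^esub> Z)"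
    using x y KR by (simp add: Qm_add a_assoc)
qed

private lemma submodule_image:
  assumes C: "ideal C R" "L \<subseteq> C" "C \<subseteq> K"
  shows "submodule ((+>) L ` C) R Qm"
proof -
  have CR: "x \<in> C \<Longrightarrow> x \<in> carrier R" for x using ideal_carrier[OF C(1)] .
  have z: "L = L +> \<zero>" using a_rcos_zero[OF L ideal_zero[OF L]] by simp
  have "subgroup ((+>) L ` C) (add_monoid Qm)"
  proof (rule subgroup.intro)
    show "(+>) L ` C \<subseteq> carrier (add_monoid Qm)" using C by (auto simp: Qm_carrier)
    show "X \<otimes>\<^bsub>add_monoid Qm\<^esub> Y \<in> (+>) L ` C" if "X \<in> (+>) L ` C" "Y \<in> (+>) L ` C" for X Y
      using that CR ideal_add[OF C(1)] by (auto simp: Qm_add)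
    show "\<one>\<^bsub>add_monoid Qm\<^esub> \<in> (+>) L ` C" using z ideal_zero[OF C(1)] by (auto simp: Qm_zero)
    fix X assume "X \<in> (+>) L ` C"
    then obtain x where x: "x \<in> C" "X = L +> x" by blast
    have "(L +> (\<ominus> x)) \<oplus>\<^bsub>Qm\<^esub> X = L"
      using Qm_add[of "\<ominus> x" x] z x CR by (simp add: l_neg)
    then have "inv\<^bsub>add_monoid Qm\<^esub> X = L +> (\<ominus> x)"
      using x C(3) ideal_uminus[OF C(1) x(1)]
      by (intro group.inv_equality[OF Qm_group]) (auto simp: Qm_zero Qm_carrier)
    then show "inv\<^bsub>add_monoid Qm\<^esub> X \<in> (+>) L ` C" using ideal_uminus[OF C(1) x(1)] by auto
  qed
  moreover have "r \<odot>\<^bsub>Qm\<^esub> X \<in> (+>) L ` C" if "r \<in> carrier R" "X \<in> (+>) L ` C" for r X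
    using that CR ideal_mult[OF C(1)] by (auto simp: Qm_smult)
  ultimately show ?thesis by (simp add: submodule_def submodule_axioms_def)
qed

private lemma Union_coset:
  assumes "ideal C R" "L \<subseteq> C" shows "\<Union>((+>) L ` C) = C"
  using coset_sub[OF assms] coset_self ideal_carrier[OF assms(1)] by blast

private lemma submodule_Union:
  assumes S: "submodule S R Qm"
  shows "ideal (\<Union>S) R" "L \<subseteq> \<Union>S" "\<Union>S \<subseteq> K" "(+>) L ` \<Union>S = S"
proof -
  have sg: "subgroup S (add_monoid Qm)" using S by (simp add: submodule_def)
  have sub: "S \<subseteq> (+>) L ` K" using subgroup.subset[OF sg] by (simp add: Qm_carrier)
  have KR: "x \<in> K \<Longrightarrow> x \<in> carrier R" for x using ideal_carrier[OF K] .
  have zero: "L \<in> S" using subgroup.one_closed[OF sg] by (simp add: Qm_zero)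
  have add: "X \<oplus>\<^bsub>Qm\<^esub> Y \<in> S" if "X \<in> S" "Y \<in> S" for X Y
    using subgroup.m_closed[OF sg that] by simp
  have smult: "r \<odot>\<^bsub>Qm\<^esub> X \<in> S" if "r \<in> carrier R" "X \<in> S" for r X
    using submodule.smult_closed[OF S that] .
  show UK: "\<Union>S \<subseteq> K" using sub coset_sub[OF K LK] by blast
  show "L \<subseteq> \<Union>S" using zero by blast
  have mem: "x \<in> \<Union>S \<longleftrightarrow> x \<in> carrier R \<and> L +> x \<in> S" for x
  proof
    assume "x \<in> \<Union>S"
    then obtain X where X: "X \<in> S" "x \<in> X" by blast
    then obtain y where "y \<in> K" "X = L +> y" using sub by blast
    then show "x \<in> carrier R \<and> L +> x \<in> S" using X coset_memD[of y x] KR by auto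
  qed (use coset_self in blast)
  show "(+>) L ` \<Union>S = S"
  proof
    show "(+>) L ` \<Union>S \<subseteq> S" using mem by blast
    show "S \<subseteq> (+>) L ` \<Union>S"
    proof
      fix X assume X: "X \<in> S"
      then obtain y where "y \<in> K" "X = L +> y" using sub by blast
      then show "X \<in> (+>) L ` \<Union>S" using X mem[of y] KR by blast
    qed
  qed
  show "ideal (\<Union>S) R"
  proof (rule ideal_commI)
    show "\<Union>S \<subseteq> carrier R" using mem by blast
    show "\<zero> \<in> \<Union>S" using zero ideal_zero[OF L] by blast
    show "x \<oplus> y \<in> \<Union>S" if "x \<in> \<Union>S" "y \<in> \<Union>S" for x y
      using that add[of "L +> x" "L +> y"] Qm_add[of x y] unfolding mem by simp
    show "r \<otimes> x \<in> \<Union>S" if "r \<in> carrier R" "x \<in> \<Union>S" for r x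
      using that smult[of r "L +> x"] Qm_smult[of r x] unfolding mem by simp
  qed
qed

definition ideal_chain :: "nat \<Rightarrow> (nat \<Rightarrow> 'a set) \<Rightarrow> bool" where
  "ideal_chain n C \<longleftrightarrow> (\<forall>i\<le>n. ideal (C i) R) \<and> (\<forall>i<n. C i \<subset> C (Suc i)) \<and> C 0 = L \<and> C n = K"

private lemma ideal_chain_mono:
  assumes "ideal_chain n C" "i \<le> j" "j \<le> n" shows "C i \<subseteq> C j"
  using assms(2,3)
proof (induction j rule: dec_induct)
  case (step j)
  then have "C j \<subset> C (Suc j)" using assms(1) unfolding ideal_chain_def by simp
  then show ?case using step by simp
qed simp

text \<open>Correspondence theorem: taking unions of cosets and taking images under the coset map
  are inverse to each other and preserve strict inclusions.\<close>

lemma module_length_ideal_quotient: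
  "module_length R Qm = (SUP n \<in> {n. \<exists>C. ideal_chain n C}. enat n)"
proof -
  have "(\<exists>N. (\<forall>i\<le>n. submodule (N i) R Qm) \<and> (\<forall>i<n. N i \<subset> N (Suc i)) \<and>
      N 0 = {\<zero>\<^bsub>Qm\<^esub>} \<and> N n = carrier Qm) \<longleftrightarrow> (\<exists>C. ideal_chain n C)" for n
  proof
    assume "\<exists>N. (\<forall>i\<le>n. submodule (N i) R Qm) \<and> (\<forall>i<n. N i \<subset> N (Suc i)) \<and>
      N 0 = {\<zero>\<^bsub>Qm\<^esub>} \<and> N n = carrier Qm"
    then obtain N where N: "\<And>i. i \<le> n \<Longrightarrow> submodule (N i) R Qm" "\<And>i. i < n \<Longrightarrow> N i \<subset> N (Suc i)"
      "N 0 = {L}" "N n = (+>) L ` K" by (auto simp: Qm_zero Qm_carrier)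
    have "ideal_chain n (\<lambda>i. \<Union>(N i))"
      unfolding ideal_chain_def
    proof (intro conjI allI impI)
      show "ideal (\<Union>(N i)) R" if "i \<le> n" for i by (rule submodule_Union(1)[OF N(1)[OF that]])
      show "\<Union>(N i) \<subset> \<Union>(N (Suc i))" if i: "i < n" for i
      proof -
        have "\<Union>(N i) \<noteq> \<Union>(N (Suc i))"
        proof
          assume "\<Union>(N i) = \<Union>(N (Suc i))"
          then have "(+>) L ` \<Union>(N i) = (+>) L ` \<Union>(N (Suc i))" by (rule arg_cong)
          then have "N i = N (Suc i)"
            using submodule_Union(4)[OF N(1)[of i]] submodule_Union(4)[OF N(1)[of "Suc i"]] i by simp
          then show False using N(2)[OF i] by blast
        qed
        then show ?thesis using N(2)[OF i] by blast
      qed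
      show "\<Union>(N 0) = L" using N(3) by simp
      show "\<Union>(N n) = K" using N(4) Union_coset[OF K LK] by simp
    qed
    then show "\<exists>C. ideal_chain n C" by blast
  next
    assume "\<exists>C. ideal_chain n C"
    then obtain C where C: "ideal_chain n C" by blast
    have Ci: "ideal (C i) R" "L \<subseteq> C i" "C i \<subseteq> K" if "i \<le> n" for i
      using C ideal_chain_mono[OF C, of 0 i] ideal_chain_mono[OF C, of i n] that by (auto simp: ideal_chain_def)
    show "\<exists>N. (\<forall>i\<le>n. submodule (N i) R Qm) \<and> (\<forall>i<n. N i \<subset> N (Suc i)) \<and>
      N 0 = {\<zero>\<^bsub>Qm\<^esub>} \<and> N n = carrier Qm"
    proof (intro exI[of _ "\<lambda>i. (+>) L ` C i"] conjI allI impI)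
      show "submodule ((+>) L ` C i) R Qm" if "i \<le> n" for i using submodule_image Ci that by blast
      show "(+>) L ` C i \<subset> (+>) L ` C (Suc i)" if i: "i < n" for i
      proof -
        have s: "C i \<subset> C (Suc i)" using C i unfolding ideal_chain_def by blast
        have "(+>) L ` C i \<noteq> (+>) L ` C (Suc i)"
        proof
          assume "(+>) L ` C i = (+>) L ` C (Suc i)"
          then have "\<Union>((+>) L ` C i) = \<Union>((+>) L ` C (Suc i))" by (rule arg_cong)
          then have "C i = C (Suc i)" using i by (simp add: Union_coset Ci)
          then show False using s by blast
        qed
        moreover have "(+>) L ` C i \<subseteq> (+>) L ` C (Suc i)" using s by (intro image_mono) blast
        ultimately show ?thesis by blast
      qed
      have "C 0 = L" "C n = K" using C unfolding ideal_chain_def by auto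
      then show "(+>) L ` C n = carrier Qm" by (simp add: Qm_carrier)
      have "(+>) L ` L = {L}" using a_rcos_zero[OF L] ideal_zero[OF L] by auto
      then show "(+>) L ` C 0 = {\<zero>\<^bsub>Qm\<^esub>}" using \<open>C 0 = L\<close> by (simp add: Qm_zero)
    qed
  qed
  then show ?thesis unfolding module_length_def by simp
qed

end

end

context noeth_local
begin

lemma module_length_eq_len:
  assumes "L.has_len L K k"
  shows "module_length R (ideal_quotient R K L) = enat k"
proof -
  have LK: "ideal L R" "ideal K R" "L \<subseteq> K" using L.has_len_sub[OF assms] by (auto simp: sub_iff_ideal)
  have le: "n \<le> k" if "ideal_chain L K n C" for n C
    using L.chain_le_has_len[OF assms, of n C] that by (simp add: ideal_chain_def[OF LK] sub_iff_ideal)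
  obtain C where "ideal_chain L K k C"
    using L.has_len_chain[OF assms] by (auto simp: ideal_chain_def[OF LK] sub_iff_ideal)
  then show ?thesis unfolding module_length_ideal_quotient[OF LK]
    using le by (intro antisym SUP_least SUP_upper) auto
qed

text \<open>If \<open>a^N x\<close> is outside \<open>L\<close>, the submodules
  \<open>L + R a^i x\<close> for \<open>i \<le> N\<close> decrease strictly, by an argument of
  Nakayama type, and with \<open>L\<close> below them they form a chain too long for length
  \<open>N\<close>. The exponent is the length itself, so it serves all \<open>a\<close> at
  once.\<close>

lemma finite_length_nilpotent:
  assumes L: "ideal L R" and K: "ideal K R" and LK: "L \<subseteq> K"
    and fin: "module_length R (ideal_quotient R K L) < \<infinity>"
  shows "\<exists>c::nat. \<forall>a\<in>\<mm>. \<forall>x\<in>K. a [^] c \<otimes> x \<in> L"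
proof -
  obtain N where "module_length R (ideal_quotient R K L) = enat N"
    using fin by (cases "module_length R (ideal_quotient R K L)") auto
  then have N: "n \<le> N" if "ideal_chain L K n C" for n C
    using that SUP_upper[of n "{n. \<exists>C. ideal_chain L K n C}" enat]
    unfolding module_length_ideal_quotient[OF L K LK] by auto
  have "a [^] N \<otimes> x \<in> L" if a: "a \<in> \<mm>" and x: "x \<in> K" for a x
  proof (rule ccontr)
    assume not: "a [^] N \<otimes> x \<notin> L"
    have R: "a \<in> carrier R" "x \<in> carrier R" using a x m_carrier ideal_carrier[OF K] by auto
    define y where "y = (\<lambda>i::nat. a [^] i \<otimes> x)"
    have yR: "y i \<in> carrier R" for i using R by (simp add: y_def)
    have yK: "y i \<in> K" for i using ideal_mult[OF K] R x by (simp add: y_def)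
    have yS: "y (Suc i) = a \<otimes> y i" for i using R by (simp add: y_def m_ac)
    have yL: "y i \<notin> L" if "i \<le> N" for i
    proof
      assume "y i \<in> L"
      then have "a [^] (N - i) \<otimes> y i \<in> L" using ideal_mult[OF L] R by simp
      moreover have "a [^] (N - i) \<otimes> y i = a [^] N \<otimes> x"
        using R that by (simp add: y_def m_assoc[symmetric] nat_pow_mult)
      ultimately show False using not by simp
    qed
    have sL: "L.sub L" and sK: "L.sub K" using L K by (simp_all add: sub_iff_ideal)
    define X where "X = (\<lambda>i. L.cyc_ext L (y i))"
    have X1: "L.sub (X i)" "y i \<in> X i" "L \<subseteq> X i" "X i \<subseteq> K" for i
      unfolding X_def using L.sub_cyc_ext[OF sL] L.cyc_ext_mem[OF sL] L.cyc_ext_superset[OF sL]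
        L.cyc_ext_least[OF sK LK] yR yK by auto
    have X2: "X (Suc i) \<subset> X i" if i: "i \<le> N" for i
    proof
      have "y (Suc i) \<in> X i" unfolding yS using L.sub_smult[OF X1(1), of a "y i" i] R X1(2) by simp
      then show "X (Suc i) \<subseteq> X i"
        unfolding X_def using L.cyc_ext_least X1 X_def by metis
      show "X (Suc i) \<noteq> X i"
      proof
        assume "X (Suc i) = X i"
        then have "y i \<in> L.cyc_ext L (y (Suc i))" using X1(2) unfolding X_def by blast
        then obtain l r where lr: "l \<in> L" "r \<in> carrier R" "y i = l \<oplus> r \<otimes> y (Suc i)"
          by (auto elim!: L.cyc_extE)
        have lR: "l \<in> carrier R" using lr ideal_carrier[OF L] by blast
        \<comment> \<open>Equality of consecutive submodules gives
          \<open>(1 - r a) a^i x \<in> L\<close>; as \<open>r a\<close> is in \<open>\<mm>\<close>,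
          the factor is a unit and \<open>a^i x\<close> would lie in \<open>L\<close>.\<close>
        define b where "b = \<one> \<ominus> r \<otimes> a"
        have bR: "b \<in> carrier R" using lr R by (simp add: b_def)
        have ram: "r \<otimes> a \<in> \<mm>" using ideal_mult[OF m_ideal lr(2) a] .
        have "b \<notin> \<mm>"
        proof
          assume "b \<in> \<mm>"
          then have "b \<oplus> r \<otimes> a \<in> \<mm>" using ideal_add[OF m_ideal _ ram] by blast
          moreover have "b \<oplus> r \<otimes> a = \<one>" using lr R by (simp add: b_def a_minus_def a_assoc l_neg)
          ultimately show False using one_notin_m by simp
        qed
        then have u: "b \<in> Units R" using nonunit bR by blast
        have "b \<otimes> y i = y i \<ominus> r \<otimes> y (Suc i)"
          using lr R yR unfolding b_def yS by (simp add: a_minus_def l_distr l_minus m_assoc)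
        also have "\<dots> = l"
        proof -
          have "r \<otimes> y (Suc i) \<in> carrier R" using lr yR by simp
          then show ?thesis using lr(3) lR by (metis a_assoc a_minus_def a_inv_closed r_neg r_zero)
        qed
        finally have "inv b \<otimes> (b \<otimes> y i) \<in> L" using ideal_mult[OF L] u lr by simp
        moreover have "inv b \<otimes> (b \<otimes> y i) = y i" using u bR yR by (simp add: m_assoc[symmetric])
        ultimately show False using yL[OF i] by simp
      qed
    qed
    have X3: "L \<subset> X N" using X1(2,3)[of N] yL[of N] by auto
    \<comment> \<open>The decreasing sequence is reversed: \<open>L\<close>, then \<open>X N\<close>
      up to \<open>X 0\<close>, which makes \<open>N + 1\<close> inclusions. \<open>K\<close> is a
      further term only when \<open>X 0\<close> differs from it.\<close>
    define C where "C = (\<lambda>i. if i = 0 then L else if i \<le> Suc N then X (Suc N - i) else K)"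
    have C_id: "ideal (C i) R" for i using X1(1) L K by (simp add: C_def sub_iff_ideal)
    have C_lt: "C i \<subset> C (Suc i)" if "i < Suc N" for i
    proof (cases i)
      case 0 then show ?thesis using X3 by (simp add: C_def)
    next
      case (Suc j)
      then have "Suc N - i = Suc (Suc N - Suc i)" using that by simp
      then show ?thesis using X2[of "Suc N - Suc i"] that Suc by (simp add: C_def)
    qed
    show False
    proof (cases "X 0 = K")
      case True
      then have "ideal_chain L K (Suc N) C"
        unfolding ideal_chain_def[OF L K LK] using C_id C_lt by (auto simp: C_def)
      then show False using N by fastforce
    next
      case False
      have "C i \<subset> C (Suc i)" if "i < Suc (Suc N)" for i
      proof (cases "i < Suc N")
        case True then show ?thesis using C_lt by simp
      next
        case False
        then have "i = Suc N" using that by simp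
        then show ?thesis using \<open>X 0 \<noteq> K\<close> X1(4)[of 0] by (auto simp: C_def)
      qed
      then have "ideal_chain L K (Suc (Suc N)) C"
        unfolding ideal_chain_def[OF L K LK] using C_id by (auto simp: C_def)
      then show False using N by fastforce
    qed
  qed
  then show ?thesis by blast
qed

end

section \<open>The quotient of two Rees algebras\<close>

context cring
begin

lemma mult_mon_apply:
  assumes p: "p \<in> carrier (UP R)" and y: "y \<in> carrier R"
  shows "(p \<otimes>\<^bsub>UP R\<^esub> mon y s) (n + s) = p n \<otimes> y"
proof -
  have pR: "p i \<in> carrier R" for i using UP_apply_closed[OF p] .
  have "(\<Oplus>i\<in>{..n + s}. p i \<otimes> mon y s (n + s - i)) = (\<Oplus>i\<in>{..n + s}. if n = i then p i \<otimes> y else \<zero>)"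
    by (rule finsum_cong') (use pR y in \<open>auto simp: mon_apply\<close>)
  also have "\<dots> = p n \<otimes> y"
    by (rule add.finprod_singleton) (use pR y in auto)
  finally show ?thesis using UP_apply_mult[OF p mon_closed[OF y]] by simp
qed

end

context noeth_local_ideal
begin

context
  fixes I :: "'a set"
  assumes I: "ideal I R" and JI: "J \<subseteq> I" and red: "is_reduction R J I"
begin

private abbreviation "Ip \<equiv> ideal_pow R I"
private abbreviation "B \<equiv> carrier (rees_algebra R I)"
private abbreviation "M \<equiv> rees_quotient R I J"

private lemma Ip_ideal: "ideal (Ip n) R" by (rule pow_ideal[OF I])
private lemma Ip_carrier: "x \<in> Ip n \<Longrightarrow> x \<in> carrier R" using ideal_carrier[OF Ip_ideal] .
private lemma Jp_Ip: "Jp n \<subseteq> Ip n" by (rule pow_subset[OF J I JI])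
private lemma Ip_gsub: "gsub J Ip" using gsub_subset[OF gsub_pow[OF I] JI] .

private lemma reduction:
  obtains r where "\<And>n. n \<ge> r \<Longrightarrow> Ip (Suc n) = ideal_prod R J (Ip n)" "noeth_seq J Ip"
proof -
  obtain r where r: "ideal_prod R J (Ip r) = Ip (Suc r)" using red unfolding is_reduction_def by auto
  show ?thesis using that[of r] reduction_pow[OF J I r] noeth_seq_reduction_pow[OF J I r] by blast
qed

text \<open>Exponents add up under products, so every single degree has one. Beyond \<open>r\<close>
  no growth occurs, because \<open>I^(n+1) = J I^n\<close> and multiplication by \<open>J\<close>
  already raises the power of \<open>J\<close> by one.\<close>

private lemma nilp_pow:
  assumes "\<exists>c::nat. \<forall>a\<in>\<mm>. \<forall>x\<in>I. a [^] c \<otimes> x \<in> J"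
  shows "nilp Jp Ip"
  unfolding nilp_def
proof
  fix a assume "a \<in> \<mm>"
  obtain c0 :: nat where c0: "\<And>x. x \<in> I \<Longrightarrow> a [^] c0 \<otimes> x \<in> J" using assms \<open>a \<in> \<mm>\<close> by blast
  have aR: "a \<in> carrier R" using \<open>a \<in> \<mm>\<close> m_carrier by blast
  have colon: "ideal {x \<in> carrier R. a [^] (c::nat) \<otimes> x \<in> Jp n} R" for c n
    by (rule ideal.helper_max_prime[OF Jp_ideal cring_axioms]) (use aR in simp)
  have up: "a [^] d \<otimes> x \<in> Jp n" if "a [^] c \<otimes> x \<in> Jp n" "c \<le> d" "x \<in> carrier R" for c d n :: nat and x
  proof -
    have "a [^] (d - c) \<otimes> (a [^] c \<otimes> x) \<in> Jp n" using ideal_mult[OF Jp_ideal] that aR by simp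
    then show ?thesis using that aR by (simp add: m_assoc[symmetric] nat_pow_mult)
  qed
  have "\<exists>c::nat. \<forall>x\<in>Ip n. a [^] c \<otimes> x \<in> Jp n" for n
  proof (induction n)
    case 0
    then show ?case using aR by (intro exI[of _ 0]) (simp add: pow_0)
  next
    case (Suc n)
    then obtain c :: nat where c: "\<And>x. x \<in> Ip n \<Longrightarrow> a [^] c \<otimes> x \<in> Jp n" by blast
    have "Ip (Suc n) \<subseteq> {x \<in> carrier R. a [^] (c + c0) \<otimes> x \<in> Jp (Suc n)}"
      unfolding pow_Suc[of I]
    proof (rule ideal_prod_least[OF colon])
      fix x y assume xy: "x \<in> Ip n" "y \<in> I"
      have R: "x \<in> carrier R" "y \<in> carrier R" using xy Ip_carrier ideal_carrier[OF I] by auto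
      have 1: "a [^] c0 \<otimes> y \<in> Jp (Suc 0)" using c0[OF xy(2)] pow_1[OF J] by simp
      have "(a [^] c \<otimes> x) \<otimes> (a [^] c0 \<otimes> y) \<in> Jp (n + Suc 0)"
        by (rule pow_mult[OF J c[OF xy(1)] 1])
      moreover have "(a [^] c \<otimes> x) \<otimes> (a [^] c0 \<otimes> y) = a [^] (c + c0) \<otimes> (x \<otimes> y)"
        using R aR by (simp add: nat_pow_mult[symmetric] m_ac)
      ultimately have "a [^] (c + c0) \<otimes> (x \<otimes> y) \<in> Jp (Suc n)" by (simp only: add_Suc_right add_0_right)
      then show "x \<otimes> y \<in> {x \<in> carrier R. a [^] (c + c0) \<otimes> x \<in> Jp (Suc n)}" using R by blast
    qed
    then show ?case by blast
  qed
  then obtain c where c: "\<And>n x. x \<in> Ip n \<Longrightarrow> a [^] (c n :: nat) \<otimes> x \<in> Jp n" by metis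
  obtain r where r: "\<And>n. n \<ge> r \<Longrightarrow> Ip (Suc n) = ideal_prod R J (Ip n)" using reduction by blast
  \<comment> \<open>Any common bound of the exponents \<open>c 0, \<dots>, c r\<close> would do; the
    sum is one.\<close>
  define d where "d = (\<Sum>s\<le>r. c s)"
  have low: "a [^] d \<otimes> x \<in> Jp n" if "n \<le> r" "x \<in> Ip n" for n x
  proof (rule up[OF c[OF that(2)]])
    show "c n \<le> d" unfolding d_def by (rule member_le_sum) (use that in auto)
    show "x \<in> carrier R" using Ip_carrier[OF that(2)] .
  qed
  have high: "Ip n \<subseteq> {x \<in> carrier R. a [^] d \<otimes> x \<in> Jp n}" if "n \<ge> r" for n
    using that
  proof (induction n rule: dec_induct)
    case base then show ?case using low Ip_carrier by blast
  next
    case (step n)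
    show ?case unfolding r[OF step(1)]
    proof (rule ideal_prod_least[OF colon])
      fix g x assume gx: "g \<in> J" "x \<in> Ip n"
      have R: "g \<in> carrier R" "x \<in> carrier R" using gx Ip_carrier J_carrier by auto
      have "g \<otimes> (a [^] d \<otimes> x) \<in> Jp (Suc n)" using gsub_mult[OF Jp_gsub gx(1)] step.IH gx(2) by blast
      then have "a [^] d \<otimes> (g \<otimes> x) \<in> Jp (Suc n)" using R aR by (simp only: m_lcomm nat_pow_closed)
      then show "g \<otimes> x \<in> {x \<in> carrier R. a [^] d \<otimes> x \<in> Jp (Suc n)}" using R by blast
    qed
  qed
  have "a [^] d \<otimes> x \<in> Jp n" if "x \<in> Ip n" for n x
    using low[OF _ that] high[of n] that by (cases "n \<le> r") auto
  then show "\<exists>c::nat. \<forall>n. \<forall>x\<in>Ip n. a [^] c \<otimes> x \<in> Jp n" by blast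
qed

private lemma B_UP: "x \<in> B \<Longrightarrow> x \<in> carrier (UP R)" by (simp add: rees_mem)

private abbreviation cs :: "(nat \<Rightarrow> 'a) \<Rightarrow> (nat \<Rightarrow> 'a) set" where
  "cs x \<equiv> {a \<oplus>\<^bsub>UP R\<^esub> x | a. a \<in> carrier A}"

private lemma M_carrier: "carrier M = cs ` B"
  unfolding rees_quotient_def quot_module_def A_RCOSETS_def' a_r_coset_def' A_def[symmetric] by auto

private lemma M_zero: "\<zero>\<^bsub>M\<^esub> = carrier A"
  by (simp add: rees_quotient_def quot_module_def A_def)

private lemma M_smult: "r \<odot>\<^bsub>M\<^esub> X = (\<Union>x\<in>X. cs (r \<otimes>\<^bsub>UP R\<^esub> x))"
  unfolding rees_quotient_def quot_module_def a_r_coset_def' A_def[symmetric] by auto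

private lemma cs_self: "x \<in> carrier (UP R) \<Longrightarrow> x \<in> cs x"
  using A.zero_closed V.M.l_zero[of x] by (metis (mono_tags, lifting) A_simps(3) mem_Collect_eq)

private lemma cs_A: "x \<in> carrier A \<Longrightarrow> cs x = carrier A"
proof
  assume x: "x \<in> carrier A"
  show "cs x \<subseteq> carrier A" using A.a_closed[OF _ x] by auto
  show "carrier A \<subseteq> cs x"
  proof
    fix y assume y: "y \<in> carrier A"
    have "y = (y \<ominus>\<^bsub>A\<^esub> x) \<oplus>\<^bsub>A\<^esub> x"
      using x y by (simp only: a_minus_def A.a_assoc A.l_neg A.r_zero A.a_inv_closed)
    then show "y \<in> cs x" using A.minus_closed[OF y x] by auto
  qed
qed

text \<open>Two representatives of a coset differ by an element of \<open>A\<close>, and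
  \<open>r\<close> keeps such a difference in \<open>A\<close>.\<close>

private lemma M_smult_zero_iff:
  assumes r: "r \<in> carrier A" and x: "x \<in> B"
  shows "r \<odot>\<^bsub>M\<^esub> cs x = \<zero>\<^bsub>M\<^esub> \<longleftrightarrow> r \<otimes>\<^bsub>UP R\<^esub> x \<in> carrier A"
proof
  have xU: "x \<in> carrier (UP R)" and rU: "r \<in> carrier (UP R)" using x r B_UP A_UP by auto
  assume "r \<odot>\<^bsub>M\<^esub> cs x = \<zero>\<^bsub>M\<^esub>"
  then have "cs (r \<otimes>\<^bsub>UP R\<^esub> x) \<subseteq> carrier A"
    unfolding M_smult M_zero using cs_self[OF xU] by blast
  moreover have "r \<otimes>\<^bsub>UP R\<^esub> x \<in> carrier (UP R)"
    using monoid.m_closed[OF ring.axioms(2)[OF cring.axioms(1)[OF UP_is_cring]] rU xU] .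
  ultimately show "r \<otimes>\<^bsub>UP R\<^esub> x \<in> carrier A" using cs_self by blast
next
  have xU: "x \<in> carrier (UP R)" and rU: "r \<in> carrier (UP R)" using x r B_UP A_UP by auto
  assume rx: "r \<otimes>\<^bsub>UP R\<^esub> x \<in> carrier A"
  have "cs (r \<otimes>\<^bsub>UP R\<^esub> y) = carrier A" if "y \<in> cs x" for y
  proof (rule cs_A)
    obtain a where a: "a \<in> carrier A" "y = a \<oplus>\<^bsub>UP R\<^esub> x" using \<open>y \<in> cs x\<close> by blast
    have "r \<otimes>\<^bsub>UP R\<^esub> y = r \<otimes>\<^bsub>A\<^esub> a \<oplus>\<^bsub>A\<^esub> r \<otimes>\<^bsub>UP R\<^esub> x"
      using ring.ring_simprules(23)[OF cring.axioms(1)[OF UP_is_cring] A_UP[OF a(1)] xU rU] a(2) by simp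
    then show "r \<otimes>\<^bsub>UP R\<^esub> y \<in> carrier A"
      using A.a_closed[OF A.m_closed[OF r a(1)] rx] by simp
  qed
  then show "r \<odot>\<^bsub>M\<^esub> cs x = \<zero>\<^bsub>M\<^esub>"
    unfolding M_smult M_zero using cs_self[OF xU] by blast
qed

text \<open>\<R>(I) is spanned by monomials, and the product of \<open>r\<close> with
  \<open>y t^s\<close> has the coefficient \<open>r n \<otimes> y\<close> in degree
  \<open>n + s\<close>. So an annihilating \<open>r\<close> does so coefficient by coefficient, and
  the annihilator is homogeneous.\<close>

private lemma annihilator_eq: "annihilator (rees_algebra R J) M = hat (ann Jp Ip)"
proof -
  have eq: "(\<forall>x\<in>B. r \<otimes>\<^bsub>UP R\<^esub> x \<in> carrier A) \<longleftrightarrow> (\<forall>n. r n \<in> ann Jp Ip n)" if r: "r \<in> carrier A" for r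
  proof
    assume *: "\<forall>x\<in>B. r \<otimes>\<^bsub>UP R\<^esub> x \<in> carrier A"
    show "\<forall>n. r n \<in> ann Jp Ip n"
      unfolding ann_def
    proof (intro allI CollectI conjI ballI)
      fix n
      show "r n \<in> Jp n" using A_Jp[OF r] .
      fix s y assume y: "y \<in> Ip s"
      have "r \<otimes>\<^bsub>UP R\<^esub> mon y s \<in> carrier A" using * rees_mon_mem[OF I y] by blast
      then have "(r \<otimes>\<^bsub>UP R\<^esub> mon y s) (n + s) \<in> Jp (n + s)" by (rule A_Jp)
      then show "r n \<otimes> y \<in> Jp (n + s)" using mult_mon_apply[OF A_UP[OF r] Ip_carrier[OF y]] by simp
    qed
  next
    assume *: "\<forall>n. r n \<in> ann Jp Ip n"
    show "\<forall>x\<in>B. r \<otimes>\<^bsub>UP R\<^esub> x \<in> carrier A"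
    proof
      fix x assume x: "x \<in> B"
      have rU: "r \<in> carrier (UP R)" and xU: "x \<in> carrier (UP R)" using r x A_UP B_UP by auto
      have "(r \<otimes>\<^bsub>UP R\<^esub> x) n \<in> Jp n" for n
        unfolding UP_apply_mult[OF rU xU]
      proof (rule ideal_finsum[OF Jp_ideal])
        fix i assume i: "i \<in> {..n}"
        have "x (n - i) \<in> Ip (n - i)" using x by (simp add: rees_mem)
        then have "r i \<otimes> x (n - i) \<in> Jp (i + (n - i))" using * by (simp add: ann_def)
        then show "r i \<otimes> x (n - i) \<in> Jp n" using i by simp
      qed simp
      moreover have "r \<otimes>\<^bsub>UP R\<^esub> x \<in> carrier (UP R)"
        using monoid.m_closed[OF ring.axioms(2)[OF cring.axioms(1)[OF UP_is_cring]] rU xU] .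
      ultimately show "r \<otimes>\<^bsub>UP R\<^esub> x \<in> carrier A" by (simp add: A_mem)
    qed
  qed
  have "(\<forall>X\<in>cs ` B. r \<odot>\<^bsub>M\<^esub> X = \<zero>\<^bsub>M\<^esub>) \<longleftrightarrow> (\<forall>n. r n \<in> ann Jp Ip n)" if r: "r \<in> carrier A" for r
    unfolding eq[OF r, symmetric] ball_simps using M_smult_zero_iff[OF r] by (intro ball_cong HOL.refl)
  then show ?thesis
    unfolding annihilator_def hat_def M_carrier A_def[symmetric] by (intro Collect_cong conj_cong HOL.refl)
qed

private lemma M_trivial_iff: "carrier M = {\<zero>\<^bsub>M\<^esub>} \<longleftrightarrow> Ip = Jp"
proof
  assume *: "carrier M = {\<zero>\<^bsub>M\<^esub>}"
  have "Ip n \<subseteq> Jp n" for n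
  proof
    fix y assume y: "y \<in> Ip n"
    have "cs (mon y n) \<in> carrier M" unfolding M_carrier using rees_mon_mem[OF I y] by blast
    then have "cs (mon y n) = carrier A" using * M_zero by simp
    moreover have "mon y n \<in> cs (mon y n)" by (rule cs_self[OF mon_closed[OF Ip_carrier[OF y]]])
    ultimately have "mon y n \<in> carrier A" by (rule back_subst[of "\<lambda>X. mon y n \<in> X", rotated])
    then have "mon y n n \<in> Jp n" by (rule A_Jp)
    then show "y \<in> Jp n" using Ip_carrier[OF y] by (simp add: mon_apply)
  qed
  then show "Ip = Jp" using Jp_Ip by blast
next
  assume *: "Ip = Jp"
  then have "B = carrier A" by (auto simp: A_mem rees_mem)
  moreover have "carrier A \<noteq> {}" using A.zero_closed by blast
  ultimately show "carrier M = {\<zero>\<^bsub>M\<^esub>}" unfolding M_carrier M_zero using cs_A by auto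
qed

private lemmas gsub_ann_pow = gsub_ann[OF Jp_gsub Ip_gsub]

text \<open>By the uniform exponent some power of each \<open>a\<close> in \<open>\<mm>\<close>
  annihilates \<open>M\<close> as a constant, hence lies in \<open>q\<close>; primeness gives
  \<open>a\<close>.\<close>

private lemma over_m_ann:
  assumes nil: "nilp Jp Ip" and q: "primeideal q A" "hat (ann Jp Ip) \<subseteq> q"
  shows "over_m q" "ann Jp Ip \<le> hpart q"
proof -
  have I': "ideal q A" using q(1) primeideal.axioms(1) by blast
  show "ann Jp Ip \<le> hpart q"
    unfolding le_fun_def
  proof (intro allI subsetI)
    fix n a assume a: "a \<in> ann Jp Ip n"
    then have aJ: "a \<in> Jp n" by (simp add: ann_def)
    have "mon a n \<in> hat (ann Jp Ip)" by (rule hat_mon[OF a aJ gsub_ann_pow])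
    then show "a \<in> hpart q n" using q(2) aJ by (auto simp: hpart_def)
  qed
  have "mon a 0 \<in> q" if a: "a \<in> \<mm>" for a
  proof -
    have aR: "a \<in> carrier R" using a m_carrier by blast
    obtain c :: nat where c: "\<And>n x. x \<in> Ip n \<Longrightarrow> a [^] c \<otimes> x \<in> Jp n"
      using nil a unfolding nilp_def by blast
    have "a [^] c \<in> ann Jp Ip 0" using c aR by (simp add: ann_def pow_0)
    moreover have "a [^] c \<in> Jp 0" using aR by (simp add: pow_0)
    ultimately have "mon (a [^] c) 0 \<in> q" using hat_mon[OF _ _ gsub_ann_pow] q(2) by blast
    then show ?thesis
    proof (induction c)
      case 0
      then have "\<one>\<^bsub>A\<^esub> \<in> q" by (simp add: mon_one)
      then have "q = carrier A" using ideal.one_imp_carrier[OF I'] by blast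
      then show ?case using primeideal.I_notcarr[OF q(1)] by blast
    next
      case (Suc c)
      have "mon (a [^] c) 0 \<otimes>\<^bsub>A\<^esub> mon a 0 \<in> q"
        using Suc.prems aR by (simp add: mon_mult)
      then show ?case
        using primeideal.I_prime[OF q(1) A_const A_const[OF aR]] Suc.IH aR by blast
    qed
  qed
  then show "over_m q" using q(1) by (simp add: over_m_def)
qed

lemma hilbert_polynomial:
  assumes fin: "module_length R (ideal_quotient R I J) < \<infinity>"
  shows "\<exists>P :: rat poly.
           (\<forall>\<^sub>F n in sequentially.
              \<exists>k. module_length R (ideal_quotient R (ideal_pow R I n) (ideal_pow R J n)) = enat k \<and>
                  of_nat k = poly P (of_nat n)) \<and>
           (if carrier (rees_quotient R I J) = {\<zero>\<^bsub>rees_quotient R I J\<^esub>}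
            then P = 0
            else ereal (real_of_int (poly_deg P)) =
                   module_dim (rees_algebra R J) (rees_quotient R I J) - 1)"
proof -
  have nil: "nilp Jp Ip" by (rule nilp_pow[OF finite_length_nilpotent[OF J I JI fin]])
  have le: "Jp \<le> Ip" using Jp_Ip by (simp add: le_fun_def)
  have noeth_seq: "noeth_seq J Ip" using reduction by blast
  obtain Q where Q: "hilbert_dim Jp Ip Q" using devissage_pow[OF Ip_gsub noeth_seq Jp_gsub le nil] by blast
  have len: "module_length R (ideal_quotient R (Ip n) (Jp n)) = enat (len (Jp n) (Ip n))" for n
    by (rule module_length_eq_len[OF nilp_has_len[OF Jp_gsub Ip_gsub le nil]])
  have ev: "evpoly (\<lambda>n. len (Jp n) (Ip n)) Q" using Q by (simp add: hilbert_dim_def)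
  show ?thesis
  proof (intro exI conjI)
    show "\<forall>\<^sub>F n in sequentially. \<exists>k. module_length R (ideal_quotient R (Ip n) (Jp n)) = enat k \<and>
        of_nat k = poly Q (of_nat n)"
      using ev unfolding len evpoly_def by eventually_elim blast
    show "if carrier M = {\<zero>\<^bsub>M\<^esub>} then Q = 0
      else ereal (real_of_int (poly_deg Q)) = module_dim (rees_algebra R J) M - 1"
    proof (cases "Ip = Jp")
      case True
      have "Q = 0" by (rule evpoly_zero[OF ev]) (simp add: True len_self[OF Jp_ideal])
      then show ?thesis using True M_trivial_iff by simp
    next
      case False
      \<comment> \<open>\<open>poly_deg\<close> is at least -1, so \<open>nat\<close> loses nothing.
        A nonzero \<open>M\<close> with \<open>Q = 0\<close> has dimension 0, in accordance with
        degree -1.\<close>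
      define d where "d = nat (poly_deg Q + 1)"
      have hilbert_dim: "\<exists>T. ann Jp Ip \<le> T \<and> hchain T d"
        "\<And>T. hprime T \<Longrightarrow> ann Jp Ip \<le> T \<Longrightarrow>
          \<exists>P QP. hprime P \<and> P \<le> T \<and> evpoly (hfun P) QP \<and> poly_deg QP \<le> poly_deg Q"
        using Q False unfolding hilbert_dim_def d_def by auto
      have "krull_dim (A Quot hat (ann Jp Ip)) = ereal (real d)"
        unfolding A.krull_dim_Quot[OF hat_ideal[OF gsub_ann_pow]]
      proof (intro antisym SUP_least)
        fix n assume "n \<in> {n. \<exists>q. hat (ann Jp Ip) \<subseteq> q \<and> pchain A q n}"
        then obtain q where q: "hat (ann Jp Ip) \<subseteq> q" "pchain A q n" by blast
        note om = over_m_ann[OF nil pchain_prime[OF q(2)] q(1)]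
        obtain P QP where P: "hprime P" "P \<le> hpart q" "evpoly (hfun P) QP" "poly_deg QP \<le> poly_deg Q"
          using hilbert_dim(2)[OF hpart_hprime[OF om(1)] om(2)] by blast
        have "n \<le> nat (poly_deg QP + 1)" by (rule pchain_le_degree[OF q(2) om(1) P(1-3)])
        also have "\<dots> \<le> d" unfolding d_def using P(4) by simp
        finally show "ereal (real n) \<le> ereal (real d)" by simp
      next
        obtain T where T: "ann Jp Ip \<le> T" "hchain T d" using hilbert_dim(1) by blast
        have "hat (ann Jp Ip) \<subseteq> hat T" using T(1) by (auto simp: hat_def le_fun_def)
        then show "ereal (real d) \<le> (SUP n \<in> {n. \<exists>q. hat (ann Jp Ip) \<subseteq> q \<and> pchain A q n}. ereal (real n))"
          using hchain_pchain[OF T(2)] by (intro SUP_upper) blast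
      qed
      then have "module_dim (rees_algebra R J) M = ereal (real d)"
        unfolding module_dim_def annihilator_eq by (simp add: A_def)
      moreover have "real_of_int (poly_deg Q) = real d - 1" by (simp add: d_def poly_deg_def)
      ultimately show ?thesis using False M_trivial_iff by (simp add: one_ereal_def)
    qed
  qed
qed

end

end

text \<open>A nonunit lies in a proper ideal. If no proper ideal containing it were maximal, these
  ideals could be enlarged forever, against the chain condition; so it lies in a maximal ideal, and
  the only one is \<open>\<mm>\<close>.\<close>

lemma local_ring_nonunit:
  fixes R (structure)
  assumes "noetherian_ring R" "local_ring R \<mm>" "a \<in> carrier R" "a \<notin> \<mm>"
  shows "a \<in> Units R"
proof (rule ccontr)
  interpret noetherian_ring R by fact
  interpret cring R using assms(2) by (simp add: local_ring_def)
  interpret N: noeth_cring R ..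
  assume nu: "a \<notin> Units R"
  have one: "\<one> \<notin> PIdl a"
  proof
    assume "\<one> \<in> PIdl a"
    then obtain x where "x \<in> carrier R" "\<one> = x \<otimes> a" unfolding cgenideal_def by blast
    then have "a \<in> Units R" using assms(3) m_comm unfolding Units_def by fastforce
    then show False using nu by blast
  qed
  have grow: "\<exists>Y. (ideal Y R \<and> a \<in> Y \<and> \<one> \<notin> Y) \<and> X \<subset> Y" if X: "ideal X R \<and> a \<in> X \<and> \<one> \<notin> X" for X
  proof (rule ccontr)
    assume neg: "\<not> ?thesis"
    have "maximalideal X R"
    proof (rule maximalidealI)
      show "ideal X R" "carrier R \<noteq> X" using X by auto
      fix Y assume Y: "ideal Y R" "X \<subseteq> Y" "Y \<subseteq> carrier R"
      show "Y = X \<or> Y = carrier R"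
        using neg X Y ideal.one_imp_carrier[OF Y(1)] by blast
    qed
    then show False using assms(2,4) X unfolding local_ring_def by blast
  qed
  have "\<exists>f. \<forall>k. (ideal (f k) R \<and> a \<in> f k \<and> \<one> \<notin> f k) \<and> f k \<subset> f (Suc k)"
  proof (rule dependent_nat_choice)
    show "\<exists>X. ideal X R \<and> a \<in> X \<and> \<one> \<notin> X"
      using one cgenideal_ideal[OF assms(3)] cgenideal_self[OF assms(3)] by blast
    show "\<exists>Y. (ideal Y R \<and> a \<in> Y \<and> \<one> \<notin> Y) \<and> X \<subset> Y" if "ideal X R \<and> a \<in> X \<and> \<one> \<notin> X" for X and n :: nat
      using that by (rule grow)
  qed
  then obtain f where f: "\<And>k. (ideal (f k) R \<and> a \<in> f k \<and> \<one> \<notin> f k) \<and> f k \<subset> f (Suc k)" by blast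
  have "\<exists>n. \<forall>k\<ge>n. f k = f n"
  proof (rule N.ideal_chain_stable)
    show "ideal (f k) R" for k using f[of k] by simp
    show "f k \<subseteq> f (Suc k)" for k using f[of k] by (simp add: psubset_imp_subset)
  qed
  then obtain n where "\<forall>k\<ge>n. f k = f n" by (rule exE)
  from this[rule_format, of "Suc n"] have "f (Suc n) = f n" by simp
  then show False using f[of n] by simp
qed

theorem corollary4p7:
  fixes R :: "('a, 'b) ring_scheme" and \<mm> I J :: "'a set" and d :: nat
  assumes "noetherian_ring R"
    and "local_ring R \<mm>"
    and "krull_dim R = ereal (real d)"
    and "ideal I R" and "ideal J R" and "J \<subseteq> I"
    and "is_reduction R J I"
    and "module_length R (ideal_quotient R I J) < \<infinity>"
  shows "\<exists>P :: rat poly.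
           (\<forall>\<^sub>F n in sequentially.
              \<exists>k. module_length R (ideal_quotient R (ideal_pow R I n) (ideal_pow R J n)) = enat k \<and>
                  of_nat k = poly P (of_nat n)) \<and>
           (if carrier (rees_quotient R I J) = {\<zero>\<^bsub>rees_quotient R I J\<^esub>}
            then P = 0
            else ereal (real_of_int (poly_deg P)) =
                   module_dim (rees_algebra R J) (rees_quotient R I J) - 1)"
proof -
  have "cring R" "maximalideal \<mm> R" using assms(2) by (simp_all add: local_ring_def)
  then have "noeth_local_ideal R \<mm> J"
    using assms(1,5) local_ring_nonunit[OF assms(1,2)]
    by (intro noeth_local_ideal.intro noeth_local.intro noeth_cring.intro
        noeth_local_axioms.intro noeth_local_ideal_axioms.intro)
  then show ?thesis
    using noeth_local_ideal.hilbert_polynomial[of R \<mm> J I] assms by blast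
qed

end
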